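(* Let $d_1,d_2\ge1$ and let $A(B_i,C_i)$ be a $d_i$-representation infinite algebra of type $\widetilde A$ for $i=1,2$. Then the tensor product \[A(B_1,C_1)\otimes_kA(B_2,C_2)\] is a $(d_1+d_2)$-representation infinite algebra of type $\widetilde A\widetilde A$.
   Context: $k$ is an arbitrary field. Being of type $\widetilde A\widetilde A$ is understood up to isomorphism of algebras. Algebras of type $\widetilde A$. Let $d\ge1$, let $f_0,\dots,f_d$ be the unit vectors of $\mathbb Z^{d+1}$, $\alpha_i=f_i-f_{i-1}$ for $1\le i\le d$, $\alpha_0=f_0-f_d$, and $L=\{v\in\mathbb Z^{d+1}\mid\sum v_i=0\}$. For a cofinite (finite index) subgroup $B\subset L$, let $Q$ be the finite quiver with vertex set $L/B$ and, for each vertex $x+B$ and each $0\le i\le d$, one arrow $x+B\to x+\alpha_i+B$ of type $i$. An elementary cycle of $Q$ is a cycle of length $d+1$ consisting of arrows of $d+1$ distinct types. A cut of $Q$ is a subset $C\subset Q_1$ such that every elementary cycle has exactly one arrow in $C$; it is bounding if $Q_C=(Q_0,Q_1\setminus C)$ is acyclic. $A(B,C)=kQ_C/I_C$, where $I_C$ is generated by all commutativity relations $(x+B\to x+\alpha_i+B\to x+\alpha_i+\alpha_j+B)=(x+B\to x+\alpha_j+B\to x+\alpha_i+\alpha_j+B)$ for which all four arrows lie in $Q_C$. A $d$-representation infinite algebra of type $\widetilde A$ is an algebra $A(B,C)$ with $C$ bounding. Algebras of type $\widetilde A\widetilde A$. Polytope and group $H$. Let $N\cong\mathbb Z^d$,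 $M=\operatorname{Hom}_{\mathbb Z}(N,\mathbb Z)$, and let $P\subset N_{\mathbb R}$ be a $d$-dimensional simplicial lattice polytope with exactly $d+2$ vertices. Let $F$ be the free abelian group on the vertices, $\mathbf p\in F$ the sum of all basis elements, $A_P\colon M\to F$ the map sending $m$ to the vector whose coordinate at a vertex $v$ is $\langle m,v\rangle$, and $H=F/(A_P(M)+\mathbb Z\mathbf p)$, a group of rank one, with projection $\deg_H\colon F\to H$ and $\pi\colon H\to H/H_{\rm tors}\cong\mathbb Z$. The vertices can be labelled $v_0,\dots,v_l,v'_0,\dots,v'_{l'}$ with $l,l'\ge1$, $l+l'=d$, with basis elements $e_i,e'_{i'}$ of $F$ and images $\bar x_i=\deg_H(e_i)$, $\bar x'_{i'}=\deg_H(e'_{i'})$, such that $\pi(\bar x_i)>0$ and $\pi(\bar x'_{i'})<0$. Order $H$ by $h_1\ge h_2$ iff $h_1-h_2\in\sum_i\mathbb Z_{\ge0}\bar x_i+\sum_{i'}\mathbb Z_{\ge0}(-\bar x'_{i'})$, and put $s=\sum_i\bar x_i=-\sum_{i'}\bar x'_{i'}$. Let $I\subset H$ be a non-trivial upper set (closed under going up, $\ne\emptyset,H$) and put $J=J(I)=I\cap(I^c+s)$; it is a complete set of representatives of $H/\mathbb Zs$. Quiver $Q(C)$. Let $f_0,\dots,f_l$ be the unit vectors of $\mathbb Z^{l+1}$, $\alpha_i=f_i-f_{i-1}$ for $1\le i\le l$, $\alpha_0=f_0-f_l$, and $L=\{v\in\mathbb Z^{l+1}\mid\sum v_i=0\}$.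 Let $f'_0,\dots,f'_{l'}$ be the unit vectors of $\mathbb Z^{l'+1}$, $\alpha'_{i'}=f'_{i'}-f'_{i'-1}$ for $1\le i'\le l'$, $\alpha'_0=f'_0-f'_{l'}$, and $L'=\{v\in\mathbb Z^{l'+1}\mid\sum v_{i'}=0\}$. Let $\Psi\colon L\oplus L'\to H/\mathbb Zs$ be the surjection $\alpha_i\mapsto\bar x_i$, $\alpha'_{i'}\mapsto\bar x'_{i'}$ and $B=\ker\Psi$. Let $\widehat Q$ be the quiver with vertex set $L\oplus L'$ and arrows $x\to x+\alpha_i$, $x\to x+\alpha'_{i'}$ for all $x,i,i'$. For $x\in L\oplus L'$ let $h_x\in J$ be the representative of $\Psi(x)$. Let $\widehat C$ be the set of arrows $x\to x+\alpha_i$ with $h_x+\bar x_i\notin J$ and arrows $x\to x+\alpha'_{i'}$ with $h_x+\bar x'_{i'}\notin J$. The quiver $\widehat Q(\widehat C)$ has vertex set $L\oplus L'$ and arrows $\widehat Q_1\setminus\widehat C$ together with one new arrow $x\to x+\alpha_i+\alpha'_{i'}$ for every $x,i,i'$ such that both $x\to x+\alpha_i$ and $x\to x+\alpha'_{i'}$ lie in $\widehat C$. $B$ acts by translation; put $Q(C)=\widehat Q(\widehat C)/B$ and $C=C(I)=\widehat C/B$. Cuts of $Q(C)$. Arrows of $Q(C)$ have labels in $F$: $\lambda(x\to x+\alpha_i)=e_i$, $\lambda(x\to x+\alpha'_{i'})=e'_{i'}$, $\lambda(x\to x+\alpha_i+\alpha'_{i'})=e_i+e'_{i'}$; $\lambda(\gamma)$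 of a path $\gamma$ is the sum of labels of its arrows. An elementary cycle of $Q(C)$ is a cycle $c$ with $\lambda(c)=\mathbf p$. For $C'\subset Q(C)_1$ let $\varepsilon_{C'}(\gamma)$ be the number of arrows of $\gamma$ (with multiplicity) lying in $C'$. $C'$ is a cut of $Q(C)$ if (i) every elementary cycle has exactly one arrow in $C'$, and (ii) $\varepsilon_{C'}(\gamma)=\varepsilon_{C'}(\gamma')$ for paths $\gamma,\gamma'$ with the same source, the same target and $\lambda(\gamma)=\lambda(\gamma')$. Type: for a cut $C'$ and $b\in B$ choose $x\in L\oplus L'$ and a path $\gamma\colon x\to x+b$ in $\widehat Q(\widehat C)$ and put $\kappa_{C'}(b)=\lambda(\gamma)-\varepsilon_{C'}(\gamma)\mathbf p\in F$ (computed on the image of $\gamma$ in $Q(C)$); this is well defined, gives a homomorphism $\kappa_{C'}\colon B\to F$, and there is a unique $u(C')\in N$ with $\operatorname{Im}\kappa_{C'}=\{A_P(m)-\langle m,u(C')\rangle\mathbf p\mid m\in M\}$. One has $u(C')\in P\cap N$; $u(C')$ is the type of $C'$. $\Gamma(B,C)=kQ(C)/I(C)$, where $I(C)$ is generated by all $\gamma-\gamma'$ with $\gamma,\gamma'$ paths of positive length with the same source, same target and $\lambda(\gamma)=\lambda(\gamma')$. A cut $C'$ defines a $\mathbb Z_{\ge0}$-grading on $\Gamma(B,C)$ by $|\gamma|=\varepsilon_{C'}(\gamma)$, and $A(B,C,C')=\Gamma(B,C)_0$ is the degree $0$ part. A $d$-representation infinite algebra of type $\widetilde A\widetilde A$ is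 an algebra $A(B,C,C')$ arising from some such $P$, $I$ (with $C=C(I)$) and some cut $C'$ of $Q(C)$ whose type lies in the interior of $P$. *)

theory Defs
  imports
    "HOL-Analysis.Analysis"
    "HOL-Algebra.QuotRing"
    "HOL-Algebra.Module"
    "HOL-Algebra.Free_Abelian_Groups"
    "HOL-Library.Function_Algebras"
    "HOL-Library.Product_Plus"
    "Graph_Theory.Digraph"
    "Graph_Theory.Arc_Walk"
begin

section \<open>Algebras over a field\<close>

text \<open>
  The ground field is an arbitrary type of class \<open>field\<close>. An algebra is a HOL-Algebra ring
  together with the scalar multiplication of the record \<open>module\<close>.
\<close>

definition alg_iso :: "('k, 'a) module \<Rightarrow> ('k, 'b) module \<Rightarrow> bool" where
  "alg_iso A A' \<longleftrightarrow> (\<exists>h \<in> ring_iso A A'.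
     \<forall>c. \<forall>x \<in> carrier A. h (c \<odot>\<^bsub>A\<^esub> x) = c \<odot>\<^bsub>A'\<^esub> h x)"

definition single :: "'x \<Rightarrow> 'x \<Rightarrow> 'k::field" where
  "single x = (\<lambda>y. if y = x then 1 else 0)"

abbreviation support :: "('x \<Rightarrow> 'k::field) \<Rightarrow> 'x set" where
  "support f \<equiv> {x. f x \<noteq> 0}"

abbreviation scl :: "'k::field \<Rightarrow> ('x \<Rightarrow> 'k) \<Rightarrow> 'x \<Rightarrow> 'k" where
  "scl \<equiv> (\<lambda>c f x. c * f x)"

text \<open>
  The algebra with basis \<open>X\<close> in which the product of two basis elements is a basis element, or
  zero (rendered as \<open>None\<close>); the unit is the sum of the elements of \<open>E\<close>.
\<close>

definition basis_algebra ::
  "'x set \<Rightarrow> ('x \<Rightarrow> 'x \<Rightarrow> 'x option) \<Rightarrow> 'x set \<Rightarrow> ('k::field, 'x \<Rightarrow> 'k) module" where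
  "basis_algebra X m E = \<lparr>
     carrier = {f. finite (support f) \<and> support f \<subseteq> X},
     mult = (\<lambda>f g z. \<Sum>x\<in>support f. \<Sum>y\<in>support g. if m x y = Some z then f x * g y else 0),
     one = (\<lambda>x. if x \<in> E then 1 else 0),
     ring.zero = 0,
     add = (+),
     smult = scl\<rparr>"

definition quotient_algebra :: "('k, 'a) module \<Rightarrow> 'a set \<Rightarrow> ('k, 'a set) module" where
  "quotient_algebra A I = \<lparr>
     carrier = carrier (A Quot I),
     mult = mult (A Quot I),
     one = one (A Quot I),
     ring.zero = ring.zero (A Quot I),
     add = add (A Quot I),
     smult = (\<lambda>c X. \<Union>x\<in>X. I +>\<^bsub>A\<^esub> (c \<odot>\<^bsub>A\<^esub> x))\<rparr>"

text \<open>
  The tensor product: the free vector space on pairs, modulo the subspace spanned by the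
  bilinearity relations, with \<open>(a \<otimes> b)(a' \<otimes> b') = aa' \<otimes> bb'\<close>.
\<close>

definition bilinearity_relations ::
  "('k::field, 'a) module \<Rightarrow> ('k, 'b) module \<Rightarrow> ('a \<times> 'b \<Rightarrow> 'k) set" where
  "bilinearity_relations A A' =
     {single (a \<oplus>\<^bsub>A\<^esub> a', b) - single (a, b) - single (a', b) | a a' b.
        a \<in> carrier A \<and> a' \<in> carrier A \<and> b \<in> carrier A'} \<union>
     {single (a, b \<oplus>\<^bsub>A'\<^esub> b') - single (a, b) - single (a, b') | a b b'.
        a \<in> carrier A \<and> b \<in> carrier A' \<and> b' \<in> carrier A'} \<union>
     {single (c \<odot>\<^bsub>A\<^esub> a, b) - scl c (single (a, b)) | c a b.
        a \<in> carrier A \<and> b \<in> carrier A'} \<union>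
     {single (a, c \<odot>\<^bsub>A'\<^esub> b) - scl c (single (a, b)) | c a b.
        a \<in> carrier A \<and> b \<in> carrier A'}"

definition tensor_algebra ::
  "('k::field, 'a) module \<Rightarrow> ('k, 'b) module \<Rightarrow> ('k, ('a \<times> 'b \<Rightarrow> 'k) set) module" where
  "tensor_algebra A A' = quotient_algebra
     (basis_algebra (carrier A \<times> carrier A')
        (\<lambda>(a, b) (a', b'). Some (a \<otimes>\<^bsub>A\<^esub> a', b \<otimes>\<^bsub>A'\<^esub> b'))
        {(\<one>\<^bsub>A\<^esub>, \<one>\<^bsub>A'\<^esub>)})
     (Modules.module.span scl (bilinearity_relations A A'))"


section \<open>Quivers and path algebras\<close>

text \<open>
  A quiver is a \<open>pre_digraph\<close>. A path is a start vertex together with the list of its arrows, in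
  the order in which they are traversed; products of paths are written in the same order. (Passing
  to the other common convention replaces every algebra below by its opposite.)
\<close>

definition is_path :: "('v, 'a) pre_digraph \<Rightarrow> 'v \<Rightarrow> 'a list \<Rightarrow> 'v \<Rightarrow> bool" where
  "is_path Q x p y \<longleftrightarrow> pre_digraph.awalk Q x p y"

definition paths :: "('v, 'a) pre_digraph \<Rightarrow> ('v \<times> 'a list) set" where
  "paths Q = {(x, p). \<exists>y. is_path Q x p y}"

definition compose_paths ::
  "('v, 'a) pre_digraph \<Rightarrow> 'v \<times> 'a list \<Rightarrow> 'v \<times> 'a list \<Rightarrow> ('v \<times> 'a list) option" where
  "compose_paths Q = (\<lambda>(x, p) (y, q). if is_path Q x p y then Some (x, p @ q) else None)"

definition path_algebra ::
  "('v, 'a) pre_digraph \<Rightarrow> ('k::field, 'v \<times> 'a list \<Rightarrow> 'k) module" where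
  "path_algebra Q = basis_algebra (paths Q) (compose_paths Q) {(x, []) | x. x \<in> verts Q}"

definition acyclic_quiver :: "('v, 'a) pre_digraph \<Rightarrow> bool" where
  "acyclic_quiver Q \<longleftrightarrow> (\<nexists>x p. p \<noteq> [] \<and> is_path Q x p x)"

text \<open>The number of arrows of a path, counted with multiplicity, that lie in \<open>C\<close>.\<close>

definition eps :: "'a set \<Rightarrow> 'a list \<Rightarrow> nat" where
  "eps C p = length (filter (\<lambda>a. a \<in> C) p)"


section \<open>Algebras of type \<open>\<A>\<close>-tilde\<close>

text \<open>\<open>\<int>\<^sup>d\<^sup>+\<^sup>1\<close> is the set of functions \<open>nat \<Rightarrow> int\<close> vanishing outside \<open>{..d}\<close>.\<close>

definition unit_vec :: "nat \<Rightarrow> nat \<Rightarrow> int" where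
  "unit_vec i = (\<lambda>j. if j = i then 1 else 0)"

definition alpha :: "nat \<Rightarrow> nat \<Rightarrow> nat \<Rightarrow> int" where
  "alpha d i = (if i = 0 then unit_vec 0 - unit_vec d else unit_vec i - unit_vec (i - 1))"

definition root_lattice :: "nat \<Rightarrow> (nat \<Rightarrow> int) set" where
  "root_lattice d = {v. (\<forall>i>d. v i = 0) \<and> (\<Sum>i\<le>d. v i) = 0}"

definition add_group :: "'a::ab_group_add set \<Rightarrow> 'a monoid" where
  "add_group S = \<lparr>carrier = S, mult = (+), one = 0\<rparr>"

abbreviation root_group :: "nat \<Rightarrow> (nat \<Rightarrow> int) monoid" where
  "root_group d \<equiv> add_group (root_lattice d)"

text \<open>The arrow of type \<open>i\<close> starting at the coset \<open>X\<close> is the pair \<open>(X, i)\<close>.\<close>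

definition quiverA ::
  "nat \<Rightarrow> (nat \<Rightarrow> int) set \<Rightarrow> ((nat \<Rightarrow> int) set, (nat \<Rightarrow> int) set \<times> nat) pre_digraph" where
  "quiverA d B = \<lparr>
     verts = rcosets\<^bsub>root_group d\<^esub> B,
     arcs = (rcosets\<^bsub>root_group d\<^esub> B) \<times> {..d},
     tail = fst,
     head = (\<lambda>(X, i). X #>\<^bsub>root_group d\<^esub> alpha d i)\<rparr>"

definition elementary_cycleA ::
  "nat \<Rightarrow> (nat \<Rightarrow> int) set \<Rightarrow> ((nat \<Rightarrow> int) set \<times> nat) list \<Rightarrow> bool" where
  "elementary_cycleA d B c \<longleftrightarrow>
     (\<exists>X. is_path (quiverA d B) X c X) \<and> length c = d + 1 \<and> distinct (map snd c)"

definition cutA :: "nat \<Rightarrow> (nat \<Rightarrow> int) set \<Rightarrow> ((nat \<Rightarrow> int) set \<times> nat) set \<Rightarrow> bool" where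
  "cutA d B C \<longleftrightarrow>
     C \<subseteq> arcs (quiverA d B) \<and> (\<forall>c. elementary_cycleA d B c \<longrightarrow> eps C c = 1)"

definition cut_quiverA ::
  "nat \<Rightarrow> (nat \<Rightarrow> int) set \<Rightarrow> ((nat \<Rightarrow> int) set \<times> nat) set \<Rightarrow>
     ((nat \<Rightarrow> int) set, (nat \<Rightarrow> int) set \<times> nat) pre_digraph" where
  "cut_quiverA d B C = (quiverA d B)\<lparr>arcs := arcs (quiverA d B) - C\<rparr>"

definition boundingA :: "nat \<Rightarrow> (nat \<Rightarrow> int) set \<Rightarrow> ((nat \<Rightarrow> int) set \<times> nat) set \<Rightarrow> bool" where
  "boundingA d B C \<longleftrightarrow> acyclic_quiver (cut_quiverA d B C)"

definition commutativity_relations ::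
  "nat \<Rightarrow> (nat \<Rightarrow> int) set \<Rightarrow> ((nat \<Rightarrow> int) set \<times> nat) set \<Rightarrow>
     ((nat \<Rightarrow> int) set \<times> ((nat \<Rightarrow> int) set \<times> nat) list \<Rightarrow> 'k::field) set" where
  "commutativity_relations d B C =
     {single (X, [(X, i), (X #>\<^bsub>root_group d\<^esub> alpha d i, j)])
        - single (X, [(X, j), (X #>\<^bsub>root_group d\<^esub> alpha d j, i)]) | X i j.
        {(X, i), (X #>\<^bsub>root_group d\<^esub> alpha d i, j), (X, j), (X #>\<^bsub>root_group d\<^esub> alpha d j, i)}
          \<subseteq> arcs (cut_quiverA d B C)}"

definition algebraA ::
  "nat \<Rightarrow> (nat \<Rightarrow> int) set \<Rightarrow> ((nat \<Rightarrow> int) set \<times> nat) set \<Rightarrow>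
     ('k::field, ((nat \<Rightarrow> int) set \<times> ((nat \<Rightarrow> int) set \<times> nat) list \<Rightarrow> 'k) set) module" where
  "algebraA d B C =
     (let kQ = path_algebra (cut_quiverA d B C)
      in quotient_algebra kQ (Idl\<^bsub>kQ\<^esub> (commutativity_relations d B C)))"

text \<open>
  The pairs \<open>(B, C)\<close> such that \<open>algebraA d B C\<close> is a \<open>d\<close>-representation infinite algebra of type
  \<open>\<A>\<close>-tilde.
\<close>

definition rep_infinite_datumA ::
  "nat \<Rightarrow> (nat \<Rightarrow> int) set \<Rightarrow> ((nat \<Rightarrow> int) set \<times> nat) set \<Rightarrow> bool" where
  "rep_infinite_datumA d B C \<longleftrightarrow>
     subgroup B (root_group d) \<and> finite (rcosets\<^bsub>root_group d\<^esub> B) \<and>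
     cutA d B C \<and> boundingA d B C"


section \<open>Algebras of type \<open>\<A>\<A>\<close>-tilde\<close>

text \<open>
  \<open>Lft i\<close>, \<open>Rgt i'\<close> and \<open>New i i'\<close> mark the arrows \<open>x \<rightarrow> x + \<alpha>\<^sub>i\<close>, \<open>x \<rightarrow> x + \<alpha>'\<^sub>i\<^sub>'\<close> and the new arrows
  \<open>x \<rightarrow> x + \<alpha>\<^sub>i + \<alpha>'\<^sub>i\<^sub>'\<close>.
\<close>

datatype arrow = Lft nat | Rgt nat | New nat nat

type_synonym pt = "(nat \<Rightarrow> int) \<times> (nat \<Rightarrow> int)"

text \<open>
  The lattice \<open>N\<close> is \<open>int ^ 'n\<close>, so that \<open>d = CARD('n)\<close>, and \<open>M = Hom(N, \<int>)\<close> consists of the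
  additive maps \<open>int ^ 'n \<Rightarrow> int\<close>.
\<close>

definition lat :: "int ^ 'n \<Rightarrow> real ^ 'n" where
  "lat v = (\<chi> i. real_of_int (v $ i))"

locale AA_construction =
  fixes P :: "(real ^ 'n::finite) set"
    and l l' :: nat
    and v v' :: "nat \<Rightarrow> int ^ 'n"
    and I :: "(int ^ 'n \<Rightarrow>\<^sub>0 int) set set"
begin

subsection \<open>The polytope and the group \<open>H\<close>\<close>

definition V :: "(int ^ 'n) set" where
  "V = {w. lat w extreme_point_of P}"

definition simplicial_lattice_polytope :: bool where
  "simplicial_lattice_polytope \<longleftrightarrow>
     polytope P \<and> aff_dim P = int CARD('n) \<and>
     (\<forall>x. x extreme_point_of P \<longrightarrow> x \<in> range lat) \<and>
     (\<forall>S. S facet_of P \<longrightarrow> (\<exists>n. n simplex S))"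

abbreviation F :: "(int ^ 'n \<Rightarrow>\<^sub>0 int) monoid" where
  "F \<equiv> free_Abelian_group V"

definition pvec :: "int ^ 'n \<Rightarrow>\<^sub>0 int" where
  "pvec = (\<Sum>w\<in>V. frag_of w)"

definition M :: "(int ^ 'n \<Rightarrow> int) set" where
  "M = {m. Modules.additive m}"

definition A_P :: "(int ^ 'n \<Rightarrow> int) \<Rightarrow> (int ^ 'n \<Rightarrow>\<^sub>0 int)" where
  "A_P m = (\<Sum>w\<in>V. frag_cmul (m w) (frag_of w))"

definition K :: "(int ^ 'n \<Rightarrow>\<^sub>0 int) set" where
  "K = {A_P m + frag_cmul c pvec | m c. m \<in> M}"

definition H :: "(int ^ 'n \<Rightarrow>\<^sub>0 int) set monoid" where
  "H = F Mod K"

definition deg :: "(int ^ 'n \<Rightarrow>\<^sub>0 int) \<Rightarrow> (int ^ 'n \<Rightarrow>\<^sub>0 int) set" where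
  "deg f = K #>\<^bsub>F\<^esub> f"

definition xbar :: "nat \<Rightarrow> (int ^ 'n \<Rightarrow>\<^sub>0 int) set" where
  "xbar i = deg (frag_of (v i))"

definition xbar' :: "nat \<Rightarrow> (int ^ 'n \<Rightarrow>\<^sub>0 int) set" where
  "xbar' i = deg (frag_of (v' i))"

text \<open>\<open>\<pi>\<close> is the projection modulo torsion followed by an isomorphism onto \<open>\<int>\<close>.\<close>

definition projection_mod_torsion :: "((int ^ 'n \<Rightarrow>\<^sub>0 int) set \<Rightarrow> int) \<Rightarrow> bool" where
  "projection_mod_torsion \<pi> \<longleftrightarrow>
     \<pi> \<in> hom H integer_group \<and> \<pi> ` carrier H = UNIV \<and>
     kernel H integer_group \<pi> = {h \<in> carrier H. \<exists>n::nat. n > 0 \<and> h [^]\<^bsub>H\<^esub> n = \<one>\<^bsub>H\<^esub>}"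

definition labelling :: bool where
  "labelling \<longleftrightarrow>
     l \<ge> 1 \<and> l' \<ge> 1 \<and> l + l' = CARD('n) \<and>
     bij_betw (case_sum v v') ({..l} <+> {..l'}) V \<and>
     (\<exists>\<pi>. projection_mod_torsion \<pi> \<and>
        (\<forall>i\<le>l. \<pi> (xbar i) > 0) \<and> (\<forall>i\<le>l'. \<pi> (xbar' i) < 0))"

definition geqH :: "(int ^ 'n \<Rightarrow>\<^sub>0 int) set \<Rightarrow> (int ^ 'n \<Rightarrow>\<^sub>0 int) set \<Rightarrow> bool" where
  "geqH h1 h2 \<longleftrightarrow> h1 \<otimes>\<^bsub>H\<^esub> inv\<^bsub>H\<^esub> h2 \<in>
     {deg ((\<Sum>i\<le>l. frag_cmul (int (a i)) (frag_of (v i)))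
           - (\<Sum>i\<le>l'. frag_cmul (int (b i)) (frag_of (v' i)))) | a b :: nat \<Rightarrow> nat. True}"

definition s :: "(int ^ 'n \<Rightarrow>\<^sub>0 int) set" where
  "s = deg (\<Sum>i\<le>l. frag_of (v i))"

definition nontrivial_upper_set :: bool where
  "nontrivial_upper_set \<longleftrightarrow>
     I \<subseteq> carrier H \<and> I \<noteq> {} \<and> I \<noteq> carrier H \<and>
     (\<forall>h\<in>I. \<forall>g\<in>carrier H. geqH g h \<longrightarrow> g \<in> I)"

definition J :: "(int ^ 'n \<Rightarrow>\<^sub>0 int) set set" where
  "J = I \<inter> (\<lambda>h. h \<otimes>\<^bsub>H\<^esub> s) ` (carrier H - I)"

subsection \<open>The quiver \<open>Q(C)\<close>\<close>

definition LL :: "pt monoid" where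
  "LL = add_group (root_lattice l \<times> root_lattice l')"

definition Zs :: "(int ^ 'n \<Rightarrow>\<^sub>0 int) set set" where
  "Zs = generate H {s}"

text \<open>
  The defining property determines \<open>Psi\<close> on the carrier of \<open>LL\<close>, which is all that is used
  below.
\<close>

definition Psi :: "pt \<Rightarrow> (int ^ 'n \<Rightarrow>\<^sub>0 int) set set" where
  "Psi = (SOME f. f \<in> hom LL (H Mod Zs) \<and>
     (\<forall>i\<le>l. f (alpha l i, 0) = Zs #>\<^bsub>H\<^esub> xbar i) \<and>
     (\<forall>i\<le>l'. f (0, alpha l' i) = Zs #>\<^bsub>H\<^esub> xbar' i))"

definition B :: "pt set" where
  "B = kernel LL (H Mod Zs) Psi"

definition hrep :: "pt \<Rightarrow> (int ^ 'n \<Rightarrow>\<^sub>0 int) set" where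
  "hrep x = (THE h. h \<in> J \<and> Zs #>\<^bsub>H\<^esub> h = Psi x)"

fun disp :: "arrow \<Rightarrow> pt" where
  "disp (Lft i) = (alpha l i, 0)"
| "disp (Rgt i) = (0, alpha l' i)"
| "disp (New i j) = (alpha l i, alpha l' j)"

definition arcs_hat :: "(pt \<times> arrow) set" where
  "arcs_hat = carrier LL \<times> (Lft ` {..l} \<union> Rgt ` {..l'})"

definition C_hat :: "(pt \<times> arrow) set" where
  "C_hat =
     {(x, Lft i) | x i. x \<in> carrier LL \<and> i \<le> l \<and> hrep x \<otimes>\<^bsub>H\<^esub> xbar i \<notin> J} \<union>
     {(x, Rgt i) | x i. x \<in> carrier LL \<and> i \<le> l' \<and> hrep x \<otimes>\<^bsub>H\<^esub> xbar' i \<notin> J}"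

definition QC_hat :: "(pt, pt \<times> arrow) pre_digraph" where
  "QC_hat = \<lparr>
     verts = carrier LL,
     arcs = (arcs_hat - C_hat) \<union>
       {(x, New i j) | x i j. (x, Lft i) \<in> C_hat \<and> (x, Rgt j) \<in> C_hat},
     tail = fst,
     head = (\<lambda>(x, a). x + disp a)\<rparr>"

text \<open>
  Translation by \<open>B\<close> moves the source of an arrow and keeps its mark, so the orbit of \<open>(x, a)\<close>
  is encoded as \<open>(x + B, a)\<close>.
\<close>

definition proj_arrow :: "pt \<times> arrow \<Rightarrow> pt set \<times> arrow" where
  "proj_arrow = (\<lambda>(x, a). (B #>\<^bsub>LL\<^esub> x, a))"

definition QC :: "(pt set, pt set \<times> arrow) pre_digraph" where
  "QC = \<lparr>
     verts = rcosets\<^bsub>LL\<^esub> B,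
     arcs = proj_arrow ` arcs QC_hat,
     tail = fst,
     head = (\<lambda>(X, a). X #>\<^bsub>LL\<^esub> disp a)\<rparr>"

subsection \<open>Cuts of \<open>Q(C)\<close> and their type\<close>

fun label :: "arrow \<Rightarrow> (int ^ 'n \<Rightarrow>\<^sub>0 int)" where
  "label (Lft i) = frag_of (v i)"
| "label (Rgt i) = frag_of (v' i)"
| "label (New i j) = frag_of (v i) + frag_of (v' j)"

definition path_label :: "('x \<times> arrow) list \<Rightarrow> (int ^ 'n \<Rightarrow>\<^sub>0 int)" where
  "path_label p = (\<Sum>a\<leftarrow>p. label (snd a))"

definition elementary_cycle :: "(pt set \<times> arrow) list \<Rightarrow> bool" where
  "elementary_cycle c \<longleftrightarrow> (\<exists>X. is_path QC X c X) \<and> path_label c = pvec"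

definition cut :: "(pt set \<times> arrow) set \<Rightarrow> bool" where
  "cut C' \<longleftrightarrow>
     C' \<subseteq> arcs QC \<and>
     (\<forall>c. elementary_cycle c \<longrightarrow> eps C' c = 1) \<and>
     (\<forall>X Y p q. is_path QC X p Y \<and> is_path QC X q Y \<and> path_label p = path_label q \<longrightarrow>
        eps C' p = eps C' q)"

definition kappa :: "(pt set \<times> arrow) set \<Rightarrow> pt \<Rightarrow> (int ^ 'n \<Rightarrow>\<^sub>0 int)" where
  "kappa C' b = (THE f. \<exists>x p. is_path QC_hat x p (x + b) \<and>
     f = path_label p - frag_cmul (int (eps C' (map proj_arrow p))) pvec)"

definition cut_type :: "(pt set \<times> arrow) set \<Rightarrow> int ^ 'n" where
  "cut_type C' = (THE u. kappa C' ` B = {A_P m - frag_cmul (m u) pvec | m. m \<in> M})"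

subsection \<open>The algebras\<close>

definition path_relations :: "(pt set \<times> (pt set \<times> arrow) list \<Rightarrow> 'k::field) set" where
  "path_relations =
     {single (X, p) - single (X, q) | X p q. p \<noteq> [] \<and> q \<noteq> [] \<and> path_label p = path_label q \<and>
        (\<exists>Y. is_path QC X p Y \<and> is_path QC X q Y)}"

definition relation_ideal :: "(pt set \<times> (pt set \<times> arrow) list \<Rightarrow> 'k::field) set" where
  "relation_ideal = Idl\<^bsub>path_algebra QC\<^esub> path_relations"

definition Gamma ::
  "('k::field, (pt set \<times> (pt set \<times> arrow) list \<Rightarrow> 'k) set) module" where
  "Gamma = quotient_algebra (path_algebra QC) relation_ideal"

definition algebraAA :: "(pt set \<times> arrow) set \<Rightarrow>
    ('k::field, (pt set \<times> (pt set \<times> arrow) list \<Rightarrow> 'k) set) module" where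
  "algebraAA C' = Gamma\<lparr>carrier :=
     {relation_ideal +>\<^bsub>path_algebra QC\<^esub> f | f.
        f \<in> carrier (path_algebra QC) \<and> (\<forall>(X, p) \<in> support f. eps C' p = 0)}\<rparr>"

definition admissible :: "(pt set \<times> arrow) set \<Rightarrow> bool" where
  "admissible C' \<longleftrightarrow>
     simplicial_lattice_polytope \<and> card V = CARD('n) + 2 \<and> labelling \<and> nontrivial_upper_set \<and>
     cut C' \<and> lat (cut_type C') \<in> interior P"

end

text \<open>
  \<open>A\<close> is (up to isomorphism) a \<open>CARD('n)\<close>-representation infinite algebra of type
  \<open>\<A>\<A>\<close>-tilde.
\<close>

definition rep_infinite_AA :: "'n::finite itself \<Rightarrow> ('k::field, 'a) module \<Rightarrow> bool" where
  "rep_infinite_AA T A \<longleftrightarrow>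
     (\<exists>(P :: (real ^ 'n) set) l l' v v' I C'.
        AA_construction.admissible P l l' v v' I C' \<and>
        alg_iso A (AA_construction.algebraAA P l l' v v' I C'))"

end

theory Submission
  imports Defs "HOL-Algebra.Multiplicative_Group"
begin

text \<open>
  Write a vertex of the quiver of type \<open>\<A>\<close>-tilde as the class of \<open>\<Sum> f\<^sub>i \<alpha>\<^sub>i\<close> with \<open>f\<close> an integer vector.
  A cut \<open>C\<close> has a potential \<open>\<theta>\<close>: it grows by 1 along the arrows in \<open>C\<close> and by 0 along the others. On the
  period lattice \<open>{f. \<Sum> f\<^sub>i \<alpha>\<^sub>i \<in> B}\<close> it is linear, and up to a factor it equals \<open>\<Sum> \<mu>\<^sub>i f\<^sub>i\<close>, where \<open>\<mu>\<^sub>i > 0\<close>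
  because \<open>C\<close> is bounding. Let \<open>D\<close> be the periods with \<open>\<theta> f = 0\<close>. Expressing the elements of
  \<open>D\<^sub>1 \<oplus> D\<^sub>2\<close> in a \<open>\<int>\<close>-basis gives vectors \<open>v\<^sub>i\<close>, \<open>v'\<^sub>j\<close> in \<open>\<int>\<^sup>d\<close> whose only linear relations are the
  combinations of \<open>\<Sum> \<mu>\<^sub>i v\<^sub>i = 0\<close> and \<open>\<Sum> \<mu>'\<^sub>j v'\<^sub>j = 0\<close>. Hence they are the vertices of a simplicial polytope
  with 0 in its interior.

  On \<open>H\<close> the function \<open>\<Phi> = \<theta>\<^sub>1 - \<theta>\<^sub>2\<close> is well defined. For the upper set \<open>{\<Phi> \<ge> 0}\<close> one gets
  \<open>J = {\<Phi> = 0}\<close>, so the arrows of \<open>Q(C)\<close> that are not new are exactly the arrows of the product quiver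
  moving one factor along an arrow outside its cut, and a new arrow moves both factors along arrows in
  their cuts. The new arrows form a cut of type 0. A path of degree 0 is, up to the relations, a pair of
  classes of paths in the two cut quivers; these pairs are also the product basis of the tensor product.
\<close>

section \<open>Algebras with a multiplicative basis\<close>

text \<open>The vertices are forced by asking for type 0. Reading the definition of the type
  backwards, the image of \<open>kappa\<close> has to be \<open>A_P(M)\<close>. Its value at b is
  the label of a path over b minus the degree of the path times the sum of all basis elements. The
  degree is the growth of both potentials along the path, so the two halves of this vector are
  coefficient vectors over b with potential 0. Hence \<open>A_P(M)\<close> must be the sum of the
  two lattices \<open>D\<close>; if generators of this sum are the rows of a matrix, the vertices
  are its columns. A second obstacle is that all algebras are quotients by generated ideals or
  spans. Each is therefore mapped to an algebra with an explicit basis in which products of basis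
  elements are basis elements or 0. What remains is to know which paths become equal. In the cut
  quivers these are the paths with the same start and the same number of arrows of each type,
  because the number of cut arrows on a path is a difference of potentials and so survives every
  reordering.\<close>

definition basis_mult :: "('x \<Rightarrow> 'x \<Rightarrow> 'x option) \<Rightarrow> ('x \<Rightarrow> 'k::field) \<Rightarrow> ('x \<Rightarrow> 'k) \<Rightarrow> 'x \<Rightarrow> 'k" where
  "basis_mult m f g = (\<lambda>z. \<Sum>x\<in>support f. \<Sum>y\<in>support g. if m x y = Some z then f x * g y else 0)"

definition basis_elem :: "'x option \<Rightarrow> 'x \<Rightarrow> 'k::field" where
  "basis_elem u = (case u of None \<Rightarrow> 0 | Some z \<Rightarrow> single z)"

text \<open>For infinite support the sum has the default value 0 and additivity can fail; hence the
  finiteness hypotheses below.\<close>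

definition lin_ext :: "('x \<Rightarrow> 'y \<Rightarrow> 'k::field) \<Rightarrow> ('x \<Rightarrow> 'k) \<Rightarrow> 'y \<Rightarrow> 'k" where
  "lin_ext \<phi> f = (\<lambda>z. \<Sum>x\<in>support f. f x * \<phi> x z)"

lemma basis_algebra_simps:
  "carrier (basis_algebra X m E) = {f. finite (support f) \<and> support f \<subseteq> X}"
  "mult (basis_algebra X m E) = basis_mult m"
  "one (basis_algebra X m E) = (\<lambda>x. if x \<in> E then 1 else 0)"
  "ring.zero (basis_algebra X m E) = 0"
  "add (basis_algebra X m E) = (+)"
  "smult (basis_algebra X m E) = scl"
  by (simp_all add: basis_algebra_def basis_mult_def fun_eq_iff)

lemma basis_elem_simps [simp]: "basis_elem None = 0" "basis_elem (Some z) = single z"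
  by (simp_all add: basis_elem_def)

lemma single_apply: "single x y = (if y = x then 1 else 0)"
  by (simp add: single_def)

lemma support_single [simp]: "support (single x :: 'x \<Rightarrow> 'k::field) = {x}"
  by (auto simp: single_def)

lemma support_zero [simp]: "support (0 :: 'x \<Rightarrow> 'k::field) = {}"
  by simp

lemma finite_support_basis_elem [simp]: "finite (support (basis_elem u :: 'x \<Rightarrow> 'k::field))"
  by (cases u) (simp_all del: support_zero add: zero_fun_def)

lemma support_add_subset: "support (f + g) \<subseteq> support f \<union> support (g :: 'x \<Rightarrow> 'k::field)"
  by auto

lemma support_scl_subset: "support (scl c f) \<subseteq> support (f :: 'x \<Rightarrow> 'k::field)"
  by auto

lemma finite_support_add:
  "finite (support f) \<Longrightarrow> finite (support g) \<Longrightarrow> finite (support (f + g :: 'x \<Rightarrow> 'k::field))"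
  by (rule finite_subset[OF support_add_subset]) simp

lemma finite_support_diff:
  "finite (support f) \<Longrightarrow> finite (support g) \<Longrightarrow> finite (support (f - g :: 'x \<Rightarrow> 'k::field))"
  by (rule finite_subset[of _ "support f \<union> support g"]) auto

lemma finite_support_scl: "finite (support f) \<Longrightarrow> finite (support (scl c f :: 'x \<Rightarrow> 'k::field))"
  by (rule finite_subset[OF support_scl_subset])

lemma support_lin_comb:
  "support (\<lambda>z. \<Sum>x\<in>A. c x * (\<phi> x z :: 'k::field)) \<subseteq> (\<Union>x\<in>A. support (\<phi> x))"
proof
  fix z assume "z \<in> support (\<lambda>z. \<Sum>x\<in>A. c x * \<phi> x z)"
  then have "(\<Sum>x\<in>A. c x * \<phi> x z) \<noteq> 0" by simp
  then have "\<exists>x\<in>A. c x * \<phi> x z \<noteq> 0" by (meson sum.neutral)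
  then show "z \<in> (\<Union>x\<in>A. support (\<phi> x))" by auto
qed

lemma finite_support_lin_comb:
  assumes "finite A" "\<And>x. x \<in> A \<Longrightarrow> finite (support (\<phi> x))"
  shows "finite (support (\<lambda>z. \<Sum>x\<in>A. c x * (\<phi> x z :: 'k::field)))"
proof (rule finite_subset)
  show "support (\<lambda>z. \<Sum>x\<in>A. c x * \<phi> x z) \<subseteq> (\<Union>x\<in>A. support (\<phi> x))"
    by (rule support_lin_comb)
qed (use assms in auto)

text \<open>The exact supports change with the arguments, so sums indexed by them cannot simply be
  added or interchanged. A common finite index set, on which the additional terms vanish, removes
  this difficulty.\<close>

lemma basis_mult_superset:
  assumes "finite A" "finite A'" "support f \<subseteq> A" "support g \<subseteq> A'"
  shows "basis_mult m f g z = (\<Sum>x\<in>A. \<Sum>y\<in>A'. if m x y = Some z then f x * g y else 0)"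
proof -
  have inner: "(\<Sum>y\<in>support g. if m x y = Some z then f x * g y else 0)
      = (\<Sum>y\<in>A'. if m x y = Some z then f x * g y else 0)" for x
    by (rule sum.mono_neutral_left) (use assms in auto)
  show ?thesis
    unfolding basis_mult_def inner
    by (rule sum.mono_neutral_left) (use assms in \<open>auto intro!: sum.neutral split: if_splits\<close>)
qed

lemma lin_ext_superset:
  assumes "finite A" "support f \<subseteq> A"
  shows "lin_ext \<phi> f z = (\<Sum>x\<in>A. f x * \<phi> x z)"
  unfolding lin_ext_def by (rule sum.mono_neutral_left) (use assms in auto)

lemma lin_ext_single [simp]: "lin_ext \<phi> (single x) = \<phi> x"
  by (simp add: lin_ext_def single_apply)

lemma lin_ext_zero [simp]: "lin_ext \<phi> 0 = 0"
  by (simp add: lin_ext_def fun_eq_iff)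

lemma lin_ext_add:
  assumes "finite (support f)" "finite (support g)"
  shows "lin_ext \<phi> (f + g) = lin_ext \<phi> f + lin_ext \<phi> g"
proof
  fix z
  let ?A = "support f \<union> support g"
  have A: "finite ?A" using assms by simp
  show "lin_ext \<phi> (f + g) z = (lin_ext \<phi> f + lin_ext \<phi> g) z"
  proof -
    have "lin_ext \<phi> (f + g) z = (\<Sum>x\<in>?A. (f + g) x * \<phi> x z)"
      by (rule lin_ext_superset[OF A support_add_subset])
    then show ?thesis
      using lin_ext_superset[OF A, of f \<phi> z] lin_ext_superset[OF A, of g \<phi> z]
      by (simp add: sum.distrib distrib_right)
  qed
qed

lemma lin_ext_scl:
  assumes "finite (support f)"
  shows "lin_ext \<phi> (scl c f) = scl c (lin_ext \<phi> f)"
proof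
  fix z
  show "lin_ext \<phi> (scl c f) z = scl c (lin_ext \<phi> f) z"
    using lin_ext_superset[of "support f" "scl c f" \<phi> z] assms
    by (auto simp: lin_ext_def sum_distrib_left algebra_simps)
qed

lemma lin_ext_uminus:
  assumes "finite (support f)"
  shows "lin_ext \<phi> (- f) = - lin_ext \<phi> f"
  using lin_ext_scl[OF assms, of \<phi> "-1"] by (simp add: fun_Compl_def)

lemma lin_ext_diff:
  assumes "finite (support f)" "finite (support g)"
  shows "lin_ext \<phi> (f - g) = lin_ext \<phi> f - lin_ext \<phi> g"
proof -
  have "lin_ext \<phi> (f + - g) = lin_ext \<phi> f + lin_ext \<phi> (- g)"
    using assms by (intro lin_ext_add) auto
  then show ?thesis
    using assms by (simp add: lin_ext_uminus)
qed

lemma finite_support_lin_ext: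
  assumes "finite (support f)" "\<And>x. x \<in> support f \<Longrightarrow> finite (support (\<phi> x))"
  shows "finite (support (lin_ext \<phi> f))"
  unfolding lin_ext_def using assms by (rule finite_support_lin_comb)

lemma lin_ext_single_self: 
  assumes "finite (support f)" shows "lin_ext single f = f"
proof
  fix z
  have "(\<Sum>x\<in>support f. f x * single x z) = (\<Sum>x\<in>support f. if x = z then f z else 0)"
    by (rule sum.cong) (auto simp: single_apply)
  then show "lin_ext single f z = f z"
    using assms by (simp add: lin_ext_def)
qed

lemma basis_mult_lin_comb_left:
  assumes "finite A" "\<And>x. x \<in> A \<Longrightarrow> finite (support (\<phi> x))" "finite (support g)"
  shows "basis_mult m (\<lambda>z. \<Sum>x\<in>A. c x * \<phi> x z) g = (\<lambda>z. \<Sum>x\<in>A. c x * basis_mult m (\<phi> x) g z)"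
proof
  fix z
  define U where "U = (\<Union>x\<in>A. support (\<phi> x))"
  have U: "finite U" using assms by (auto simp: U_def)
  have "support (\<lambda>z. \<Sum>x\<in>A. c x * \<phi> x z) \<subseteq> U"
    unfolding U_def by (rule support_lin_comb)
  then have "basis_mult m (\<lambda>z. \<Sum>x\<in>A. c x * \<phi> x z) g z
      = (\<Sum>u\<in>U. \<Sum>y\<in>support g. if m u y = Some z then (\<Sum>x\<in>A. c x * \<phi> x u) * g y else 0)"
    by (intro basis_mult_superset) (use U assms in auto)
  also have "\<dots> = (\<Sum>u\<in>U. \<Sum>y\<in>support g. \<Sum>x\<in>A. c x * (if m u y = Some z then \<phi> x u * g y else 0))"
    by (intro sum.cong refl) (auto simp: sum_distrib_right mult.assoc)
  also have "\<dots> = (\<Sum>x\<in>A. \<Sum>u\<in>U. \<Sum>y\<in>support g. c x * (if m u y = Some z then \<phi> x u * g y else 0))"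
    by (subst (2) sum.swap, subst sum.swap[of _ A]) (rule refl)
  also have "\<dots> = (\<Sum>x\<in>A. c x * (\<Sum>u\<in>U. \<Sum>y\<in>support g. if m u y = Some z then \<phi> x u * g y else 0))"
    by (simp add: sum_distrib_left)
  also have "\<dots> = (\<Sum>x\<in>A. c x * basis_mult m (\<phi> x) g z)"
  proof (intro sum.cong refl)
    fix x assume "x \<in> A"
    then have "support (\<phi> x) \<subseteq> U" by (auto simp: U_def)
    then show "c x * (\<Sum>u\<in>U. \<Sum>y\<in>support g. if m u y = Some z then \<phi> x u * g y else 0)
        = c x * basis_mult m (\<phi> x) g z"
      by (simp add: basis_mult_superset[OF U assms(3)])
  qed
  finally show "basis_mult m (\<lambda>z. \<Sum>x\<in>A. c x * \<phi> x z) g z = (\<Sum>x\<in>A. c x * basis_mult m (\<phi> x) g z)" .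
qed

text \<open>Passing to the opposite multiplication exchanges the factors, because the coefficients
  commute. Statements about the right factor thus follow from those about the left one.\<close>

lemma basis_mult_flip: "basis_mult m f g = basis_mult (\<lambda>x y. m y x) g f"
proof
  fix z
  show "basis_mult m f g z = basis_mult (\<lambda>x y. m y x) g f z"
    unfolding basis_mult_def by (subst sum.swap) (auto intro!: sum.cong simp: mult.commute)
qed

lemma basis_mult_lin_comb_right:
  assumes "finite A" "\<And>x. x \<in> A \<Longrightarrow> finite (support (\<phi> x))" "finite (support g)"
  shows "basis_mult m g (\<lambda>z. \<Sum>x\<in>A. c x * \<phi> x z) = (\<lambda>z. \<Sum>x\<in>A. c x * basis_mult m g (\<phi> x) z)"
  using basis_mult_lin_comb_left[of A \<phi> g "\<lambda>x y. m y x" c] assms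
  by (simp add: basis_mult_flip[of m])

lemma basis_mult_single [simp]: "basis_mult m (single x) (single y) = basis_elem (m x y)"
  by (rule ext) (cases "m x y"; auto simp: basis_mult_def single_apply)

lemma basis_mult_lin_ext_left:
  assumes "finite (support f)" "\<And>x. x \<in> support f \<Longrightarrow> finite (support (\<phi> x))" "finite (support g)"
  shows "basis_mult m (lin_ext \<phi> f) g = lin_ext (\<lambda>x. basis_mult m (\<phi> x) g) f"
  unfolding lin_ext_def by (rule basis_mult_lin_comb_left[OF assms])

lemma basis_mult_lin_ext_right:
  assumes "finite (support f)" "\<And>x. x \<in> support f \<Longrightarrow> finite (support (\<phi> x))" "finite (support g)"
  shows "basis_mult m g (lin_ext \<phi> f) = lin_ext (\<lambda>x. basis_mult m g (\<phi> x)) f"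
  unfolding lin_ext_def by (rule basis_mult_lin_comb_right[OF assms])

lemma lin_ext_cong:
  "(\<And>x. x \<in> support f \<Longrightarrow> \<phi> x = \<psi> x) \<Longrightarrow> lin_ext \<phi> f = lin_ext \<psi> f"
  by (simp add: lin_ext_def)

lemma lin_ext_lin_ext:
  assumes "finite (support f)" "\<And>x. x \<in> support f \<Longrightarrow> finite (support (\<phi> x))"
  shows "lin_ext \<psi> (lin_ext \<phi> f) = lin_ext (\<lambda>x. lin_ext \<psi> (\<phi> x)) f"
proof
  fix z
  define U where "U = (\<Union>x\<in>support f. support (\<phi> x))"
  have U: "finite U" using assms by (auto simp: U_def)
  have "support (lin_ext \<phi> f) \<subseteq> U"
    unfolding U_def lin_ext_def by (rule support_lin_comb)
  then have "lin_ext \<psi> (lin_ext \<phi> f) z = (\<Sum>u\<in>U. lin_ext \<phi> f u * \<psi> u z)"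
    by (rule lin_ext_superset[OF U])
  also have "\<dots> = (\<Sum>x\<in>support f. \<Sum>u\<in>U. f x * (\<phi> x u * \<psi> u z))"
    by (subst sum.swap) (simp add: lin_ext_def sum_distrib_right mult.assoc)
  also have "\<dots> = (\<Sum>x\<in>support f. f x * lin_ext \<psi> (\<phi> x) z)"
  proof (intro sum.cong refl)
    fix x assume "x \<in> support f"
    then have "support (\<phi> x) \<subseteq> U" by (auto simp: U_def)
    then show "(\<Sum>u\<in>U. f x * (\<phi> x u * \<psi> u z)) = f x * lin_ext \<psi> (\<phi> x) z"
      by (simp add: lin_ext_superset[OF U] sum_distrib_left)
  qed
  finally show "lin_ext \<psi> (lin_ext \<phi> f) z = lin_ext (\<lambda>x. lin_ext \<psi> (\<phi> x)) f z"
    by (simp add: lin_ext_def)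
qed

text \<open>Turns the product into two nested linear extensions, so that later identities are
  checked on pairs of basis elements.\<close>

lemma basis_mult_expand:
  assumes "finite (support f)" "finite (support g)"
  shows "basis_mult m f g = lin_ext (\<lambda>x. lin_ext (\<lambda>y. basis_elem (m x y)) g) f"
proof -
  have "basis_mult m f g = basis_mult m (lin_ext single f) (lin_ext single g)"
    using assms by (simp add: lin_ext_single_self)
  also have "\<dots> = lin_ext (\<lambda>x. basis_mult m (single x) (lin_ext single g)) f"
    using assms by (intro basis_mult_lin_ext_left) (auto simp: lin_ext_single_self)
  also have "\<dots> = lin_ext (\<lambda>x. lin_ext (\<lambda>y. basis_mult m (single x) (single y)) g) f"
    using assms by (intro lin_ext_cong basis_mult_lin_ext_right) auto
  finally show ?thesis by simp
qed

lemma finite_support_basis_mult: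
  assumes "finite (support f)" "finite (support g)"
  shows "finite (support (basis_mult m f g))"
  unfolding basis_mult_expand[OF assms] by (intro finite_support_lin_ext assms) auto

lemma support_basis_mult:
  assumes "z \<in> support (basis_mult m f g)"
  obtains x y where "x \<in> support f" "y \<in> support g" "m x y = Some z"
proof -
  have "\<exists>x\<in>support f. (\<Sum>y\<in>support g. if m x y = Some z then f x * g y else 0) \<noteq> 0"
  proof (rule ccontr)
    assume "\<not> ?thesis"
    then have "basis_mult m f g z = 0"
      unfolding basis_mult_def by (intro sum.neutral) blast
    then show False using assms by simp
  qed
  then obtain x where "x \<in> support f" "(\<Sum>y\<in>support g. if m x y = Some z then f x * g y else 0) \<noteq> 0"
    by blast
  moreover from this(2) obtain y where "y \<in> support g" "(if m x y = Some z then f x * g y else 0) \<noteq> 0"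
    by (elim sum.not_neutral_contains_not_neutral)
  ultimately show ?thesis
    using that by (auto split: if_splits)
qed

text \<open>Both sides are bilinear, so pairs of basis elements decide; \<open>None\<close> in the
  source corresponds to a vanishing product in the target.\<close>

lemma lin_ext_mult:
  assumes "finite (support f)" "finite (support g)"
    and "\<And>x. x \<in> support f \<union> support g \<Longrightarrow> finite (support (\<phi> x))"
    and "\<And>x y. x \<in> support f \<Longrightarrow> y \<in> support g \<Longrightarrow>
      basis_mult m' (\<phi> x) (\<phi> y) = (case m x y of None \<Rightarrow> 0 | Some z \<Rightarrow> \<phi> z)"
  shows "lin_ext \<phi> (basis_mult m f g) = basis_mult m' (lin_ext \<phi> f) (lin_ext \<phi> g)"
proof -
  have "basis_mult m' (lin_ext \<phi> f) (lin_ext \<phi> g)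
      = lin_ext (\<lambda>x. basis_mult m' (\<phi> x) (lin_ext \<phi> g)) f"
    using assms by (intro basis_mult_lin_ext_left finite_support_lin_ext) auto
  also have "\<dots> = lin_ext (\<lambda>x. lin_ext (\<lambda>y. basis_mult m' (\<phi> x) (\<phi> y)) g) f"
    using assms by (intro lin_ext_cong basis_mult_lin_ext_right) auto
  also have "\<dots> = lin_ext (\<lambda>x. lin_ext (\<lambda>y. lin_ext \<phi> (basis_elem (m x y))) g) f"
    using assms(4) by (intro lin_ext_cong) (auto split: option.splits)
  also have "\<dots> = lin_ext (\<lambda>x. lin_ext \<phi> (lin_ext (\<lambda>y. basis_elem (m x y)) g)) f"
    using assms by (intro lin_ext_cong lin_ext_lin_ext[symmetric]) auto
  also have "\<dots> = lin_ext \<phi> (lin_ext (\<lambda>x. lin_ext (\<lambda>y. basis_elem (m x y)) g) f)"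
    using assms by (intro lin_ext_lin_ext[symmetric] finite_support_lin_ext) auto
  also have "\<dots> = lin_ext \<phi> (basis_mult m f g)"
    using assms by (simp add: basis_mult_expand)
  finally show ?thesis by simp
qed

text \<open>The basis behaves much like a category with finitely many objects: \<open>X\<close>
  consists of the morphisms, \<open>None\<close> is a vanishing product, and \<open>E\<close> is the
  set of identities. Each basis element meets exactly one identity on either side, so the sum over
  \<open>E\<close> is the unit of the algebra.\<close>

locale algebra_basis =
  fixes X :: "'x set" and m :: "'x \<Rightarrow> 'x \<Rightarrow> 'x option" and E :: "'x set"
  assumes m_closed: "x \<in> X \<Longrightarrow> y \<in> X \<Longrightarrow> m x y = Some z \<Longrightarrow> z \<in> X"
    and m_assoc: "x \<in> X \<Longrightarrow> y \<in> X \<Longrightarrow> z \<in> X \<Longrightarrow>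
      Option.bind (m x y) (\<lambda>u. m u z) = Option.bind (m y z) (m x)"
    and finite_E: "finite E"
    and E_subset: "E \<subseteq> X"
    and left_unit: "x \<in> X \<Longrightarrow> \<exists>e\<in>E. \<forall>e'\<in>E. m e' x = (if e' = e then Some x else None)"
    and right_unit: "x \<in> X \<Longrightarrow> \<exists>e\<in>E. \<forall>e'\<in>E. m x e' = (if e' = e then Some x else None)"
begin

lemma mult_one_single:
  assumes "x \<in> X"
  shows "basis_mult m (\<lambda>x. if x \<in> E then 1 else 0) (single x) = (single x :: 'x \<Rightarrow> 'k::field)"
proof
  fix z
  obtain e where e: "e \<in> E" "\<And>e'. e' \<in> E \<Longrightarrow> m e' x = (if e' = e then Some x else None)"
    using left_unit[OF assms] by blast
  have "basis_mult m (\<lambda>x. if x \<in> E then 1 else 0) (single x) z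
      = (\<Sum>u\<in>E. \<Sum>y\<in>{x}. if m u y = Some z then (if u \<in> E then 1 else 0) * (single x y :: 'k) else 0)"
    by (rule basis_mult_superset) (auto simp: finite_E split: if_splits)
  also have "\<dots> = (\<Sum>u\<in>E. if u = e then single x z else 0)"
    by (rule sum.cong) (auto simp: e single_apply)
  finally show "basis_mult m (\<lambda>x. if x \<in> E then 1 else 0) (single x) z = (single x z :: 'k)"
    using e finite_E by simp
qed

lemma mult_single_one:
  assumes "x \<in> X"
  shows "basis_mult m (single x) (\<lambda>x. if x \<in> E then 1 else 0) = (single x :: 'x \<Rightarrow> 'k::field)"
proof
  fix z
  obtain e where e: "e \<in> E" "\<And>e'. e' \<in> E \<Longrightarrow> m x e' = (if e' = e then Some x else None)"
    using right_unit[OF assms] by blast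
  have "basis_mult m (single x) (\<lambda>x. if x \<in> E then 1 else 0) z
      = (\<Sum>y\<in>{x}. \<Sum>u\<in>E. if m y u = Some z then (single x y :: 'k) * (if u \<in> E then 1 else 0) else 0)"
    by (rule basis_mult_superset) (auto simp: finite_E split: if_splits)
  also have "\<dots> = (\<Sum>u\<in>E. if u = e then single x z else 0)"
    by simp (rule sum.cong, auto simp: e single_apply)
  finally show "basis_mult m (single x) (\<lambda>x. if x \<in> E then 1 else 0) z = (single x z :: 'k)"
    using e finite_E by simp
qed

lemma basis_elem_assoc:
  assumes "x \<in> X" "y \<in> X" "w \<in> X"
  shows "basis_mult m (basis_elem (m x y)) (single w)
      = (basis_mult m (single x) (basis_elem (m y w)) :: 'x \<Rightarrow> 'k::field)"
proof -
  have *: "basis_mult m (0 :: 'x \<Rightarrow> 'k) g = 0" "basis_mult m g (0 :: 'x \<Rightarrow> 'k) = 0" for g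
    by (simp_all add: basis_mult_def fun_eq_iff)
  show ?thesis
    using m_assoc[OF assms] by (cases "m x y"; cases "m y w") (auto simp: *)
qed

lemma mult_assoc:
  fixes f g h :: "'x \<Rightarrow> 'k::field"
  assumes "finite (support f)" "support f \<subseteq> X" "finite (support g)" "support g \<subseteq> X"
    "finite (support h)" "support h \<subseteq> X"
  shows "basis_mult m (basis_mult m f g) h = basis_mult m f (basis_mult m g h)"
proof -
  have "basis_mult m (basis_mult m f g) h
      = lin_ext (\<lambda>x. basis_mult m (lin_ext (\<lambda>y. basis_elem (m x y)) g) h) f"
    unfolding basis_mult_expand[OF assms(1,3)]
    using assms by (intro basis_mult_lin_ext_left finite_support_lin_ext) auto
  also have "\<dots> = lin_ext (\<lambda>x. lin_ext (\<lambda>y. basis_mult m (basis_elem (m x y)) h) g) f"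
    using assms by (intro lin_ext_cong basis_mult_lin_ext_left) auto
  also have "\<dots> = lin_ext (\<lambda>x. lin_ext (\<lambda>y. lin_ext (\<lambda>w. basis_mult m (basis_elem (m x y)) (single w)) h) g) f"
    using assms by (intro lin_ext_cong, subst lin_ext_single_self[of h, symmetric])
      (auto intro!: basis_mult_lin_ext_right)
  also have "\<dots> = lin_ext (\<lambda>x. lin_ext (\<lambda>y. lin_ext (\<lambda>w. basis_mult m (single x) (basis_elem (m y w))) h) g) f"
    using assms by (intro lin_ext_cong basis_elem_assoc) blast+
  also have "\<dots> = lin_ext (\<lambda>x. lin_ext (\<lambda>y. basis_mult m (single x) (lin_ext (\<lambda>w. basis_elem (m y w)) h)) g) f"
    using assms by (intro lin_ext_cong basis_mult_lin_ext_right[symmetric]) auto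
  also have "\<dots> = lin_ext (\<lambda>x. basis_mult m (single x) (basis_mult m g h)) f"
    unfolding basis_mult_expand[OF assms(3,5)]
    using assms by (intro lin_ext_cong basis_mult_lin_ext_right[symmetric] finite_support_lin_ext) auto
  also have "\<dots> = basis_mult m (lin_ext single f) (basis_mult m g h)"
    using assms by (intro basis_mult_lin_ext_left[symmetric] finite_support_basis_mult) auto
  finally show ?thesis
    using assms by (simp add: lin_ext_single_self)
qed

lemma one_mult:
  fixes f :: "'x \<Rightarrow> 'k::field"
  assumes "finite (support f)" "support f \<subseteq> X"
  shows "basis_mult m (\<lambda>x. if x \<in> E then 1 else 0) f = f"
proof -
  have "basis_mult m (\<lambda>x. if x \<in> E then 1 else 0) (lin_ext single f)
      = lin_ext (\<lambda>y. basis_mult m (\<lambda>x. if x \<in> E then 1 else 0) (single y)) f"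
    using assms finite_E by (intro basis_mult_lin_ext_right) auto
  also have "\<dots> = lin_ext single f"
    using assms by (intro lin_ext_cong mult_one_single) auto
  finally show ?thesis
    using assms by (simp add: lin_ext_single_self)
qed

lemma mult_one:
  fixes f :: "'x \<Rightarrow> 'k::field"
  assumes "finite (support f)" "support f \<subseteq> X"
  shows "basis_mult m f (\<lambda>x. if x \<in> E then 1 else 0) = f"
proof -
  have "basis_mult m (lin_ext single f) (\<lambda>x. if x \<in> E then 1 else 0)
      = lin_ext (\<lambda>y. basis_mult m (single y) (\<lambda>x. if x \<in> E then 1 else 0)) f"
    using assms finite_E by (intro basis_mult_lin_ext_left) auto
  also have "\<dots> = lin_ext single f"
    using assms by (intro lin_ext_cong mult_single_one) auto
  finally show ?thesis
    using assms by (simp add: lin_ext_single_self)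
qed

lemma mult_distrib_right:
  fixes f g h :: "'x \<Rightarrow> 'k::field"
  assumes "finite (support f)" "finite (support g)" "finite (support h)"
  shows "basis_mult m (f + g) h = basis_mult m f h + basis_mult m g h"
proof -
  have "basis_mult m (f + g) h = lin_ext (\<lambda>x. lin_ext (\<lambda>y. basis_elem (m x y)) h) (f + g)"
    by (rule basis_mult_expand[OF finite_support_add[OF assms(1,2)] assms(3)])
  then show ?thesis
    using assms by (simp add: basis_mult_expand lin_ext_add)
qed

lemma mult_distrib_left:
  fixes f g h :: "'x \<Rightarrow> 'k::field"
  assumes "finite (support f)" "finite (support g)" "finite (support h)"
  shows "basis_mult m h (f + g) = basis_mult m h f + basis_mult m h g"
  unfolding basis_mult_flip[of m h]
proof -
  let ?m = "\<lambda>x y. m y x"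
  have "basis_mult ?m (f + g) h = lin_ext (\<lambda>x. lin_ext (\<lambda>y. basis_elem (?m x y)) h) (f + g)"
    by (rule basis_mult_expand[OF finite_support_add[OF assms(1,2)] assms(3)])
  then show "basis_mult ?m (f + g) h = basis_mult ?m f h + basis_mult ?m g h"
    using assms by (simp add: basis_mult_expand lin_ext_add)
qed

lemma ring_basis_algebra: "ring (basis_algebra X m E :: ('k::field, 'x \<Rightarrow> 'k) module)"
proof (rule ringI)
  show "abelian_group (basis_algebra X m E :: ('k, 'x \<Rightarrow> 'k) module)"
  proof (rule abelian_groupI, unfold basis_algebra_simps)
    fix f g :: "'x \<Rightarrow> 'k"
    assume f: "f \<in> {f. finite (support f) \<and> support f \<subseteq> X}"
      and g: "g \<in> {f. finite (support f) \<and> support f \<subseteq> X}"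
    show "f + g \<in> {f. finite (support f) \<and> support f \<subseteq> X}"
      using f g finite_support_add[of f g] support_add_subset[of f g] by blast
    show "\<exists>g\<in>{f. finite (support f) \<and> support f \<subseteq> X}. g + f = 0"
      using f by (intro bexI[of _ "- f"]) auto
  qed (auto simp: algebra_simps)
  show "Group.monoid (basis_algebra X m E :: ('k, 'x \<Rightarrow> 'k) module)"
  proof (rule monoidI, unfold basis_algebra_simps)
    fix f g :: "'x \<Rightarrow> 'k"
    assume f: "f \<in> {f. finite (support f) \<and> support f \<subseteq> X}"
      and g: "g \<in> {f. finite (support f) \<and> support f \<subseteq> X}"
    show "basis_mult m f g \<in> {f. finite (support f) \<and> support f \<subseteq> X}"
    proof
      have "support (basis_mult m f g) \<subseteq> X"
      proof
        fix z assume "z \<in> support (basis_mult m f g)"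
        then obtain x y where "x \<in> support f" "y \<in> support g" "m x y = Some z"
          by (rule support_basis_mult)
        with f g show "z \<in> X" using m_closed[of x y z] by blast
      qed
      then show "finite (support (basis_mult m f g)) \<and> support (basis_mult m f g) \<subseteq> X"
        using f g finite_support_basis_mult[of f g m] by blast
    qed
  qed (use E_subset finite_E in \<open>auto simp: mult_assoc one_mult mult_one\<close>)
qed (auto simp: basis_algebra_simps mult_distrib_left mult_distrib_right)

end

section \<open>Quotient algebras and their bases\<close>

lemma quotient_algebra_simps:
  "carrier (quotient_algebra A I) = a_rcosets\<^bsub>A\<^esub> I"
  "mult (quotient_algebra A I) = mult (A Quot I)"
  "one (quotient_algebra A I) = one (A Quot I)"
  "ring.zero (quotient_algebra A I) = ring.zero (A Quot I)"
  "add (quotient_algebra A I) = add (A Quot I)"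
  "smult (quotient_algebra A I) = (\<lambda>c X. \<Union>x\<in>X. I +>\<^bsub>A\<^esub> (c \<odot>\<^bsub>A\<^esub> x))"
  by (simp_all add: quotient_algebra_def FactRing_def)

lemma ring_iso_quotient_algebra:
  "ring_iso (quotient_algebra A I) R = ring_iso (A Quot I) R"
  by (simp add: ring_iso_def ring_hom_def quotient_algebra_def)

lemma ring_quotient_algebra:
  assumes "ideal I A"
  shows "ring (quotient_algebra A I)"
proof -
  interpret Q: ring "A Quot I" by (rule ideal.quotient_is_ring[OF assms])
  have carrier: "carrier (quotient_algebra A I) = carrier (A Quot I)"
    by (simp add: quotient_algebra_def)
  show ?thesis
  proof (intro ringI abelian_groupI monoidI, unfold carrier quotient_algebra_simps(2-5))
    show "\<exists>y\<in>carrier (A Quot I). y \<oplus>\<^bsub>A Quot I\<^esub> x = \<zero>\<^bsub>A Quot I\<^esub>" if "x \<in> carrier (A Quot I)" for x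
      using that Q.l_neg by blast
  qed (assumption | rule Q.a_closed Q.m_closed Q.a_assoc Q.a_comm Q.m_assoc Q.l_zero Q.l_one Q.r_one
      Q.l_distr Q.r_distr Q.zero_closed Q.one_closed)+
qed

lemma quotient_algebra_iso:
  fixes A :: "('k::field, 'a) module" and R :: "('k, 'b) module"
  assumes "ring A" "ring R" and h: "h \<in> ring_hom A R" and surj: "h ` carrier A = carrier R"
    and smult_closed: "\<And>c a. a \<in> carrier A \<Longrightarrow> c \<odot>\<^bsub>A\<^esub> a \<in> carrier A"
    and smult: "\<And>c a. a \<in> carrier A \<Longrightarrow> h (c \<odot>\<^bsub>A\<^esub> a) = c \<odot>\<^bsub>R\<^esub> h a"
    and I: "I = a_kernel A R h"
  obtains \<phi> where "\<phi> \<in> ring_iso (quotient_algebra A I) R"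
    "\<And>a. a \<in> carrier A \<Longrightarrow> \<phi> (I +>\<^bsub>A\<^esub> a) = h a"
    "\<And>c x. x \<in> carrier (quotient_algebra A I) \<Longrightarrow>
      c \<odot>\<^bsub>quotient_algebra A I\<^esub> x \<in> carrier (quotient_algebra A I)"
    "\<And>c x. x \<in> carrier (quotient_algebra A I) \<Longrightarrow>
      \<phi> (c \<odot>\<^bsub>quotient_algebra A I\<^esub> x) = c \<odot>\<^bsub>R\<^esub> \<phi> x"
proof
  interpret ring_hom_ring A R h
    using assms(1-3) by (rule ring_hom_ringI2)
  let ?\<phi> = "\<lambda>X. the_elem (h ` X)"
  show "?\<phi> \<in> ring_iso (quotient_algebra A I) R"
    unfolding ring_iso_quotient_algebra I by (rule FactRing_iso_set[OF surj])
  have coset: "I +>\<^bsub>A\<^esub> a = {x \<in> carrier A. h x = h a}" if "a \<in> carrier A" for a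
    using rcos_eq_homeq[OF that] by (simp add: I)
  show \<phi>: "?\<phi> (I +>\<^bsub>A\<^esub> a) = h a" if "a \<in> carrier A" for a
  proof -
    have "h ` (I +>\<^bsub>A\<^esub> a) = {h a}" using that by (auto simp: coset)
    then show ?thesis by simp
  qed
  \<comment> \<open>Scalar multiplication on the quotient is a union over all representatives.
    Linearity of \<open>h\<close> puts the multiples of all representatives into one coset, so the
    union collapses.\<close>
  have scl: "c \<odot>\<^bsub>quotient_algebra A I\<^esub> (I +>\<^bsub>A\<^esub> a) = I +>\<^bsub>A\<^esub> (c \<odot>\<^bsub>A\<^esub> a)" if "a \<in> carrier A" for c a
  proof -
    have "(\<Union>x\<in>I +>\<^bsub>A\<^esub> a. I +>\<^bsub>A\<^esub> (c \<odot>\<^bsub>A\<^esub> x)) = (\<Union>x\<in>I +>\<^bsub>A\<^esub> a. I +>\<^bsub>A\<^esub> (c \<odot>\<^bsub>A\<^esub> a))"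
      using that by (intro SUP_cong refl) (simp add: coset smult_closed smult)
    moreover have "I +>\<^bsub>A\<^esub> a \<noteq> {}" using that by (auto simp: coset)
    ultimately show ?thesis by (simp add: quotient_algebra_simps)
  qed
  fix c x assume "x \<in> carrier (quotient_algebra A I)"
  then obtain a where a: "a \<in> carrier A" "x = I +>\<^bsub>A\<^esub> a"
    by (auto simp: quotient_algebra_simps A_RCOSETS_def' )
  show "c \<odot>\<^bsub>quotient_algebra A I\<^esub> x \<in> carrier (quotient_algebra A I)"
    using a smult_closed scl by (auto simp: quotient_algebra_simps(1) A_RCOSETS_def')
  show "?\<phi> (c \<odot>\<^bsub>quotient_algebra A I\<^esub> x) = c \<odot>\<^bsub>R\<^esub> ?\<phi> x"
    using a smult_closed by (simp add: scl \<phi> smult)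
qed

lemma lin_ext_ring_hom:
  fixes \<phi> :: "'x \<Rightarrow> 'y \<Rightarrow> 'k::field"
  assumes "\<And>x. x \<in> X \<Longrightarrow> finite (support (\<phi> x)) \<and> support (\<phi> x) \<subseteq> Y"
    and "\<And>x y. x \<in> X \<Longrightarrow> y \<in> X \<Longrightarrow>
      basis_mult m' (\<phi> x) (\<phi> y) = (case m x y of None \<Rightarrow> 0 | Some z \<Rightarrow> \<phi> z)"
    and "lin_ext \<phi> (\<lambda>x. if x \<in> E then 1 else 0) = (\<lambda>x. if x \<in> E' then 1 else 0)"
  shows "lin_ext \<phi> \<in> ring_hom (basis_algebra X m E) (basis_algebra Y m' E')"
proof (rule ring_hom_memI, unfold basis_algebra_simps)
  fix f :: "'x \<Rightarrow> 'k" assume f: "f \<in> {f. finite (support f) \<and> support f \<subseteq> X}"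
  have "support (lin_ext \<phi> f) \<subseteq> (\<Union>x\<in>support f. support (\<phi> x))"
    unfolding lin_ext_def by (rule support_lin_comb)
  moreover have "finite (support (lin_ext \<phi> f))"
    by (intro finite_support_lin_ext) (use assms(1) f in blast)+
  ultimately show "lin_ext \<phi> f \<in> {f. finite (support f) \<and> support f \<subseteq> Y}"
    using assms(1) f by blast
  fix g :: "'x \<Rightarrow> 'k" assume g: "g \<in> {f. finite (support f) \<and> support f \<subseteq> X}"
  show "lin_ext \<phi> (basis_mult m f g) = basis_mult m' (lin_ext \<phi> f) (lin_ext \<phi> g)"
    by (rule lin_ext_mult) (use assms(1,2) f g in blast)+
  show "lin_ext \<phi> (f + g) = lin_ext \<phi> f + lin_ext \<phi> g"
    using f g by (intro lin_ext_add) auto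
qed (rule assms(3))

lemma lin_ext_in_subspace:
  assumes "finite (support f)" "0 \<in> S" "\<And>u v. u \<in> S \<Longrightarrow> v \<in> S \<Longrightarrow> u + v \<in> S"
    and "\<And>c u. u \<in> S \<Longrightarrow> scl c u \<in> S" and "\<And>x. x \<in> support f \<Longrightarrow> \<phi> x \<in> S"
  shows "lin_ext \<phi> f \<in> S"
proof -
  have "(\<lambda>z. \<Sum>x\<in>A. f x * \<phi> x z) \<in> S" if "finite A" "A \<subseteq> support f" for A
    using that
  proof (induction A)
    case empty
    then show ?case using assms(2) by (simp add: zero_fun_def)
  next
    case (insert a A)
    have "(\<lambda>z. \<Sum>x\<in>insert a A. f x * \<phi> x z) = scl (f a) (\<phi> a) + (\<lambda>z. \<Sum>x\<in>A. f x * \<phi> x z)"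
      using insert by (simp add: fun_eq_iff)
    moreover have "scl (f a) (\<phi> a) \<in> S" "(\<lambda>z. \<Sum>x\<in>A. f x * \<phi> x z) \<in> S"
      using insert assms(4,5) by blast+
    ultimately show ?case
      using assms(3) by presburger
  qed
  then show ?thesis
    using assms(1) by (simp add: lin_ext_def)
qed

text \<open>If \<sigma> undoes \<phi> modulo \<open>S\<close> on basis elements, then by linearity
  every \<open>f\<close> is congruent to the vector obtained by applying first \<phi> and then
  \<sigma>, and this is 0 for \<open>f\<close> in the kernel.\<close>

lemma lin_ext_kernel_subset:
  fixes f :: "'x \<Rightarrow> 'k::field"
  assumes f: "finite (support f)" "support f \<subseteq> X" "lin_ext \<phi> f = 0"
    and S: "0 \<in> S" "\<And>u v. u \<in> S \<Longrightarrow> v \<in> S \<Longrightarrow> u + v \<in> S" "\<And>c u. u \<in> S \<Longrightarrow> scl c u \<in> S"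
    and \<phi>: "\<And>x. x \<in> X \<Longrightarrow> finite (support (\<phi> x))"
    and \<sigma>: "\<And>x. x \<in> X \<Longrightarrow> single x - lin_ext \<sigma> (\<phi> x) \<in> S"
  shows "f \<in> S"
proof -
  have "lin_ext (\<lambda>x. single x - lin_ext \<sigma> (\<phi> x)) f \<in> S"
    by (rule lin_ext_in_subspace) (use f S \<sigma> in blast)+
  moreover have "lin_ext (\<lambda>x. single x - lin_ext \<sigma> (\<phi> x)) f = f - lin_ext \<sigma> (lin_ext \<phi> f)"
  proof -
    have "lin_ext \<sigma> (lin_ext \<phi> f) = lin_ext (\<lambda>x. lin_ext \<sigma> (\<phi> x)) f"
      by (rule lin_ext_lin_ext) (use f \<phi> in blast)+
    moreover have "lin_ext (\<lambda>x. single x - lin_ext \<sigma> (\<phi> x)) f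
        = lin_ext single f - lin_ext (\<lambda>x. lin_ext \<sigma> (\<phi> x)) f"
      by (simp add: lin_ext_def fun_eq_iff sum_subtractf right_diff_distrib)
    ultimately show ?thesis
      using f(1) by (simp add: lin_ext_single_self)
  qed
  ultimately show ?thesis
    using f(3) by simp
qed

context algebra_basis
begin

text \<open>Ideals refer to the underlying ring only. Scaling by \<open>c\<close> is multiplication
  by the ring element \<open>c\<close> times the unit, so they are subspaces as well.\<close>

lemma ideal_scl:
  fixes f :: "'x \<Rightarrow> 'k::field"
  assumes "ideal S (basis_algebra X m E)" "f \<in> S"
  shows "scl c f \<in> S"
proof -
  let ?one = "\<lambda>x. if x \<in> E then 1 else 0 :: 'k"
  have f: "finite (support f)" "support f \<subseteq> X"
    using ideal.Icarr[OF assms] by (auto simp: basis_algebra_simps)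
  have one: "finite (support ?one)"
    using finite_E by simp
  have "basis_mult m (scl c ?one) f \<in> S"
    using ideal.I_l_closed[OF assms, of "scl c ?one"] E_subset finite_E
    by (force simp: basis_algebra_simps intro: finite_subset[of _ E])
  moreover have "basis_mult m (scl c ?one) f = scl c (basis_mult m ?one f)"
    using one f finite_support_scl[OF one, of c]
    by (simp only: basis_mult_expand lin_ext_scl)
  ultimately show ?thesis
    using f by (simp add: one_mult)
qed

text \<open>An ideal generated by differences of basis elements glues these elements into classes.
  If no generator mixes two classes and the ideal contains every difference within a class, the
  classes form a basis of the quotient. Injectivity on \<open>E\<close> keeps the identities apart,
  so that they still act as unique units.\<close>

lemma quotient_by_classes:
  fixes T :: "('x \<Rightarrow> 'k::field) set" and cls :: "'x \<Rightarrow> 'y" and m' :: "'y \<Rightarrow> 'y \<Rightarrow> 'y option"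
    and R :: "('k, 'x \<Rightarrow> 'k) module"
  assumes R_def: "R = basis_algebra X m E" and S_def: "S = genideal R T"
    and Q_def: "Q = quotient_algebra R S"
    and cls: "\<And>x y. x \<in> X \<Longrightarrow> y \<in> X \<Longrightarrow> m' (cls x) (cls y) = map_option cls (m x y)"
    and inj: "inj_on cls E"
    and T: "T \<subseteq> {single x - single y | x y. x \<in> X \<and> y \<in> X \<and> cls x = cls y}"
    and Idl: "\<And>x y. x \<in> X \<Longrightarrow> y \<in> X \<Longrightarrow> cls x = cls y \<Longrightarrow> single x - single y \<in> S"
  obtains \<phi> :: "('x \<Rightarrow> 'k) set \<Rightarrow> 'y \<Rightarrow> 'k"
  where "\<phi> \<in> ring_iso Q (basis_algebra (cls ` X) m' (cls ` E))"
    "\<And>f. f \<in> carrier R \<Longrightarrow> \<phi> (S +>\<^bsub>R\<^esub> f) = lin_ext (\<lambda>x. single (cls x)) f"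
    "\<And>c x. x \<in> carrier Q \<Longrightarrow>
      c \<odot>\<^bsub>Q\<^esub> x \<in> carrier Q"
    "\<And>c x. x \<in> carrier Q \<Longrightarrow>
      \<phi> (c \<odot>\<^bsub>Q\<^esub> x) = scl c (\<phi> x)"
    "algebra_basis (cls ` X) m' (cls ` E)"
    "ideal (S) R"
proof -
  interpret Y: algebra_basis "cls ` X" m' "cls ` E"
  proof
    fix x y z assume "x \<in> cls ` X" "y \<in> cls ` X" "m' x y = Some z"
    then obtain a b where *: "a \<in> X" "b \<in> X" "map_option cls (m a b) = Some z"
      using cls by force
    then show "z \<in> cls ` X" using m_closed[of a b] by blast
  next
    fix x y z assume "x \<in> cls ` X" "y \<in> cls ` X" "z \<in> cls ` X"
    then obtain a b c where *: "a \<in> X" "b \<in> X" "c \<in> X" "x = cls a" "y = cls b" "z = cls c" by blast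
    have "Option.bind (m' x y) (\<lambda>u. m' u z) = map_option cls (Option.bind (m a b) (\<lambda>u. m u c))"
      using * cls m_closed[of a b] by (cases "m a b") simp_all
    also have "\<dots> = map_option cls (Option.bind (m b c) (m a))"
      using * m_assoc by simp
    also have "\<dots> = Option.bind (m' y z) (m' x)"
      using * cls m_closed[of b c] by (cases "m b c") simp_all
    finally show "Option.bind (m' x y) (\<lambda>u. m' u z) = Option.bind (m' y z) (m' x)" .
  next
    show "finite (cls ` E)" "cls ` E \<subseteq> cls ` X" using finite_E E_subset by auto
  next
    fix y assume "y \<in> cls ` X"
    then obtain x where x: "x \<in> X" "y = cls x" by blast
    obtain e where e: "e \<in> E" "\<And>e'. e' \<in> E \<Longrightarrow> m e' x = (if e' = e then Some x else None)"
      using left_unit[OF x(1)] by blast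
    show "\<exists>e\<in>cls ` E. \<forall>e'\<in>cls ` E. m' e' y = (if e' = e then Some y else None)"
      using x e cls E_subset inj by (intro bexI[of _ "cls e"]) (auto simp: inj_on_eq_iff subset_iff)
    obtain e where e: "e \<in> E" "\<And>e'. e' \<in> E \<Longrightarrow> m x e' = (if e' = e then Some x else None)"
      using right_unit[OF x(1)] by blast
    show "\<exists>e\<in>cls ` E. \<forall>e'\<in>cls ` E. m' y e' = (if e' = e then Some y else None)"
      using x e cls E_subset inj by (intro bexI[of _ "cls e"]) (auto simp: inj_on_eq_iff subset_iff)
  qed
  interpret R: ring R
    unfolding R_def by (rule ring_basis_algebra)
  let ?R' = "basis_algebra (cls ` X) m' (cls ` E) :: ('k, 'y \<Rightarrow> 'k) module"
  interpret R': ring ?R' by (rule Y.ring_basis_algebra)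
  let ?h = "lin_ext (\<lambda>x. single (cls x)) :: ('x \<Rightarrow> 'k) \<Rightarrow> 'y \<Rightarrow> 'k"
  have R_simps: "carrier R = {f. finite (support f) \<and> support f \<subseteq> X}" "ring.zero R = 0" "smult R = scl"
    by (simp_all add: R_def basis_algebra_simps)
  have T_carrier: "T \<subseteq> carrier R"
  proof
    fix t assume "t \<in> T"
    then obtain x y where t: "t = single x - single y" "x \<in> X" "y \<in> X"
      using T by blast
    moreover have "support t \<subseteq> {x, y}" by (auto simp: t single_apply)
    ultimately show "t \<in> carrier R"
      unfolding R_simps by (auto dest: finite_subset)
  qed
  have ideal: "ideal (S) R"
    by (unfold S_def, rule R.genideal_ideal[OF T_carrier])
  have hom: "?h \<in> ring_hom R ?R'"
    unfolding R_def
  proof (rule lin_ext_ring_hom)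
    fix x y assume "x \<in> X" "y \<in> X"
    then show "basis_mult m' (single (cls x)) (single (cls y))
        = (case m x y of None \<Rightarrow> 0 | Some z \<Rightarrow> (single (cls z) :: 'y \<Rightarrow> 'k))"
      using cls by (cases "m x y") auto
  next
    show "?h (\<lambda>x. if x \<in> E then 1 else 0) = (\<lambda>x. if x \<in> cls ` E then 1 else 0)"
    proof
      fix z
      have "?h (\<lambda>x. if x \<in> E then 1 else 0) z = (\<Sum>x\<in>E. (if x \<in> E then 1 else 0) * single (cls x) z)"
        by (rule lin_ext_superset[OF finite_E]) auto
      also have "\<dots> = (\<Sum>x\<in>E. if cls x = z then 1 else 0)"
        by (auto simp: single_apply intro!: sum.cong)
      also have "(\<Sum>x\<in>E. if cls x = z then 1 else 0) = (if z \<in> cls ` E then 1 else 0 :: 'k)"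
      proof (cases "z \<in> cls ` E")
        case True
        then obtain e where e: "e \<in> E" "z = cls e" by blast
        then have "(\<Sum>x\<in>E. if cls x = z then 1 else 0) = (\<Sum>x\<in>E. if x = e then 1 else 0 :: 'k)"
          using inj by (intro sum.cong) (auto simp: inj_on_eq_iff)
        then show ?thesis using True e finite_E by simp
      qed (auto intro!: sum.neutral)
      finally show "?h (\<lambda>x. if x \<in> E then 1 else 0) z = (if z \<in> cls ` E then 1 else 0)" .
    qed
  qed auto
  interpret hom: ring_hom_ring R ?R' ?h
    using R.ring_axioms R'.ring_axioms hom by (rule ring_hom_ringI2)
  have surj: "?h ` carrier R = carrier ?R'"
  proof (rule antisym)
    show "?h ` carrier R \<subseteq> carrier ?R'" using hom.hom_closed by blast
    show "carrier ?R' \<subseteq> ?h ` carrier R"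
    proof
      fix g assume "g \<in> carrier ?R'"
      then have g: "finite (support g)" "support g \<subseteq> cls ` X" by (auto simp: basis_algebra_simps)
      define r where "r = inv_into X cls"
      have r: "r y \<in> X" "cls (r y) = y" if "y \<in> support g" for y
        using g that by (auto simp: r_def inv_into_into f_inv_into_f subset_iff)
      let ?f = "lin_ext (\<lambda>y. single (r y)) g"
      have "?h ?f = lin_ext (\<lambda>y. ?h (single (r y))) g"
        using g by (intro lin_ext_lin_ext) auto
      also have "\<dots> = lin_ext single g"
        using r by (intro lin_ext_cong) auto
      finally have "?h ?f = g" using g by (simp add: lin_ext_single_self)
      moreover have "support ?f \<subseteq> (\<Union>y\<in>support g. support (single (r y) :: 'x \<Rightarrow> 'k))"
        unfolding lin_ext_def by (rule support_lin_comb)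
      then have "?f \<in> carrier R"
        using g r by (auto simp: R_simps intro: finite_support_lin_ext)
      ultimately show "g \<in> ?h ` carrier R" by force
    qed
  qed
  have kernel: "S = a_kernel R ?R' ?h"
  proof (rule antisym)
    show "S \<subseteq> a_kernel R ?R' ?h"
    proof (unfold S_def, rule R.genideal_minimal[OF hom.kernel_is_ideal])
      show "T \<subseteq> a_kernel R ?R' ?h"
      proof
        fix t assume t: "t \<in> T"
        then obtain x y where xy: "t = single x - single y" "cls x = cls y"
          using T by blast
        have "?h t = ?h (single x) - ?h (single y)"
          unfolding xy by (rule lin_ext_diff) auto
        also have "\<dots> = \<zero>\<^bsub>?R'\<^esub>"
          unfolding lin_ext_single xy(2) basis_algebra_simps by (rule diff_self)
        finally show "t \<in> a_kernel R ?R' ?h"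
          unfolding a_kernel_def' mem_Collect_eq using subsetD[OF T_carrier t] by (rule conjI[rotated])
      qed
    qed
    show "a_kernel R ?R' ?h \<subseteq> S"
    proof
      fix f assume "f \<in> a_kernel R ?R' ?h"
      then have f: "finite (support f)" "support f \<subseteq> X" "?h f = 0"
        unfolding a_kernel_def' R_simps basis_algebra_simps by blast+
      \<comment> \<open>A representative of each class; it differs from any other member of the
        class by an element of \<open>S\<close>, by \<open>Idl\<close>.\<close>
      let ?\<sigma> = "\<lambda>y. single (inv_into X cls y) :: 'x \<Rightarrow> 'k"
      show "f \<in> S"
      proof (rule lin_ext_kernel_subset[where \<sigma> = ?\<sigma>])
        show "0 \<in> S"
          using additive_subgroup.zero_closed[OF ideal.axioms(1)[OF ideal]] by (simp add: R_simps)
        show "u + v \<in> S" if "u \<in> S" "v \<in> S" for u v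
          using additive_subgroup.a_closed[OF ideal.axioms(1)[OF ideal] that]
          by (simp add: R_def basis_algebra_simps)
        show "scl c u \<in> S" if "u \<in> S" for u c
          using ideal that unfolding R_def by (rule ideal_scl)
        show "single x - lin_ext ?\<sigma> (single (cls x)) \<in> S" if "x \<in> X" for x
          using that by (auto intro!: Idl simp: inv_into_into f_inv_into_f)
      qed (use f in auto)
    qed
  qed
  show ?thesis
  proof (rule quotient_algebra_iso[OF R.ring_axioms R'.ring_axioms hom surj _ _ kernel, folded Q_def])
    show "c \<odot>\<^bsub>R\<^esub> a \<in> carrier R" if "a \<in> carrier R" for c a
      using that support_scl_subset[of c a] finite_support_scl[of a c] by (auto simp: R_simps)
    show "?h (c \<odot>\<^bsub>R\<^esub> a) = c \<odot>\<^bsub>?R'\<^esub> ?h a" if "a \<in> carrier R" for c a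
      unfolding R_simps basis_algebra_simps
      using that by (intro lin_ext_scl) (simp add: R_simps)
  next
    fix \<phi> assume "\<phi> \<in> ring_iso Q ?R'"
      "\<And>a. a \<in> carrier R \<Longrightarrow> \<phi> (S +>\<^bsub>R\<^esub> a) = ?h a"
      "\<And>c x. x \<in> carrier Q \<Longrightarrow>
        c \<odot>\<^bsub>Q\<^esub> x \<in> carrier Q"
      "\<And>c x. x \<in> carrier Q \<Longrightarrow>
        \<phi> (c \<odot>\<^bsub>Q\<^esub> x) = c \<odot>\<^bsub>?R'\<^esub> \<phi> x"
    then show ?thesis
      using that[of \<phi>] Y.algebra_basis_axioms ideal by (simp add: basis_algebra_simps)
  qed
qed

end

section \<open>Tensor products\<close>

interpretation fun_module: Modules.module "scl :: 'k::field \<Rightarrow> ('x \<Rightarrow> 'k) \<Rightarrow> 'x \<Rightarrow> 'k"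
  by unfold_locales (auto simp: fun_eq_iff algebra_simps)

definition prod_mult ::
  "('x \<Rightarrow> 'x \<Rightarrow> 'x option) \<Rightarrow> ('y \<Rightarrow> 'y \<Rightarrow> 'y option) \<Rightarrow> 'x \<times> 'y \<Rightarrow> 'x \<times> 'y \<Rightarrow> ('x \<times> 'y) option" where
  "prod_mult m m' = (\<lambda>(x, y) (x', y'). Option.bind (m x x') (\<lambda>u. map_option (Pair u) (m' y y')))"

definition tens :: "('x \<Rightarrow> 'k::field) \<Rightarrow> ('y \<Rightarrow> 'k) \<Rightarrow> 'x \<times> 'y \<Rightarrow> 'k" where
  "tens f g = (\<lambda>(x, y). f x * g y)"

lemma prod_mult_eq_Some:
  "prod_mult m m' (x, y) (x', y') = Some (u, v) \<longleftrightarrow> m x x' = Some u \<and> m' y y' = Some v"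
  by (auto simp: prod_mult_def bind_eq_Some_conv)

lemma algebra_basis_prod:
  assumes "algebra_basis X m E" "algebra_basis Y m' E'"
  shows "algebra_basis (X \<times> Y) (prod_mult m m') (E \<times> E')"
proof -
  interpret X: algebra_basis X m E by fact
  interpret Y: algebra_basis Y m' E' by fact
  show ?thesis
  proof
    fix p q r assume "p \<in> X \<times> Y" "q \<in> X \<times> Y" "prod_mult m m' p q = Some r"
    moreover obtain x y x' y' u w where "p = (x, y)" "q = (x', y')" "r = (u, w)"
      by (cases p; cases q; cases r) blast
    ultimately show "r \<in> X \<times> Y"
      using X.m_closed[of x x' u] Y.m_closed[of y y' w] by (simp add: prod_mult_eq_Some)
  next
    fix p q r assume "p \<in> X \<times> Y" "q \<in> X \<times> Y" "r \<in> X \<times> Y"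
    then obtain x y x' y' x'' y'' where *: "p = (x, y)" "q = (x', y')" "r = (x'', y'')"
      "x \<in> X" "x' \<in> X" "x'' \<in> X" "y \<in> Y" "y' \<in> Y" "y'' \<in> Y" by blast
    have "Option.bind (prod_mult m m' p q) (\<lambda>u. prod_mult m m' u r)
        = Option.bind (Option.bind (m x x') (\<lambda>u. m u x''))
            (\<lambda>u. map_option (Pair u) (Option.bind (m' y y') (\<lambda>u. m' u y'')))"
      unfolding * prod_mult_def by (cases "m x x'"; cases "m' y y'") simp_all
    also have "\<dots> = Option.bind (Option.bind (m x' x'') (m x))
            (\<lambda>u. map_option (Pair u) (Option.bind (m' y' y'') (m' y)))"
      using * by (simp add: X.m_assoc Y.m_assoc)
    also have "\<dots> = Option.bind (prod_mult m m' q r) (prod_mult m m' p)"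
      unfolding * prod_mult_def by (cases "m x' x''"; cases "m' y' y''") simp_all
    finally show "Option.bind (prod_mult m m' p q) (\<lambda>u. prod_mult m m' u r)
        = Option.bind (prod_mult m m' q r) (prod_mult m m' p)" .
  next
    show "finite (E \<times> E')" "E \<times> E' \<subseteq> X \<times> Y"
      using X.finite_E Y.finite_E X.E_subset Y.E_subset by auto
  next
    fix p assume "p \<in> X \<times> Y"
    then obtain x y where p: "p = (x, y)" "x \<in> X" "y \<in> Y" by blast
    obtain e where e: "e \<in> E" "\<And>a. a \<in> E \<Longrightarrow> m a x = (if a = e then Some x else None)"
      using X.left_unit[OF p(2)] by blast
    obtain e' where e': "e' \<in> E'" "\<And>a. a \<in> E' \<Longrightarrow> m' a y = (if a = e' then Some y else None)"
      using Y.left_unit[OF p(3)] by blast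
    show "\<exists>e\<in>E \<times> E'. \<forall>a\<in>E \<times> E'. prod_mult m m' a p = (if a = e then Some p else None)"
      using e e' by (intro bexI[of _ "(e, e')"]) (auto simp: prod_mult_def p)
    obtain e where e: "e \<in> E" "\<And>a. a \<in> E \<Longrightarrow> m x a = (if a = e then Some x else None)"
      using X.right_unit[OF p(2)] by blast
    obtain e' where e': "e' \<in> E'" "\<And>a. a \<in> E' \<Longrightarrow> m' y a = (if a = e' then Some y else None)"
      using Y.right_unit[OF p(3)] by blast
    show "\<exists>e\<in>E \<times> E'. \<forall>a\<in>E \<times> E'. prod_mult m m' p a = (if a = e then Some p else None)"
      using e e' by (intro bexI[of _ "(e, e')"]) (auto simp: prod_mult_def p)
  qed
qed

lemma support_tens: "support (tens f g) = support f \<times> support g"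
  by (auto simp: tens_def)

lemma tens_scl_left: "tens (scl c f) g = scl c (tens f g)"
proof (rule ext, clarify)
  fix x y
  show "tens (scl c f) g (x, y) = c * tens f g (x, y)"
    unfolding tens_def prod.case by (rule mult.assoc)
qed

lemma tens_scl_right: "tens f (scl c g) = scl c (tens f g)"
proof (rule ext, clarify)
  fix x y
  show "tens f (scl c g) (x, y) = c * tens f g (x, y)"
    unfolding tens_def prod.case by (rule mult.left_commute)
qed

lemma tens_single [simp]: "tens (single x) (single y) = single (x, y)"
  by (auto simp: tens_def single_apply fun_eq_iff)

text \<open>The condition for a product in \<open>prod_mult\<close> is a conjunction of one
  condition per factor, so the fourfold sum is a product of two double sums.\<close>

lemma basis_mult_tens:
  "basis_mult (prod_mult m m') (tens f g) (tens f' g') = tens (basis_mult m f f') (basis_mult m' g g')"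
proof (rule ext, clarify)
  fix u v
  let ?a = "\<lambda>x x'. if m x x' = Some u then f x * f' x' else 0"
  let ?b = "\<lambda>y y'. if m' y y' = Some v then g y * g' y' else 0"
  have "basis_mult (prod_mult m m') (tens f g) (tens f' g') (u, v)
      = (\<Sum>x\<in>support f. \<Sum>y\<in>support g. \<Sum>x'\<in>support f'. \<Sum>y'\<in>support g'. ?a x x' * ?b y y')"
    unfolding basis_mult_def support_tens sum.cartesian_product'
    by (intro sum.cong refl) (auto simp: prod_mult_eq_Some tens_def)
  also have "\<dots> = (\<Sum>x\<in>support f. \<Sum>x'\<in>support f'. ?a x x') * (\<Sum>y\<in>support g. \<Sum>y'\<in>support g'. ?b y y')"
    by (simp only: sum_product)
  finally show "basis_mult (prod_mult m m') (tens f g) (tens f' g') (u, v)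
      = tens (basis_mult m f f') (basis_mult m' g g') (u, v)"
    by (simp add: tens_def basis_mult_def)
qed

lemma lin_ext_tens:
  "lin_ext \<sigma> (tens f g) = lin_ext (\<lambda>x. lin_ext (\<lambda>y. \<sigma> (x, y)) g) f"
  unfolding lin_ext_def support_tens sum.cartesian_product'
  by (simp add: tens_def sum_distrib_left mult.assoc)

text \<open>Meant for maps that send a vector to the basis element of a pair containing it. They are
  linear only modulo the bilinearity relations; modulo these they are still determined by their
  values on basis vectors.\<close>

lemma almost_linear_lin_ext:
  fixes L :: "('x \<Rightarrow> 'k::field) \<Rightarrow> 'y \<Rightarrow> 'k"
  assumes S: "0 \<in> S" "\<And>u v. u \<in> S \<Longrightarrow> v \<in> S \<Longrightarrow> u + v \<in> S" "\<And>c u. u \<in> S \<Longrightarrow> scl c u \<in> S"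
    and add: "\<And>f g. finite (support f) \<Longrightarrow> support f \<subseteq> X \<Longrightarrow> finite (support g) \<Longrightarrow> support g \<subseteq> X \<Longrightarrow>
      L (f + g) - L f - L g \<in> S"
    and scl: "\<And>c f. finite (support f) \<Longrightarrow> support f \<subseteq> X \<Longrightarrow> L (scl c f) - scl c (L f) \<in> S"
    and f: "finite (support f)" "support f \<subseteq> X"
  shows "L f - lin_ext (\<lambda>x. L (single x)) f \<in> S"
proof -
  have sub: "L (lin_ext single (\<lambda>x. if x \<in> A then f x else 0))
      - lin_ext (\<lambda>x. L (single x)) (\<lambda>x. if x \<in> A then f x else 0) \<in> S"
    if "finite A" "A \<subseteq> support f" for A
    using that
  proof (induction A)
    case empty
    \<comment> \<open>The zero function is \<open>scl 0 0\<close>, so homogeneity with factor 0 puts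
      \<open>L 0\<close> into \<open>S\<close>.\<close>
    have "L (scl 0 0) - scl 0 (L 0) \<in> S" by (rule scl) auto
    then show ?case by (simp add: zero_fun_def[symmetric])
  next
    case (insert a A)
    let ?g = "\<lambda>x. if x \<in> A then f x else 0"
    let ?s = "single a :: 'x \<Rightarrow> 'k"
    have g: "finite (support ?g)" "support ?g \<subseteq> X"
      using insert f by (auto intro: finite_subset[of _ A])
    have s: "finite (support ?s)" "support ?s \<subseteq> X"
      using insert f by auto
    have fs: "finite (support (scl (f a) ?s))" "support (scl (f a) ?s) \<subseteq> X"
      using s support_scl_subset[of "f a" ?s] by (auto intro: finite_subset)
    have eq: "(\<lambda>x. if x \<in> insert a A then f x else 0) = scl (f a) ?s + ?g"
      using insert by (auto simp: fun_eq_iff single_apply)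
    have lin: "lin_ext (\<lambda>x. L (single x)) (scl (f a) ?s + ?g)
        = scl (f a) (L ?s) + lin_ext (\<lambda>x. L (single x)) ?g"
      using lin_ext_add[OF fs(1) g(1), of "\<lambda>x. L (single x)"]
        lin_ext_scl[OF s(1), of "\<lambda>x. L (single x)" "f a"] by simp
    have id: "lin_ext single (scl (f a) ?s + ?g) = scl (f a) ?s + ?g" "lin_ext single ?g = ?g"
      by (rule lin_ext_single_self, rule finite_support_add[OF fs(1) g(1)])
        (rule lin_ext_single_self[OF g(1)])
    have IH: "L ?g - lin_ext (\<lambda>x. L (single x)) ?g \<in> S"
      using insert.IH insert.prems unfolding id by blast
    have "L (scl (f a) ?s + ?g) - (scl (f a) (L ?s) + lin_ext (\<lambda>x. L (single x)) ?g)
        = (L (scl (f a) ?s + ?g) - L (scl (f a) ?s) - L ?g) + (L (scl (f a) ?s) - scl (f a) (L ?s))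
          + (L ?g - lin_ext (\<lambda>x. L (single x)) ?g)" by simp
    also have "\<dots> \<in> S"
      by (intro S(2) add[OF fs g] scl[OF s] IH)
    finally show ?case
      unfolding eq lin id .
  qed
  have "(\<lambda>x. if x \<in> support f then f x else 0) = f" by auto
  with sub[OF f(1) order_refl] have "L (lin_ext single f) - lin_ext (\<lambda>x. L (single x)) f \<in> S"
    by (simp only:)
  then show ?thesis using f by (simp add: lin_ext_single_self)
qed

text \<open>An algebra with a chosen multiplicative basis, given by the coordinate map \<phi>.
  Scalars need assumptions of their own because \<open>ring_iso\<close> sees only the ring
  structure.\<close>

locale basis_iso = algebra_basis X m E
  for A :: "('k::field, 'a) module" and X :: "'x set" and m E +
  fixes \<phi>
  assumes ring_A: "ring A"
    and iso: "\<phi> \<in> ring_iso A (basis_algebra X m E :: ('k, 'x \<Rightarrow> 'k) module)"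
    and smult_closed: "a \<in> carrier A \<Longrightarrow> c \<odot>\<^bsub>A\<^esub> a \<in> carrier A"
    and smult: "a \<in> carrier A \<Longrightarrow> \<phi> (c \<odot>\<^bsub>A\<^esub> a) = scl c (\<phi> a)"
begin

sublocale A: ring A by (rule ring_A)

abbreviation \<psi> where "\<psi> \<equiv> inv_into (carrier A) \<phi>"

lemma bij: "bij_betw \<phi> (carrier A) {f. finite (support f) \<and> support f \<subseteq> X}"
  using iso by (simp add: ring_iso_def basis_algebra_simps)

lemma \<phi>_closed: "a \<in> carrier A \<Longrightarrow> finite (support (\<phi> a)) \<and> support (\<phi> a) \<subseteq> X"
  using bij by (auto simp: bij_betw_def)

lemma \<phi>_add: "a \<in> carrier A \<Longrightarrow> b \<in> carrier A \<Longrightarrow> \<phi> (a \<oplus>\<^bsub>A\<^esub> b) = \<phi> a + \<phi> b"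
  using iso by (simp add: ring_iso_def ring_hom_def basis_algebra_simps)

lemma \<phi>_mult: "a \<in> carrier A \<Longrightarrow> b \<in> carrier A \<Longrightarrow> \<phi> (a \<otimes>\<^bsub>A\<^esub> b) = basis_mult m (\<phi> a) (\<phi> b)"
  using iso by (simp add: ring_iso_def ring_hom_def basis_algebra_simps)

lemma \<phi>_one: "\<phi> \<one>\<^bsub>A\<^esub> = (\<lambda>x. if x \<in> E then 1 else 0)"
  using iso by (simp add: ring_iso_def ring_hom_def basis_algebra_simps)

lemma \<psi>_closed:
  assumes "finite (support f)" "support f \<subseteq> X"
  shows "\<psi> f \<in> carrier A" "\<phi> (\<psi> f) = f"
  using assms bij by (auto simp: bij_betw_def intro!: inv_into_into f_inv_into_f)

lemma \<psi>_\<phi>: "a \<in> carrier A \<Longrightarrow> \<psi> (\<phi> a) = a"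
  using bij by (simp add: bij_betw_def)

lemma \<psi>_add:
  assumes "finite (support f)" "support f \<subseteq> X" "finite (support g)" "support g \<subseteq> X"
  shows "\<psi> (f + g) = \<psi> f \<oplus>\<^bsub>A\<^esub> \<psi> g"
proof -
  have "f + g = \<phi> (\<psi> f \<oplus>\<^bsub>A\<^esub> \<psi> g)"
    using assms by (simp add: \<phi>_add \<psi>_closed)
  then show ?thesis
    using assms by (simp add: \<psi>_\<phi> \<psi>_closed)
qed

lemma \<psi>_scl:
  assumes "finite (support f)" "support f \<subseteq> X"
  shows "\<psi> (scl c f) = c \<odot>\<^bsub>A\<^esub> \<psi> f"
proof -
  have "scl c f = \<phi> (c \<odot>\<^bsub>A\<^esub> \<psi> f)"
    using assms by (simp add: smult \<psi>_closed)
  then show ?thesis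
    using assms by (simp add: \<psi>_\<phi> \<psi>_closed smult_closed)
qed

end

text \<open>The free space on all pairs of elements is mapped to the space on pairs of basis
  elements by sending a pair to the tensor of its coordinate vectors. Bilinearity of
  \<open>tens\<close> puts the relations into the kernel. Conversely, the relations allow every pair
  to be expanded in pairs of basis elements, which shows that they span the kernel.\<close>

lemma tensor_algebra_basis_iso:
  fixes A1 :: "('k::field, 'a) module" and A2 :: "('k, 'b) module"
    and X1 :: "'x set" and X2 :: "'y set"
  assumes "basis_iso A1 X1 m1 E1 \<phi>1" "basis_iso A2 X2 m2 E2 \<phi>2"
  shows "alg_iso (tensor_algebra A1 A2) (basis_algebra (X1 \<times> X2) (prod_mult m1 m2) (E1 \<times> E2))"
proof -
  interpret A1: basis_iso A1 X1 m1 E1 \<phi>1 by fact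
  interpret A2: basis_iso A2 X2 m2 E2 \<phi>2 by fact
  define m where "m = (\<lambda>(a, b) (a', b'). Some (a \<otimes>\<^bsub>A1\<^esub> a', b \<otimes>\<^bsub>A2\<^esub> b'))"
  let ?X = "carrier A1 \<times> carrier A2" and ?E = "{(\<one>\<^bsub>A1\<^esub>, \<one>\<^bsub>A2\<^esub>)}"
  let ?R = "basis_algebra ?X m ?E :: ('k, 'a \<times> 'b \<Rightarrow> 'k) module"
  let ?Y = "X1 \<times> X2"
  let ?R' = "basis_algebra ?Y (prod_mult m1 m2) (E1 \<times> E2) :: ('k, 'x \<times> 'y \<Rightarrow> 'k) module"
  interpret R: algebra_basis ?X m ?E
    by unfold_locales (auto simp: m_def A1.A.m_assoc A2.A.m_assoc)
  interpret R: ring ?R by (rule R.ring_basis_algebra)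
  interpret R': algebra_basis ?Y "prod_mult m1 m2" "E1 \<times> E2"
    using A1.algebra_basis_axioms A2.algebra_basis_axioms by (rule algebra_basis_prod)
  interpret R': ring ?R' by (rule R'.ring_basis_algebra)
  define \<phi> where "\<phi> = (\<lambda>(a, b). tens (\<phi>1 a) (\<phi>2 b))"
  define h where "h = lin_ext \<phi>"
  have \<phi>: "finite (support (\<phi> p)) \<and> support (\<phi> p) \<subseteq> ?Y" if "p \<in> ?X" for p
    using that A1.\<phi>_closed A2.\<phi>_closed by (cases p) (auto simp only: \<phi>_def support_tens prod.case)
  have hom: "h \<in> ring_hom ?R ?R'"
    unfolding h_def
  proof (rule lin_ext_ring_hom)
    show "finite (support (\<phi> p)) \<and> support (\<phi> p) \<subseteq> ?Y" if "p \<in> ?X" for p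
      using that by (rule \<phi>)
    show "basis_mult (prod_mult m1 m2) (\<phi> p) (\<phi> q) = (case m p q of None \<Rightarrow> 0 | Some r \<Rightarrow> \<phi> r)"
      if "p \<in> ?X" "q \<in> ?X" for p q
      using that by (cases p; cases q) (simp add: m_def \<phi>_def basis_mult_tens A1.\<phi>_mult A2.\<phi>_mult)
    have one_eq: "(\<lambda>p. if p \<in> ?E then 1 else 0) = (single (\<one>\<^bsub>A1\<^esub>, \<one>\<^bsub>A2\<^esub>) :: 'a \<times> 'b \<Rightarrow> 'k)"
      by (auto simp: fun_eq_iff single_apply)
    show "lin_ext \<phi> (\<lambda>p. if p \<in> ?E then 1 else 0) = (\<lambda>p. if p \<in> E1 \<times> E2 then 1 else 0)"
      unfolding one_eq lin_ext_single by (auto simp: \<phi>_def A1.\<phi>_one A2.\<phi>_one tens_def fun_eq_iff)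
  qed
  interpret hom: ring_hom_ring ?R ?R' h
    using R.ring_axioms R'.ring_axioms hom by (rule ring_hom_ringI2)
  let ?\<sigma> = "\<lambda>(x, y). single (A1.\<psi> (single x), A2.\<psi> (single y)) :: 'a \<times> 'b \<Rightarrow> 'k"
  have \<psi>_single: "A1.\<psi> (single x) \<in> carrier A1" "\<phi>1 (A1.\<psi> (single x)) = single x" if "x \<in> X1" for x
    using that A1.\<psi>_closed[of "single x"] by auto
  have \<psi>_single': "A2.\<psi> (single y) \<in> carrier A2" "\<phi>2 (A2.\<psi> (single y)) = single y" if "y \<in> X2" for y
    using that A2.\<psi>_closed[of "single y"] by auto
  have surj: "h ` carrier ?R = carrier ?R'"
  proof (rule antisym)
    show "h ` carrier ?R \<subseteq> carrier ?R'" using hom.hom_closed by blast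
    show "carrier ?R' \<subseteq> h ` carrier ?R"
    proof
      fix g assume "g \<in> carrier ?R'"
      then have g: "finite (support g)" "support g \<subseteq> ?Y" by (auto simp: basis_algebra_simps)
      have \<sigma>: "finite (support (?\<sigma> p))" "support (?\<sigma> p) \<subseteq> ?X" "h (?\<sigma> p) = single p" if "p \<in> support g" for p
        using that g(2) \<psi>_single \<psi>_single' by (auto simp: h_def \<phi>_def split: prod.splits)
      have "h (lin_ext ?\<sigma> g) = lin_ext (\<lambda>p. h (?\<sigma> p)) g"
        unfolding h_def using g \<sigma>(1) by (intro lin_ext_lin_ext) auto
      also have "\<dots> = lin_ext single g"
        by (rule lin_ext_cong[OF \<sigma>(3)])
      also have "\<dots> = g"
        using g(1) by (rule lin_ext_single_self)
      finally have "h (lin_ext ?\<sigma> g) = g" .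
      moreover have "support (lin_ext ?\<sigma> g) \<subseteq> (\<Union>p\<in>support g. support (?\<sigma> p))"
        unfolding lin_ext_def by (rule support_lin_comb)
      then have "lin_ext ?\<sigma> g \<in> carrier ?R"
        unfolding basis_algebra_simps using finite_support_lin_ext[of g ?\<sigma>, OF g(1) \<sigma>(1)] \<sigma>(2) by blast
      ultimately show "g \<in> h ` carrier ?R" by force
    qed
  qed
  let ?S = "Modules.module.span scl (bilinearity_relations A1 A2)"
  note S = fun_module.span_zero fun_module.span_add fun_module.span_scale
  note rel_base = fun_module.span_base
  have kernel: "?S = a_kernel ?R ?R' h"
  proof (rule antisym)
    have kernel_iff: "f \<in> a_kernel ?R ?R' h \<longleftrightarrow> finite (support f) \<and> support f \<subseteq> ?X \<and> h f = 0" for f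
      unfolding a_kernel_def' basis_algebra_simps by blast
    show "?S \<subseteq> a_kernel ?R ?R' h"
    proof (rule fun_module.span_minimal)
      show "fun_module.subspace (a_kernel ?R ?R' h)"
      proof (rule fun_module.subspaceI)
        show "0 \<in> a_kernel ?R ?R' h" unfolding kernel_iff by (simp add: h_def)
        show "f + g \<in> a_kernel ?R ?R' h" if "f \<in> a_kernel ?R ?R' h" "g \<in> a_kernel ?R ?R' h" for f g
          using additive_subgroup.a_closed[OF ideal.axioms(1)[OF hom.kernel_is_ideal] that]
          by (simp add: basis_algebra_simps)
        show "scl c f \<in> a_kernel ?R ?R' h" if "f \<in> a_kernel ?R ?R' h" for c f
          using hom.kernel_is_ideal that by (rule R.ideal_scl)
      qed
      show "bilinearity_relations A1 A2 \<subseteq> a_kernel ?R ?R' h"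
      proof
        have fin: "finite (support (single p - single q - single r :: 'a \<times> 'b \<Rightarrow> 'k))"
          "finite (support (single p - scl c (single q) :: 'a \<times> 'b \<Rightarrow> 'k))" for p q r c
          by (rule finite_subset[of _ "{p, q, r}"]; auto simp: single_apply)+
        have sub: "support (single p - single q - single r :: 'a \<times> 'b \<Rightarrow> 'k) \<subseteq> {p, q, r}"
          "support (single p - scl c (single q) :: 'a \<times> 'b \<Rightarrow> 'k) \<subseteq> {p, q}" for p q r c
          by (auto simp: single_apply split: if_splits)
        have diff: "h (single p - single q - single r) = \<phi> p - \<phi> q - \<phi> r" for p q r
        proof -
          have "h (single p - single q - single r) = h (single p - single q) - h (single r)"
            unfolding h_def by (intro lin_ext_diff finite_support_diff) auto
          also have "h (single p - single q) = h (single p) - h (single q)"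
            unfolding h_def by (intro lin_ext_diff) auto
          finally show ?thesis unfolding h_def lin_ext_single .
        qed
        have sc: "h (single p - scl c (single q)) = \<phi> p - scl c (\<phi> q)" for p q c
        proof -
          have "h (single p - scl c (single q)) = h (single p) - h (scl c (single q))"
            unfolding h_def by (intro lin_ext_diff finite_support_scl) auto
          also have "h (scl c (single q)) = scl c (h (single q))"
            unfolding h_def by (intro lin_ext_scl) auto
          finally show ?thesis unfolding h_def lin_ext_single .
        qed
        fix t assume "t \<in> bilinearity_relations A1 A2"
        then consider
          a a' b where "t = single (a \<oplus>\<^bsub>A1\<^esub> a', b) - single (a, b) - single (a', b)"
            "a \<in> carrier A1" "a' \<in> carrier A1" "b \<in> carrier A2"
          | a b b' where "t = single (a, b \<oplus>\<^bsub>A2\<^esub> b') - single (a, b) - single (a, b')"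
            "a \<in> carrier A1" "b \<in> carrier A2" "b' \<in> carrier A2"
          | c a b where "t = single (c \<odot>\<^bsub>A1\<^esub> a, b) - scl c (single (a, b))" "a \<in> carrier A1" "b \<in> carrier A2"
          | c a b where "t = single (a, c \<odot>\<^bsub>A2\<^esub> b) - scl c (single (a, b))" "a \<in> carrier A1" "b \<in> carrier A2"
          unfolding bilinearity_relations_def by blast
        then show "t \<in> a_kernel ?R ?R' h"
        proof cases
          case 1
          have h0: "h t = 0"
            unfolding 1(1) diff using 1(2-)
            by (auto simp: \<phi>_def A1.\<phi>_add tens_def fun_eq_iff algebra_simps)
          have fin0: "finite (support t)" unfolding 1(1) by (rule fin)
          have "support t \<subseteq> {(a \<oplus>\<^bsub>A1\<^esub> a', b), (a, b), (a', b)}" unfolding 1 by (rule sub)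
          also have "\<dots> \<subseteq> ?X" using 1 by auto
          finally show ?thesis
            unfolding kernel_iff using h0 fin0 by blast
        next
          case 2
          have h0: "h t = 0"
            unfolding 2(1) diff using 2(2-)
            by (auto simp: \<phi>_def A2.\<phi>_add tens_def fun_eq_iff algebra_simps)
          have fin0: "finite (support t)" unfolding 2(1) by (rule fin)
          have "support t \<subseteq> {(a, b \<oplus>\<^bsub>A2\<^esub> b'), (a, b), (a, b')}" unfolding 2 by (rule sub)
          also have "\<dots> \<subseteq> ?X" using 2 by auto
          finally show ?thesis
            unfolding kernel_iff using h0 fin0 by blast
        next
          case 3
          have h0: "h t = 0"
            unfolding 3(1) sc \<phi>_def prod.case A1.smult[OF 3(2)] tens_scl_left by (rule diff_self)
          have fin0: "finite (support t)" unfolding 3(1) by (rule fin)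
          have "support t \<subseteq> {(c \<odot>\<^bsub>A1\<^esub> a, b), (a, b)}" unfolding 3 by (rule sub)
          also have "\<dots> \<subseteq> ?X" using 3 A1.smult_closed by auto
          finally show ?thesis
            unfolding kernel_iff using h0 fin0 by blast
        next
          case 4
          have h0: "h t = 0"
            unfolding 4(1) sc \<phi>_def prod.case A2.smult[OF 4(3)] tens_scl_right by (rule diff_self)
          have fin0: "finite (support t)" unfolding 4(1) by (rule fin)
          have "support t \<subseteq> {(a, c \<odot>\<^bsub>A2\<^esub> b), (a, b)}" unfolding 4 by (rule sub)
          also have "\<dots> \<subseteq> ?X" using 4 A2.smult_closed by auto
          finally show ?thesis
            unfolding kernel_iff using h0 fin0 by blast
        qed
      qed
    qed
    have lin1: "single (A1.\<psi> f, b) - lin_ext (\<lambda>x. single (A1.\<psi> (single x), b)) f \<in> ?S"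
      if "b \<in> carrier A2" "finite (support f)" "support f \<subseteq> X1" for f b
    proof (rule almost_linear_lin_ext[where X = X1 and L = "\<lambda>f. single (A1.\<psi> f, b)", OF S _ _ that(2,3)])
      fix f g :: "'x \<Rightarrow> 'k" assume fg: "finite (support f)" "support f \<subseteq> X1" "finite (support g)" "support g \<subseteq> X1"
      show "single (A1.\<psi> (f + g), b) - single (A1.\<psi> f, b) - single (A1.\<psi> g, b) \<in> ?S"
        unfolding A1.\<psi>_add[OF fg] using that(1) A1.\<psi>_closed(1)[OF fg(1,2)] A1.\<psi>_closed(1)[OF fg(3,4)]
        unfolding bilinearity_relations_def by (intro rel_base) blast
    next
      fix f :: "'x \<Rightarrow> 'k" and c assume f: "finite (support f)" "support f \<subseteq> X1"
      show "single (A1.\<psi> (scl c f), b) - scl c (single (A1.\<psi> f, b)) \<in> ?S"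
        unfolding A1.\<psi>_scl[OF f] using that(1) A1.\<psi>_closed(1)[OF f]
        unfolding bilinearity_relations_def by (intro rel_base) blast
    qed
    have lin2: "single (a, A2.\<psi> f) - lin_ext (\<lambda>y. single (a, A2.\<psi> (single y))) f \<in> ?S"
      if "a \<in> carrier A1" "finite (support f)" "support f \<subseteq> X2" for f a
    proof (rule almost_linear_lin_ext[where X = X2 and L = "\<lambda>f. single (a, A2.\<psi> f)", OF S _ _ that(2,3)])
      fix f g :: "'y \<Rightarrow> 'k" assume fg: "finite (support f)" "support f \<subseteq> X2" "finite (support g)" "support g \<subseteq> X2"
      show "single (a, A2.\<psi> (f + g)) - single (a, A2.\<psi> f) - single (a, A2.\<psi> g) \<in> ?S"
        unfolding A2.\<psi>_add[OF fg] using that(1) A2.\<psi>_closed(1)[OF fg(1,2)] A2.\<psi>_closed(1)[OF fg(3,4)]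
        unfolding bilinearity_relations_def by (intro rel_base) blast
    next
      fix f :: "'y \<Rightarrow> 'k" and c assume f: "finite (support f)" "support f \<subseteq> X2"
      show "single (a, A2.\<psi> (scl c f)) - scl c (single (a, A2.\<psi> f)) \<in> ?S"
        unfolding A2.\<psi>_scl[OF f] using that(1) A2.\<psi>_closed(1)[OF f]
        unfolding bilinearity_relations_def by (intro rel_base) blast
    qed
    show "a_kernel ?R ?R' h \<subseteq> ?S"
    proof
      fix f assume "f \<in> a_kernel ?R ?R' h"
      then have f: "finite (support f)" "support f \<subseteq> ?X" "lin_ext \<phi> f = 0"
        unfolding kernel_iff unfolding h_def by blast+
      then show "f \<in> ?S"
      proof (rule lin_ext_kernel_subset[where \<sigma> = ?\<sigma>, OF _ _ _ S])
        fix p assume "p \<in> ?X"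
        then obtain a b where p: "p = (a, b)" "a \<in> carrier A1" "b \<in> carrier A2" by blast
        have a: "finite (support (\<phi>1 a))" "support (\<phi>1 a) \<subseteq> X1" using A1.\<phi>_closed[OF p(2)] by auto
        have b: "finite (support (\<phi>2 b))" "support (\<phi>2 b) \<subseteq> X2" using A2.\<phi>_closed[OF p(3)] by auto
        \<comment> \<open>Intermediate stage of the expansion: the first entry is expanded while
          \<open>b\<close> stays fixed, and \<open>?w\<close> then expands the second entry of each
          term.\<close>
        let ?u = "\<lambda>x. single (A1.\<psi> (single x), b) :: 'a \<times> 'b \<Rightarrow> 'k"
        let ?w = "\<lambda>x. lin_ext (\<lambda>y. ?\<sigma> (x, y)) (\<phi>2 b)"
        have uw: "lin_ext (\<lambda>x. ?u x - ?w x) (\<phi>1 a) \<in> ?S"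
        proof (rule lin_ext_in_subspace[OF a(1) S])
          fix x assume "x \<in> support (\<phi>1 a)"
          then have x: "x \<in> X1" using a(2) by blast
          show "?u x - ?w x \<in> ?S"
            using lin2[OF \<psi>_single(1)[OF x] b] p(3) by (simp add: A2.\<psi>_\<phi>)
        qed
        have eq: "lin_ext (\<lambda>x. ?u x - ?w x) (\<phi>1 a) = lin_ext ?u (\<phi>1 a) - lin_ext ?w (\<phi>1 a)"
          by (simp add: lin_ext_def fun_eq_iff sum_subtractf right_diff_distrib)
        have pu: "single p - lin_ext ?u (\<phi>1 a) \<in> ?S"
          using lin1[OF p(3) a] p by (simp add: A1.\<psi>_\<phi>)
        have "single p - lin_ext ?w (\<phi>1 a)
            = (single p - lin_ext ?u (\<phi>1 a)) + (lin_ext ?u (\<phi>1 a) - lin_ext ?w (\<phi>1 a))" by simp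
        also have "\<dots> \<in> ?S"
          using pu uw unfolding eq by (rule S(2))
        finally have "single p - lin_ext ?w (\<phi>1 a) \<in> ?S" .
        then show "single p - lin_ext ?\<sigma> (\<phi> p) \<in> ?S"
          by (simp only: p \<phi>_def prod.case lin_ext_tens)
        from \<open>p \<in> ?X\<close> show "finite (support (\<phi> p))" using \<phi> by blast
      qed
    qed
  qed
  have smult_closed: "c \<odot>\<^bsub>?R\<^esub> a \<in> carrier ?R" if "a \<in> carrier ?R" for c a
    using that support_scl_subset[of c a] finite_support_scl[of a c] unfolding basis_algebra_simps by blast
  have smult: "h (c \<odot>\<^bsub>?R\<^esub> a) = c \<odot>\<^bsub>?R'\<^esub> h a" if "a \<in> carrier ?R" for c a
    using that unfolding basis_algebra_simps h_def by (intro lin_ext_scl) blast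
  define Q where "Q = quotient_algebra ?R ?S"
  have "alg_iso Q ?R'"
    unfolding Q_def
  proof (rule quotient_algebra_iso[OF R.ring_axioms R'.ring_axioms hom surj smult_closed smult kernel])
    fix \<Phi> assume "\<Phi> \<in> ring_iso (quotient_algebra ?R ?S) ?R'"
      "\<And>c x. x \<in> carrier (quotient_algebra ?R ?S) \<Longrightarrow>
        \<Phi> (smult (quotient_algebra ?R ?S) c x) = smult ?R' c (\<Phi> x)"
    then show "alg_iso (quotient_algebra ?R ?S) ?R'"
      unfolding alg_iso_def by blast
  qed
  moreover have "tensor_algebra A1 A2 = Q"
    by (simp add: tensor_algebra_def m_def Q_def)
  ultimately show ?thesis by simp
qed

section \<open>Sublattices and potentials\<close>

lemma int_subgroup_generator:
  fixes Z :: "int set"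
  assumes "0 \<in> Z" "\<And>a b. a \<in> Z \<Longrightarrow> b \<in> Z \<Longrightarrow> a - b \<in> Z"
  obtains g where "g \<in> Z" "\<And>a. a \<in> Z \<Longrightarrow> g dvd a"
proof (cases "Z \<subseteq> {0}")
  case True
  then show ?thesis using that[of 0] assms(1) by auto
next
  case False
  have neg: "- a \<in> Z" if "a \<in> Z" for a
    using assms(2)[OF assms(1) that] by simp
  have add: "a + b \<in> Z" if "a \<in> Z" "b \<in> Z" for a b
    using assms(2)[OF that(1) neg[OF that(2)]] by simp
  from False obtain a where a: "a \<in> Z" "a \<noteq> 0" by blast
  define P where "P k \<longleftrightarrow> k > 0 \<and> int k \<in> Z" for k
  have "P (nat \<bar>a\<bar>)"
    using a neg[OF a(1)] by (auto simp: P_def abs_if)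
  then have P: "P (LEAST k. P k)" by (rule LeastI)
  define g where "g = int (LEAST k. P k)"
  have g: "g > 0" "g \<in> Z" using P by (auto simp: P_def g_def)
  have mult: "int k * g \<in> Z" for k
    by (induction k) (use assms(1) add g(2) in \<open>simp_all add: distrib_right\<close>)
  have mult': "k * g \<in> Z" for k
    using mult[of "nat k"] neg[OF mult[of "nat (- k)"]] by (cases "k \<ge> 0") auto
  show ?thesis
  proof (rule that[OF g(2)])
    fix b assume "b \<in> Z"
    then have "b - (b div g) * g \<in> Z" using mult' assms(2) by blast
    then have "b mod g \<in> Z" by (simp add: minus_div_mult_eq_mod)
    moreover have "b mod g < g" "b mod g \<ge> 0" using g(1) by simp_all
    ultimately have "b mod g = 0"
      using not_less_Least[of "nat (b mod g)" P] by (auto simp: P_def g_def)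
    then show "g dvd b" by auto
  qed
qed

text \<open>Induction on the number of coordinates that determine an element. The values at the last
  coordinate form a subgroup of the integers. An element attaining a generator of it, together with
  generators of the elements that vanish there, generates everything.\<close>

lemma sublattice_generators:
  fixes D :: "('x \<Rightarrow> int) set" and c :: "nat \<Rightarrow> 'x"
  assumes "0 \<in> D" "\<And>f g. f \<in> D \<Longrightarrow> g \<in> D \<Longrightarrow> f - g \<in> D"
    and "\<And>f. f \<in> D \<Longrightarrow> (\<And>k. k < n \<Longrightarrow> f (c k) = 0) \<Longrightarrow> f = 0"
  shows "\<exists>b. (\<forall>k<n. b k \<in> D) \<and> (\<forall>f\<in>D. \<exists>m. f = (\<lambda>x. \<Sum>k<n. m k * b k x))"
  using assms
proof (induction n arbitrary: D)
  case 0
  have "f = 0" if "f \<in> D" for f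
    using that by (rule 0(3)) simp
  then show ?case by (auto simp: zero_fun_def)
next
  case (Suc n)
  let ?D = "{f \<in> D. f (c n) = 0}"
  have "\<exists>b. (\<forall>k<n. b k \<in> ?D) \<and> (\<forall>f\<in>?D. \<exists>m. f = (\<lambda>x. \<Sum>k<n. m k * b k x))"
  proof (rule Suc.IH)
    show "f = 0" if "f \<in> ?D" "\<And>k. k < n \<Longrightarrow> f (c k) = 0" for f
      using that by (intro Suc.prems(3)) (auto simp: less_Suc_eq)
    have "(0 :: 'x \<Rightarrow> int) (c n) = 0" by simp
    with Suc.prems(1) show "0 \<in> ?D" by blast
    show "f - g \<in> ?D" if "f \<in> ?D" "g \<in> ?D" for f g
    proof -
      have "f - g \<in> D" using that by (intro Suc.prems(2)) blast+
      moreover have "(f - g) (c n) = 0" using that by simp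
      ultimately show ?thesis by blast
    qed
  qed
  then obtain b where b: "\<And>k. k < n \<Longrightarrow> b k \<in> ?D" "\<And>f. f \<in> ?D \<Longrightarrow> \<exists>m. f = (\<lambda>x. \<Sum>k<n. m k * b k x)"
    by blast
  have "\<exists>z\<in>(\<lambda>f. f (c n)) ` D. \<forall>a\<in>(\<lambda>f. f (c n)) ` D. z dvd a"
  proof (rule int_subgroup_generator)
    fix z assume "z \<in> (\<lambda>f. f (c n)) ` D" "\<And>a. a \<in> (\<lambda>f. f (c n)) ` D \<Longrightarrow> z dvd a"
    then show ?thesis by blast
  next
    show "0 \<in> (\<lambda>f. f (c n)) ` D" using Suc.prems(1) by force
    show "a - b \<in> (\<lambda>f. f (c n)) ` D" if ab: "a \<in> (\<lambda>f. f (c n)) ` D" "b \<in> (\<lambda>f. f (c n)) ` D" for a b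
    proof -
      obtain f where f: "f \<in> D" "a = f (c n)" using ab(1) by blast
      obtain g where g: "g \<in> D" "b = g (c n)" using ab(2) by blast
      show ?thesis
        by (rule image_eqI[OF _ Suc.prems(2)[OF f(1) g(1)]]) (simp add: f g)
    qed
  qed
  then obtain g where g: "g \<in> D" "\<And>f. f \<in> D \<Longrightarrow> g (c n) dvd f (c n)" by blast
  have neg: "- f \<in> D" if "f \<in> D" for f
    using Suc.prems(2)[OF Suc.prems(1) that] by (simp only: diff_0)
  have add: "f + h \<in> D" if "f \<in> D" "h \<in> D" for f h
    using Suc.prems(2)[OF that(1) neg[OF that(2)]] by (simp only: diff_minus_eq_add)
  have mult: "(\<lambda>x. int k * g x) \<in> D" for k
  proof (induction k)
    case 0
    then show ?case using Suc.prems(1) by (simp add: zero_fun_def)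
  next
    case (Suc k)
    have "(\<lambda>x. int (Suc k) * g x) = (\<lambda>x. int k * g x) + g" by (auto simp: distrib_right)
    then show ?case using add[OF Suc g(1)] by simp
  qed
  have mult': "(\<lambda>x. k * g x) \<in> D" for k
  proof (cases "k \<ge> 0")
    case True
    then show ?thesis using mult[of "nat k"] by simp
  next
    case False
    have "(\<lambda>x. k * g x) = - (\<lambda>x. int (nat (- k)) * g x)" using False by auto
    then show ?thesis using neg[OF mult[of "nat (- k)"]] by simp
  qed
  show ?case
  proof (intro exI[of _ "b(n := g)"] conjI ballI allI impI)
    show "(b(n := g)) k \<in> D" if "k < Suc n" for k
      using that b(1) g(1) by (auto simp: less_Suc_eq)
    fix f assume f: "f \<in> D"
    obtain q where q: "f (c n) = g (c n) * q" using g(2)[OF f] by blast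
    have "f - (\<lambda>x. q * g x) \<in> D"
      by (rule Suc.prems(2)[OF f mult'])
    moreover have "(f - (\<lambda>x. q * g x)) (c n) = 0" using q by simp
    ultimately have "f - (\<lambda>x. q * g x) \<in> ?D" by blast
    then obtain m where m: "f - (\<lambda>x. q * g x) = (\<lambda>x. \<Sum>k<n. m k * b k x)" using b(2) by blast
    show "\<exists>m. f = (\<lambda>x. \<Sum>k<Suc n. m k * (b(n := g)) k x)"
    proof (intro exI[of _ "m(n := q)"] ext)
      fix x
      have "f x - q * g x = (\<Sum>k<n. m k * b k x)" using fun_cong[OF m, of x] by simp
      then show "f x = (\<Sum>k<Suc n. (m(n := q)) k * (b(n := g)) k x)" by simp
    qed
  qed
qed

text \<open>The discrete integral of \<open>g\<close> from 0 to \<open>t\<close>, with the sign that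
  makes the step formula hold for negative \<open>t\<close> too.\<close>

definition int_sum :: "(int \<Rightarrow> int) \<Rightarrow> int \<Rightarrow> int" where
  "int_sum g t = (if t \<ge> 0 then \<Sum>k\<in>{0..<t}. g k else - (\<Sum>k\<in>{t..<0}. g k))"

lemma int_sum_step: "int_sum g (t + 1) = int_sum g t + g t"
proof (cases "t \<ge> 0")
  case True
  then have "{0..<t + 1} = insert t {0..<t}" by auto
  then show ?thesis using True by (simp add: int_sum_def)
next
  case False
  then have "{t..<0} = insert t {t + 1..<0}" by auto
  then show ?thesis using False by (cases "t = - 1") (simp_all add: int_sum_def)
qed

text \<open>A discrete Poincare lemma: edge weights that agree along the two ways around each unit
  square are differences of a function. In the induction, the defect of the earlier potential in the
  new direction is constant along the earlier directions, so it can be summed along the new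
  coordinate alone.\<close>

lemma potential_exists:
  fixes w :: "(nat \<Rightarrow> int) \<Rightarrow> nat \<Rightarrow> int"
  assumes "\<And>f i j. i < n \<Longrightarrow> j < n \<Longrightarrow> i \<noteq> j \<Longrightarrow>
    w f i + w (f + unit_vec i) j = w f j + w (f + unit_vec j) i"
  shows "\<exists>\<theta>. \<forall>f. \<forall>i<n. \<theta> (f + unit_vec i) = \<theta> f + w f i"
  using assms
proof (induction n)
  case 0
  then show ?case by simp
next
  case (Suc n)
  then obtain \<theta> where \<theta>: "\<And>f i. i < n \<Longrightarrow> \<theta> (f + unit_vec i) = \<theta> f + w f i"
    using less_Suc_eq by metis
  define \<delta> where "\<delta> f = w f n - (\<theta> (f + unit_vec n) - \<theta> f)" for f
  have \<delta>: "\<delta> (f + unit_vec i) = \<delta> f" if "i < n" for f i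
  proof -
    have "f + unit_vec i + unit_vec n = f + unit_vec n + unit_vec i" by (simp add: ac_simps)
    then have "\<theta> (f + unit_vec i + unit_vec n) = \<theta> (f + unit_vec n) + w (f + unit_vec n) i"
      using \<theta>[OF that, of "f + unit_vec n"] by (simp only:)
    then show ?thesis
      using Suc.prems[of i n f] \<theta>[OF that, of f] that unfolding \<delta>_def by linarith
  qed
  define \<theta>' where "\<theta>' f = \<theta> f + int_sum (\<lambda>k. \<delta> (f(n := k))) (f n)" for f
  have "\<theta>' (f + unit_vec i) = \<theta>' f + w f i" if "i < Suc n" for f i
  proof (cases "i = n")
    case True
    have "(f + unit_vec n)(n := k) = f(n := k)" for k by (auto simp: unit_vec_def)
    moreover have "(f + unit_vec n) n = f n + 1" by (simp add: unit_vec_def)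
    ultimately have "\<theta>' (f + unit_vec n) = \<theta> (f + unit_vec n) + (int_sum (\<lambda>k. \<delta> (f(n := k))) (f n) + \<delta> f)"
      unfolding \<theta>'_def by (simp only: int_sum_step fun_upd_triv)
    then show ?thesis unfolding True \<theta>'_def \<delta>_def by linarith
  next
    case False
    then have "(f + unit_vec i)(n := k) = f(n := k) + unit_vec i" for k by (auto simp: unit_vec_def)
    moreover have "(f + unit_vec i) n = f n" using False by (simp add: unit_vec_def)
    moreover have "i < n" using False that by simp
    ultimately show ?thesis
      unfolding \<theta>'_def by (simp only: \<theta> \<delta>)
  qed
  then show ?case by blast
qed

section \<open>The root lattice\<close>

text \<open>With \<open>\<alpha>\<^sub>0 + \<dots> + \<alpha>\<^sub>d = 0\<close>, the coefficients of \<open>\<Sum> f\<^sub>i \<alpha>\<^sub>i\<close> are differences of consecutive \<open>f\<^sub>i\<close>.\<close>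

definition alpha_comb :: "nat \<Rightarrow> (nat \<Rightarrow> int) \<Rightarrow> nat \<Rightarrow> int" where
  "alpha_comb d f = (\<lambda>j. if j < d then f j - f (Suc j) else if j = d then f d - f 0 else 0)"

definition one_vec :: "nat \<Rightarrow> nat \<Rightarrow> int" where
  "one_vec d = (\<lambda>i. if i \<le> d then 1 else 0)"

text \<open>Coefficient vectors are functions on all of \<open>nat\<close>;
  \<open>restr d f = f\<close> expresses that \<open>f\<close> lies in
  \<open>\<int>\<^sup>d\<^sup>+\<^sup>1\<close>.\<close>

definition restr :: "nat \<Rightarrow> (nat \<Rightarrow> int) \<Rightarrow> nat \<Rightarrow> int" where
  "restr d f = (\<lambda>i. if i \<le> d then f i else 0)"

definition zmul :: "int \<Rightarrow> ('x \<Rightarrow> int) \<Rightarrow> 'x \<Rightarrow> int" where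
  "zmul c f = (\<lambda>x. c * f x)"

text \<open>The exponent vector of a word of arrow types, that is, the word up to
  reordering.\<close>

definition cnt :: "nat list \<Rightarrow> nat \<Rightarrow> int" where
  "cnt p = (\<lambda>i. int (count_list p i))"

lemma zmul_apply [simp]: "zmul c f x = c * f x" by (simp add: zmul_def)
lemma zmul_0 [simp]: "zmul 0 f = 0" by (simp add: zmul_def fun_eq_iff)
lemma zmul_1 [simp]: "zmul 1 f = f" by (simp add: zmul_def)

lemma cnt_Nil [simp]: "cnt [] = 0" by (simp add: cnt_def fun_eq_iff)
lemma cnt_Cons [simp]: "cnt (i # p) = unit_vec i + cnt p"
  by (auto simp: cnt_def unit_vec_def fun_eq_iff)
lemma cnt_append [simp]: "cnt (p @ q) = cnt p + cnt q"
  by (auto simp: cnt_def fun_eq_iff)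

lemma alpha_comb_0 [simp]: "alpha_comb d 0 = 0" by (auto simp: alpha_comb_def fun_eq_iff)
lemma alpha_comb_add: "alpha_comb d (f + g) = alpha_comb d f + alpha_comb d g"
  by (auto simp: alpha_comb_def fun_eq_iff)
lemma alpha_comb_diff: "alpha_comb d (f - g) = alpha_comb d f - alpha_comb d g"
  by (auto simp: alpha_comb_def fun_eq_iff)
lemma alpha_comb_zmul: "alpha_comb d (zmul c f) = zmul c (alpha_comb d f)"
  by (auto simp: alpha_comb_def fun_eq_iff right_diff_distrib)
lemma alpha_comb_one [simp]: "alpha_comb d (one_vec d) = 0"
  by (auto simp: alpha_comb_def one_vec_def fun_eq_iff)
lemma alpha_comb_unit_vec: "d \<ge> 1 \<Longrightarrow> i \<le> d \<Longrightarrow> alpha_comb d (unit_vec i) = alpha d i"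
  by (auto simp: alpha_comb_def alpha_def unit_vec_def fun_eq_iff)
lemma alpha_comb_restr [simp]: "alpha_comb d (restr d f) = alpha_comb d f"
  by (auto simp: alpha_comb_def restr_def fun_eq_iff)

lemma restr_add: "restr d (f + g) = restr d f + restr d g"
  by (auto simp: restr_def fun_eq_iff)
lemma restr_restr [simp]: "restr d (restr d f) = restr d f"
  by (auto simp: restr_def fun_eq_iff)
lemma restr_id: "(\<And>i. i > d \<Longrightarrow> f i = 0) \<Longrightarrow> restr d f = f"
  by (auto simp: restr_def fun_eq_iff)
lemma restr_one [simp]: "restr d (one_vec d) = one_vec d"
  by (auto simp: restr_def one_vec_def fun_eq_iff)
lemma restr_unit_vec: "i \<le> d \<Longrightarrow> restr d (unit_vec i) = unit_vec i"
  by (auto simp: restr_def unit_vec_def fun_eq_iff)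

lemma sum_alpha_comb: "(\<Sum>j\<le>d. alpha_comb d f j) = 0"
proof -
  have "(\<Sum>j\<le>d. alpha_comb d f j) = (\<Sum>j<d. f j - f (Suc j)) + (f d - f 0)"
    by (simp add: alpha_comb_def lessThan_Suc_atMost[symmetric])
  also have "(\<Sum>j<d. f j - f (Suc j)) = f 0 - f d"
    by (rule sum_lessThan_telescope')
  finally show ?thesis by simp
qed

lemma alpha_comb_in_root_lattice [simp]: "alpha_comb d f \<in> root_lattice d"
  by (simp add: root_lattice_def sum_alpha_comb) (simp add: alpha_comb_def)

lemma alpha_comb_surj:
  assumes "x \<in> root_lattice d"
  obtains f where "alpha_comb d f = x" "restr d f = f"
proof
  \<comment> \<open>Tail sums solve \<open>f j - f (Suc j) = x j\<close>. The condition at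
    \<open>d\<close> also needs \<open>f 0 = 0\<close>, which is the vanishing of the total
    sum.\<close>
  define f where "f = (\<lambda>j. \<Sum>k\<in>{j..d}. x k)"
  have *: "x k = 0" if "k > d" for k using assms that by (simp add: root_lattice_def)
  have "(\<Sum>k\<in>{0..d}. x k) = 0" using assms by (simp add: root_lattice_def atMost_atLeast0)
  then have "f 0 = 0" by (simp add: f_def)
  moreover have "f j = x j + f (Suc j)" if "j < d" for j
    using that by (simp add: f_def sum.atLeast_Suc_atMost)
  ultimately show "alpha_comb d f = x"
    using * by (auto simp: alpha_comb_def fun_eq_iff f_def)
  show "restr d f = f" by (auto simp: restr_def f_def fun_eq_iff)
qed

text \<open>The only relation among the \<open>alpha d i\<close> is that their sum vanishes.\<close>

lemma alpha_comb_eq_0: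
  assumes "alpha_comb d f = 0" "restr d f = f"
  shows "f = zmul (f 0) (one_vec d)"
proof -
  have le: "f j = f 0" if "j \<le> d" for j
    using that
  proof (induction j)
    case (Suc j)
    then show ?case using fun_cong[OF assms(1), of j] by (simp add: alpha_comb_def)
  qed simp
  have gt: "f j = 0" if "j > d" for j
    using fun_cong[OF assms(2), of j] that by (simp add: restr_def)
  show ?thesis
  proof
    fix j
    show "f j = zmul (f 0) (one_vec d) j"
      using le[of j] gt[of j] by (cases "j \<le> d") (simp_all add: one_vec_def)
  qed
qed

lemma cnt_list_exists:
  assumes "\<And>i. f i \<ge> 0" "restr d f = f"
  obtains p where "set p \<subseteq> {..d}" "cnt p = f"
proof
  let ?p = "\<lambda>n. concat (map (\<lambda>i. replicate (nat (f i)) i) [0..<n])"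
  show "set (?p (Suc d)) \<subseteq> {..d}" by auto
  have rep: "count_list (replicate n i) j = (if i = j then n else 0)" for n and i j :: nat
    by (induction n) auto
  have count: "int (count_list (?p n) i) = (if i < n then f i else 0)" for n i
  proof (induction n)
    case (Suc n)
    have "?p (Suc n) = ?p n @ replicate (nat (f n)) n" by simp
    then have "int (count_list (?p (Suc n)) i) = int (count_list (?p n) i) + (if n = i then f n else 0)"
      using assms(1)[of n] by (cases "n = i") (simp_all only: count_list_append rep of_nat_add, simp_all)
    then show ?case unfolding Suc by (simp add: less_Suc_eq)
  qed simp
  then have "cnt (?p (Suc d)) = restr d f"
    by (simp only: cnt_def restr_def count less_Suc_eq_le)
  then show "cnt (?p (Suc d)) = f" using assms(2) by simp
qed

section \<open>Cosets in additive groups\<close>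

lemma r_coset_add_group: "X #>\<^bsub>add_group S\<^esub> y = (\<lambda>z. z + y) ` X"
  by (auto simp: r_coset_def add_group_def)

lemma r_coset_r_coset: "(X #>\<^bsub>add_group S\<^esub> y) #>\<^bsub>add_group S\<^esub> z = X #>\<^bsub>add_group S\<^esub> (y + z)"
  by (auto simp: r_coset_add_group image_image add.assoc)

lemma r_coset_0 [simp]: "X #>\<^bsub>add_group S\<^esub> 0 = X"
  by (simp add: r_coset_add_group)

lemma comm_group_add_group:
  assumes "0 \<in> S" "\<And>x y. x \<in> S \<Longrightarrow> y \<in> S \<Longrightarrow> x - y \<in> S"
  shows "comm_group (add_group S)"
proof -
  have neg: "- x \<in> S" if "x \<in> S" for x using assms(2)[OF assms(1) that] by simp
  have add: "x + y \<in> S" if "x \<in> S" "y \<in> S" for x y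
    using assms(2)[OF that(1) neg[OF that(2)]] by simp
  show ?thesis
    using assms(1) add neg
    by (intro comm_groupI) (auto simp: add_group_def ac_simps intro!: bexI[where x = "- x" for x])
qed

lemma root_lattice_closed:
  "0 \<in> root_lattice d" "x \<in> root_lattice d \<Longrightarrow> y \<in> root_lattice d \<Longrightarrow> x - y \<in> root_lattice d"
  "x \<in> root_lattice d \<Longrightarrow> y \<in> root_lattice d \<Longrightarrow> x + y \<in> root_lattice d"
  by (auto simp: root_lattice_def sum_subtractf sum.distrib)

lemma comm_group_root_group: "comm_group (root_group d)"
  by (intro comm_group_add_group root_lattice_closed)

lemma add_group_subgroupD:
  assumes "comm_group (add_group S)" "subgroup B (add_group S)"
  shows "0 \<in> B" "x \<in> B \<Longrightarrow> y \<in> B \<Longrightarrow> x + y \<in> B" "x \<in> B \<Longrightarrow> - x \<in> B" "B \<subseteq> S"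
proof -
  interpret comm_group "add_group S" by fact
  interpret subgroup B "add_group S" by fact
  show "0 \<in> B" "x \<in> B \<Longrightarrow> y \<in> B \<Longrightarrow> x + y \<in> B"
    using one_closed m_closed by (auto simp: add_group_def)
  show "B \<subseteq> S" using subset by (auto simp: add_group_def)
  assume x: "x \<in> B"
  then have i: "inv\<^bsub>add_group S\<^esub> x \<in> B" by (rule m_inv_closed)
  have "inv\<^bsub>add_group S\<^esub> x + x = 0"
    using l_inv[of x] subset x by (auto simp: add_group_def)
  then show "- x \<in> B" using i by (simp add: add_eq_0_iff2)
qed

lemma r_coset_eq_iff:
  assumes "comm_group (add_group S)" "subgroup B (add_group S)"
  shows "B #>\<^bsub>add_group S\<^esub> x = B #>\<^bsub>add_group S\<^esub> y \<longleftrightarrow> x - y \<in> B"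
proof
  note B = add_group_subgroupD[OF assms]
  assume "B #>\<^bsub>add_group S\<^esub> x = B #>\<^bsub>add_group S\<^esub> y"
  then have "x \<in> (\<lambda>z. z + y) ` B"
    using B(1) by (metis add_0 image_eqI r_coset_add_group)
  then show "x - y \<in> B" by auto
next
  note B = add_group_subgroupD[OF assms]
  assume *: "x - y \<in> B"
  have "z + x \<in> (\<lambda>z. z + y) ` B" if "z \<in> B" for z
    using B(2)[OF that *] by (intro image_eqI[of _ _ "z + (x - y)"]) auto
  moreover have "z + y \<in> (\<lambda>z. z + x) ` B" if "z \<in> B" for z
    using B(2)[OF that B(3)[OF *]] by (intro image_eqI[of _ _ "z + - (x - y)"]) auto
  ultimately show "B #>\<^bsub>add_group S\<^esub> x = B #>\<^bsub>add_group S\<^esub> y"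
    by (auto simp: r_coset_add_group)
qed

section \<open>Path algebras\<close>

lemma zmul_zero: "zmul c 0 = 0"
  by (simp add: zmul_def fun_eq_iff)

lemma count_list_distinct: "distinct p \<Longrightarrow> count_list p x = (if x \<in> set p then 1 else 0)"
  by (induction p) auto

context wf_digraph
begin

lemma is_path_Nil: "is_path G x [] y \<longleftrightarrow> x \<in> verts G \<and> x = y"
  by (auto simp: is_path_def awalk_Nil_iff)

lemma is_path_Cons:
  "is_path G x (a # p) y \<longleftrightarrow> a \<in> arcs G \<and> tail G a = x \<and> is_path G (head G a) p y"
  by (auto simp: is_path_def awalk_Cons_iff)

lemma is_path_append:
  "is_path G x (p @ q) z \<longleftrightarrow> (\<exists>y. is_path G x p y \<and> is_path G y q z)"
proof (induction p arbitrary: x)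
  case Nil
  have "is_path G x q z \<Longrightarrow> x \<in> verts G"
    by (auto simp: is_path_def awalk_def)
  then show ?case by (auto simp: is_path_Nil)
qed (auto simp: is_path_Cons)

lemma is_path_unique: "is_path G x p y \<Longrightarrow> is_path G x p z \<Longrightarrow> y = z"
  by (induction p arbitrary: x) (auto simp: is_path_Nil is_path_Cons)

lemma is_path_verts:
  assumes "is_path G x p y"
  shows "x \<in> verts G" "y \<in> verts G"
  using assms by (auto simp: is_path_def)

lemma algebra_basis_paths:
  assumes "finite (verts G)"
  shows "algebra_basis (paths G) (compose_paths G) {(x, []) | x. x \<in> verts G}"
proof
  fix x y z assume "x \<in> paths G" "y \<in> paths G" "compose_paths G x y = Some z"
  then show "z \<in> paths G"
    by (auto simp: paths_def compose_paths_def split: prod.splits if_splits) (metis is_path_append)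
next
  fix x y z assume "x \<in> paths G" "y \<in> paths G" "z \<in> paths G"
  then obtain a p b b' q c c' r d where *: "x = (a, p)" "y = (b', q)" "z = (c', r)"
    "is_path G a p b" "is_path G b' q c" "is_path G c' r d"
    unfolding paths_def by blast
  have "is_path G a (p @ q) v \<longleftrightarrow> is_path G b' q v" if "b = b'" for v
    using * that is_path_unique by (auto simp: is_path_append)
  moreover have "is_path G a p b' \<longleftrightarrow> b = b'"
    using * is_path_unique by blast
  moreover have "is_path G b' q v \<longleftrightarrow> v = c" for v
    using * is_path_unique by blast
  ultimately show "Option.bind (compose_paths G x y) (\<lambda>u. compose_paths G u z)
      = Option.bind (compose_paths G y z) (compose_paths G x)"
    unfolding * compose_paths_def by (cases "b = b'"; cases "c' = c") simp_all
next
  show "finite {(x, []) | x. x \<in> verts G}"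
    using assms by (simp add: setcompr_eq_image)
  show "{(x, []) | x. x \<in> verts G} \<subseteq> paths G"
    by (auto simp: paths_def is_path_Nil)
next
  fix x assume "x \<in> paths G"
  then obtain a p b where *: "x = (a, p)" "is_path G a p b" by (auto simp: paths_def)
  note verts = is_path_verts[OF *(2)]
  show "\<exists>e\<in>{(x, []) | x. x \<in> verts G}. \<forall>e'\<in>{(x, []) | x. x \<in> verts G}.
      compose_paths G e' x = (if e' = e then Some x else None)"
    using verts by (intro bexI[of _ "(a, [])"]) (auto simp: compose_paths_def * is_path_Nil)
  have "is_path G a p v \<longleftrightarrow> v = b" for v
    using * is_path_unique by blast
  then show "\<exists>e\<in>{(x, []) | x. x \<in> verts G}. \<forall>e'\<in>{(x, []) | x. x \<in> verts G}.
      compose_paths G x e' = (if e' = e then Some x else None)"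
    using verts by (intro bexI[of _ "(b, [])"]) (auto simp: compose_paths_def *(1))
qed

end

lemma basis_mult_diff_left:
  fixes f g h :: "'x \<Rightarrow> 'k::field"
  assumes "finite (support f)" "finite (support g)" "finite (support h)"
  shows "basis_mult m (f - g) h = basis_mult m f h - basis_mult m g h"
proof -
  have "basis_mult m (f - g) h = lin_ext (\<lambda>x. lin_ext (\<lambda>y. basis_elem (m x y)) h) (f - g)"
    by (rule basis_mult_expand[OF finite_support_diff[OF assms(1,2)] assms(3)])
  also have "\<dots> = basis_mult m f h - basis_mult m g h"
    unfolding basis_mult_expand[OF assms(1,3)] basis_mult_expand[OF assms(2,3)]
    by (rule lin_ext_diff[OF assms(1,2)])
  finally show ?thesis .
qed

lemma basis_mult_diff_right:
  fixes f g h :: "'x \<Rightarrow> 'k::field"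
  assumes "finite (support f)" "finite (support g)" "finite (support h)"
  shows "basis_mult m h (f - g) = basis_mult m h f - basis_mult m h g"
  unfolding basis_mult_flip[of m h] by (rule basis_mult_diff_left[OF assms])

section \<open>Cuts and potentials in type \<open>\<A>\<close>-tilde\<close>

text \<open>The lift of a word of types to a path from \<open>X\<close>; it is unique because every
  vertex has one outgoing arrow of each type.\<close>

fun steps :: "nat \<Rightarrow> (nat \<Rightarrow> int) set \<Rightarrow> nat list \<Rightarrow> ((nat \<Rightarrow> int) set \<times> nat) list" where
  "steps d X [] = []"
| "steps d X (i # p) = (X, i) # steps d (X #>\<^bsub>root_group d\<^esub> alpha d i) p"

lemma map_snd_steps [simp]: "map snd (steps d X p) = p"
  by (induction p arbitrary: X) auto

lemma eps_Nil [simp]: "eps C [] = 0" by (simp add: eps_def)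
lemma eps_Cons: "eps C (a # p) = (if a \<in> C then 1 else 0) + eps C p" by (simp add: eps_def)

locale type_A =
  fixes d :: nat and B :: "(nat \<Rightarrow> int) set" and C :: "((nat \<Rightarrow> int) set \<times> nat) set"
  assumes d: "d \<ge> 1" and datum: "rep_infinite_datumA d B C"
begin

abbreviation G where "G \<equiv> root_group d"
abbreviation vs where "vs \<equiv> rcosets\<^bsub>root_group d\<^esub> B"
abbreviation coset where "coset f \<equiv> B #>\<^bsub>root_group d\<^esub> alpha_comb d f"
abbreviation QA where "QA \<equiv> quiverA d B"
abbreviation QC where "QC \<equiv> cut_quiverA d B C"

lemma subgroup_B: "subgroup B G" and finite_vs: "finite vs" and cut: "cutA d B C"
  and bounding: "boundingA d B C"
  using datum by (auto simp: rep_infinite_datumA_def)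

lemmas B = add_group_subgroupD[OF comm_group_root_group subgroup_B]

lemma coset_eq_iff: "coset f = coset g \<longleftrightarrow> alpha_comb d (f - g) \<in> B"
  unfolding r_coset_eq_iff[OF comm_group_root_group subgroup_B] alpha_comb_diff ..

lemma coset_in_vs [simp]: "coset f \<in> vs"
  by (auto simp: RCOSETS_def add_group_def)

lemma vsE:
  assumes "X \<in> vs"
  obtains f where "X = coset f" "restr d f = f"
proof -
  from assms obtain x where "x \<in> root_lattice d" "X = B #>\<^bsub>G\<^esub> x"
    by (auto simp: RCOSETS_def add_group_def)
  then show ?thesis using alpha_comb_surj that by metis
qed

lemma coset_shift: "coset f #>\<^bsub>G\<^esub> alpha_comb d g = coset (f + g)"
  by (simp only: r_coset_r_coset alpha_comb_add)

lemma coset_alpha: "i \<le> d \<Longrightarrow> coset f #>\<^bsub>G\<^esub> alpha d i = coset (f + unit_vec i)"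
  using coset_shift[of f "unit_vec i"] alpha_comb_unit_vec[OF d] by simp

lemma vs_shift: "X \<in> vs \<Longrightarrow> i \<le> d \<Longrightarrow> X #>\<^bsub>G\<^esub> alpha d i \<in> vs"
  by (metis coset_alpha coset_in_vs vsE)

lemma QA_simps: "verts QA = vs" "arcs QA = vs \<times> {..d}" "tail QA = fst"
  "head QA (X, i) = X #>\<^bsub>G\<^esub> alpha d i"
  by (simp_all add: quiverA_def)

lemma QC_simps: "verts QC = vs" "arcs QC = vs \<times> {..d} - C" "tail QC = fst"
  "head QC (X, i) = X #>\<^bsub>G\<^esub> alpha d i"
  by (simp_all add: cut_quiverA_def quiverA_def)

lemma wf_QA: "wf_digraph QA"
proof
  fix e assume "e \<in> arcs QA"
  then show "tail QA e \<in> verts QA" "head QA e \<in> verts QA"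
    by (cases e; simp add: QA_simps vs_shift)+
qed

lemma wf_QC: "wf_digraph QC"
proof
  fix e assume "e \<in> arcs QC"
  then show "tail QC e \<in> verts QC" "head QC e \<in> verts QC"
    by (cases e; simp add: QC_simps vs_shift)+
qed

sublocale QA: wf_digraph QA by (rule wf_QA)
sublocale QC: wf_digraph QC by (rule wf_QC)

text \<open>Paths from a fixed vertex correspond to words of types, and the endpoint sees only the
  exponent vector of the word.\<close>

lemma is_path_QA_iff:
  "is_path QA (coset f) p Y \<longleftrightarrow>
     p = steps d (coset f) (map snd p) \<and> set (map snd p) \<subseteq> {..d} \<and> Y = coset (f + cnt (map snd p))"
proof (induction p arbitrary: f)
  case Nil
  show ?case
    unfolding QA.is_path_Nil list.map cnt_Nil add_0_right steps.simps QA_simps by auto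
next
  case (Cons a p)
  obtain Z i where a: "a = (Z, i)" by (cases a)
  have "is_path QA (coset f) (a # p) Y \<longleftrightarrow> Z = coset f \<and> i \<le> d \<and> is_path QA (coset (f + unit_vec i)) p Y"
    using coset_alpha[of i f] by (auto simp: QA.is_path_Cons QA_simps a simp del: plus_fun_apply)
  moreover have "f + unit_vec i + cnt (map snd p) = f + cnt (map snd (a # p))"
    by (simp add: a add.assoc del: plus_fun_apply)
  ultimately show ?case
    unfolding Cons using coset_alpha[of i f] by (auto simp: a simp del: plus_fun_apply cnt_Cons)
qed

lemma is_path_QC_iff: "is_path QC X p Y \<longleftrightarrow> is_path QA X p Y \<and> eps C p = 0"
proof (induction p arbitrary: X)
  case Nil
  show ?case by (simp only: QA.is_path_Nil QC.is_path_Nil QA_simps QC_simps eps_Nil simp_thms)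
next
  case (Cons a p)
  obtain Z i where a: "a = (Z, i)" by (cases a)
  show ?case
    unfolding a QA.is_path_Cons QC.is_path_Cons QA_simps QC_simps Cons eps_Cons by auto
qed

text \<open>The cut pulled back to the lattice of coefficient vectors, as an integer weight on its
  edges.\<close>

definition weight :: "(nat \<Rightarrow> int) \<Rightarrow> nat \<Rightarrow> int" where
  "weight f i = (if (coset f, i) \<in> C then 1 else 0)"

fun total_weight :: "(nat \<Rightarrow> int) \<Rightarrow> nat list \<Rightarrow> int" where
  "total_weight f [] = 0"
| "total_weight f (i # p) = weight f i + total_weight (f + unit_vec i) p"

lemma eps_steps: "set p \<subseteq> {..d} \<Longrightarrow> int (eps C (steps d (coset f) p)) = total_weight f p"
proof (induction p arbitrary: f)
  case (Cons i p)
  then show ?case using coset_alpha[of i f] by (simp add: eps_Cons weight_def)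
qed simp

text \<open>The word uses each type once and the \<open>alpha d i\<close> sum to 0, so its lift
  closes up to an elementary cycle.\<close>

lemma total_weight_elementary:
  assumes "distinct p" "set p = {..d}"
  shows "total_weight f p = 1"
proof -
  have "cnt p = one_vec d"
    unfolding cnt_def one_vec_def using assms by (auto simp: count_list_distinct)
  then have "coset (f + cnt p) = coset f"
    by (simp add: alpha_comb_add)
  moreover have "length p = d + 1"
    using assms distinct_card[of p] by simp
  ultimately have "elementary_cycleA d B (steps d (coset f) p)"
    using assms is_path_QA_iff[of f "steps d (coset f) p" "coset f"]
    by (metis elementary_cycleA_def length_map map_snd_steps order_refl)
  then have "eps C (steps d (coset f) p) = 1"
    using cut by (simp add: cutA_def)
  then show ?thesis using eps_steps[of p f] assms by simp
qed

text \<open>Complete \<open>i, j\<close> and \<open>j, i\<close> by the same word in the remaining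
  types. Both results are elementary cycles of weight 1, and the common tail starts at the same
  vertex in both, so the two beginnings have the same weight.\<close>

lemma weight_closed:
  assumes "i \<le> d" "j \<le> d" "i \<noteq> j"
  shows "weight f i + weight (f + unit_vec i) j = weight f j + weight (f + unit_vec j) i"
proof -
  define r where "r = filter (\<lambda>k. k \<noteq> i \<and> k \<noteq> j) [0..<Suc d]"
  have r: "distinct r" "set r = {..d} - {i, j}" by (auto simp: r_def)
  have "total_weight f (i # j # r) = 1" "total_weight f (j # i # r) = 1"
    using assms r by (intro total_weight_elementary; auto)+
  moreover have "f + unit_vec i + unit_vec j = f + unit_vec j + unit_vec i" by (simp only: ac_simps)
  ultimately show ?thesis by (simp only: total_weight.simps)
qed

text \<open>The step condition leaves open the value at 0 and the dependence on coordinates above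
  \<open>d\<close>; the last two clauses fix both.\<close>

definition is_potential :: "((nat \<Rightarrow> int) \<Rightarrow> int) \<Rightarrow> bool" where
  "is_potential \<theta> \<longleftrightarrow> (\<forall>f. \<forall>i\<le>d. \<theta> (f + unit_vec i) = \<theta> f + weight f i) \<and> \<theta> 0 = 0 \<and>
     (\<forall>f. \<theta> (restr d f) = \<theta> f)"

definition theta :: "(nat \<Rightarrow> int) \<Rightarrow> int" where
  "theta = (SOME \<theta>. is_potential \<theta>)"

lemma weight_restr: "weight (restr d f) i = weight f i"
  by (simp add: weight_def)

lemma is_potential_theta: "is_potential theta"
proof -
  obtain \<theta> where \<theta>: "\<And>f i. i < Suc d \<Longrightarrow> \<theta> (f + unit_vec i) = \<theta> f + weight f i"
    using potential_exists[of "Suc d" weight] weight_closed by (metis less_Suc_eq_le)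
  define \<theta>' where "\<theta>' f = \<theta> (restr d f) - \<theta> 0" for f
  have "\<theta>' (f + unit_vec i) = \<theta>' f + weight f i" if "i \<le> d" for f i
    unfolding \<theta>'_def restr_add restr_unit_vec[OF that] using \<theta>[of i "restr d f"] that
    by (simp add: weight_restr del: plus_fun_apply)
  moreover have "restr d 0 = 0" by (rule restr_id) simp
  then have "\<theta>' 0 = 0" by (simp only: \<theta>'_def diff_self)
  moreover have "\<theta>' (restr d f) = \<theta>' f" for f by (simp add: \<theta>'_def)
  ultimately have "is_potential \<theta>'"
    unfolding is_potential_def by blast
  then show ?thesis
    unfolding theta_def by (rule someI[of is_potential])
qed

lemma theta_step: "i \<le> d \<Longrightarrow> theta (f + unit_vec i) = theta f + weight f i"
  and theta_0 [simp]: "theta 0 = 0"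
  and theta_restr [simp]: "theta (restr d f) = theta f"
  using is_potential_theta unfolding is_potential_def by blast+

lemma theta_total_weight: "set p \<subseteq> {..d} \<Longrightarrow> theta (f + cnt p) = theta f + total_weight f p"
proof (induction p arbitrary: f)
  case Nil
  then show ?case by (simp only: cnt_Nil add_0_right) simp
next
  case (Cons i p)
  have eq: "f + cnt (i # p) = f + unit_vec i + cnt p" by (simp only: cnt_Cons add.assoc)
  have i: "i \<le> d" "set p \<subseteq> {..d}" using Cons.prems by simp_all
  show ?case
    unfolding eq total_weight.simps Cons.IH[OF i(2)] theta_step[OF i(1)] by (rule add.assoc)
qed

lemma theta_eps: "set p \<subseteq> {..d} \<Longrightarrow> int (eps C (steps d (coset f) p)) = theta (f + cnt p) - theta f"
  unfolding eps_steps theta_total_weight by simp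

text \<open>The positive and the negative part of \<open>g\<close> are exponent vectors of words.
  Adding the negative part to \<open>g\<close>, or the positive part to 0, leads to the same vector,
  so unit steps connect \<open>g\<close> with 0.\<close>

lemma step_invariant_const:
  assumes step: "\<And>g i. i \<le> d \<Longrightarrow> h (g + unit_vec i) = h g" and restr: "\<And>g. h (restr d g) = h g"
  shows "h g = h (0 :: nat \<Rightarrow> int)"
proof -
  have inv: "h (g + cnt p) = h g" if "set p \<subseteq> {..d}" for g p
    using that
  proof (induction p arbitrary: g)
    case Nil
    then show ?case by (simp only: cnt_Nil add_0_right)
  next
    case (Cons i p)
    have eq: "g + cnt (i # p) = g + unit_vec i + cnt p" by (simp only: cnt_Cons add.assoc)
    have i: "i \<le> d" "set p \<subseteq> {..d}" using Cons.prems by simp_all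
    show ?case
      unfolding eq Cons.IH[OF i(2)] by (rule step[OF i(1)])
  qed
  have nn: "restr d (\<lambda>i. max (g i) 0) i \<ge> 0" "restr d (\<lambda>i. max (- g i) 0) i \<ge> 0" for i
    by (simp_all add: restr_def)
  obtain p where p: "set p \<subseteq> {..d}" "cnt p = restr d (\<lambda>i. max (g i) 0)"
    using cnt_list_exists[of "restr d (\<lambda>i. max (g i) 0)" d] nn(1) by (metis restr_restr)
  obtain q where q: "set q \<subseteq> {..d}" "cnt q = restr d (\<lambda>i. max (- g i) 0)"
    using cnt_list_exists[of "restr d (\<lambda>i. max (- g i) 0)" d] nn(2) by (metis restr_restr)
  have "restr d g + cnt q = 0 + cnt p"
    unfolding p q by (auto simp: restr_def fun_eq_iff)
  then have "h (restr d g) = h 0"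
    using inv[OF q(1), of "restr d g"] inv[OF p(1), of 0] by (simp only:)
  then show ?thesis by (simp only: restr)
qed

text \<open>Translation by a period changes no weight. So \<open>theta (f + g) - theta g\<close> is
  constant along unit steps of \<open>g\<close> and equals its value at
  \<open>g = 0\<close>.\<close>

lemma theta_add_period:
  assumes "alpha_comb d f \<in> B"
  shows "theta (f + g) = theta f + theta g"
proof -
  let ?h = "\<lambda>g. theta (f + g) - theta g"
  have "?h g = ?h 0"
  proof (rule step_invariant_const)
    fix g i assume i: "i \<le> d"
    have "f + g - g = f" by (rule add_diff_cancel_right')
    then have "coset (f + g) = coset g" using assms by (simp only: coset_eq_iff)
    then have "weight (f + g) i = weight g i" by (simp only: weight_def)
    moreover have "f + (g + unit_vec i) = f + g + unit_vec i" by (simp only: add.assoc)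
    ultimately show "?h (g + unit_vec i) = ?h g"
      using theta_step[OF i, of "f + g"] theta_step[OF i, of g] by (simp only:)
  next
    fix g
    have "theta (f + restr d g) = theta (restr d (f + restr d g))" by (rule theta_restr[symmetric])
    also have "restr d (f + restr d g) = restr d (f + g)" by (simp only: restr_add restr_restr)
    finally show "?h (restr d g) = ?h g" by (simp only: theta_restr)
  qed
  then show ?thesis by (simp only: theta_0 add_0_right)
qed

text \<open>The word of all types is an elementary cycle and meets the cut once.\<close>

lemma theta_one: "theta (one_vec d) = 1"
proof -
  have "cnt [0..<Suc d] = one_vec d"
    by (auto simp: cnt_def one_vec_def count_list_distinct simp del: upt_Suc)
  moreover have "total_weight 0 [0..<Suc d] = 1"
    by (rule total_weight_elementary) auto
  moreover have "set [0..<Suc d] \<subseteq> {..d}" by auto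
  ultimately show ?thesis
    using theta_total_weight[of "[0..<Suc d]" 0] by (simp only: theta_0 add_0_left)
qed

lemma theta_zmul_period:
  assumes "alpha_comb d f \<in> B"
  shows "theta (zmul c f) = c * theta f"
proof -
  have nat: "theta (zmul (int n) f) = int n * theta f" for n
  proof (induction n)
    case (Suc n)
    have "zmul (int (Suc n)) f = f + zmul (int n) f" by (simp add: zmul_def fun_eq_iff distrib_right)
    then have "theta (zmul (int (Suc n)) f) = theta f + int n * theta f"
      by (simp only: theta_add_period[OF assms] Suc)
    then show ?case by (simp only: of_nat_Suc distrib_right mult_1)
  qed (simp only: zmul_0 theta_0 of_nat_0 mult_zero_left)
  show ?thesis
  proof (cases "c \<ge> 0")
    case True
    then show ?thesis using nat[of "nat c"] by simp
  next
    case False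
    have "zmul (int (nat (- c))) f + zmul c f = 0" using False by (auto simp: zmul_def fun_eq_iff)
    moreover have "alpha_comb d (zmul (int n) f) \<in> B" for n
    proof (induction n)
      case (Suc n)
      have "zmul (int (Suc n)) f = f + zmul (int n) f" by (simp add: zmul_def fun_eq_iff distrib_right)
      then show ?case using B(2)[OF assms Suc] by (simp only: alpha_comb_add)
    qed (simp only: of_nat_0 zmul_0 alpha_comb_0 B(1))
    ultimately have "theta (zmul (int (nat (- c))) f) + theta (zmul c f) = 0"
      using theta_add_period[of "zmul (int (nat (- c))) f" "zmul c f"] by (simp only: theta_0)
    then show ?thesis unfolding nat using False by simp
  qed
qed

lemma theta_add_one: "theta (f + zmul c (one_vec d)) = theta f + c"
proof -
  have "theta (zmul c (one_vec d) + f) = theta (zmul c (one_vec d)) + theta f"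
    by (rule theta_add_period) (simp only: alpha_comb_zmul alpha_comb_one zmul_zero B(1))
  moreover have "theta (zmul c (one_vec d)) = c * theta (one_vec d)"
    by (rule theta_zmul_period) (simp only: alpha_comb_one B(1))
  ultimately show ?thesis by (simp only: theta_one add.commute mult_1_right)
qed

text \<open>By Lagrange, the order of the finite quotient group annihilates it.\<close>

lemma ex_multiple_in_B:
  obtains N where "N > 0" "\<And>f. alpha_comb d (zmul (int N) f) \<in> B"
proof
  interpret comm_group G by (rule comm_group_root_group)
  interpret normal B G using subgroup_B by (rule subgroup_imp_normal)
  interpret Q: group "G Mod B" by (rule factorgroup_is_group)
  have Mod: "X \<otimes>\<^bsub>G Mod B\<^esub> Y = X <#>\<^bsub>G\<^esub> Y" "\<one>\<^bsub>G Mod B\<^esub> = B" "carrier (G Mod B) = vs"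
    "order (G Mod B) = card vs" for X Y
    by (simp_all add: FactGroup_def order_def)
  have G: "x \<otimes>\<^bsub>G\<^esub> y = x + y" "carrier G = root_lattice d" for x y
    by (simp_all add: add_group_def)
  let ?N = "card vs"
  have "vs \<noteq> {}" using coset_in_vs by blast
  then show "?N > 0" using finite_vs by (simp add: card_gt_0_iff)
  fix f
  have pow: "coset f [^]\<^bsub>G Mod B\<^esub> n = coset (zmul (int n) f)" for n
  proof (induction n)
    case 0
    show ?case
      by (simp only: Q.nat_pow_0 of_nat_0 zmul_0 alpha_comb_0 r_coset_0 Mod)
  next
    case (Suc n)
    have eq: "zmul (int (Suc n)) f = zmul (int n) f + f" by (simp add: zmul_def fun_eq_iff distrib_right)
    have "coset f [^]\<^bsub>G Mod B\<^esub> Suc n = coset (zmul (int n) f) <#>\<^bsub>G\<^esub> coset f"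
      by (simp only: Q.nat_pow_Suc Suc Mod)
    also have "\<dots> = B #>\<^bsub>G\<^esub> (alpha_comb d (zmul (int n) f) \<otimes>\<^bsub>G\<^esub> alpha_comb d f)"
      by (rule rcos_sum) (simp_all only: G alpha_comb_in_root_lattice)
    also have "\<dots> = coset (zmul (int (Suc n)) f)"
      by (simp only: eq alpha_comb_add G)
    finally show ?case .
  qed
  have "coset f \<in> carrier (G Mod B)"
    by (simp only: Mod coset_in_vs)
  then have "coset f [^]\<^bsub>G Mod B\<^esub> order (G Mod B) = \<one>\<^bsub>G Mod B\<^esub>"
    by (rule Q.pow_order_eq_1)
  then have "coset (zmul (int ?N) f) = coset 0"
    by (simp only: pow Mod alpha_comb_0 r_coset_0)
  then show "alpha_comb d (zmul (int ?N) f) \<in> B"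
    unfolding coset_eq_iff by (simp only: diff_0_right)
qed

definition period :: nat where
  "period = (SOME N. N > 0 \<and> (\<forall>f. alpha_comb d (zmul (int N) f) \<in> B))"

lemma period: "period > 0" "alpha_comb d (zmul (int period) f) \<in> B"
proof -
  have "\<exists>N. N > 0 \<and> (\<forall>f. alpha_comb d (zmul (int N) f) \<in> B)"
    using ex_multiple_in_B by metis
  then have "period > 0 \<and> (\<forall>f. alpha_comb d (zmul (int period) f) \<in> B)"
    unfolding period_def by (rule someI_ex)
  then show "period > 0" "alpha_comb d (zmul (int period) f) \<in> B" by auto
qed

text \<open>\<open>theta\<close> is additive on periods, and \<open>period\<close> times any vector
  is a period. So \<open>mu i\<close> is \<open>period\<close> times the mean slope of
  \<open>theta\<close> in direction \<open>i\<close>.\<close>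

definition mu :: "nat \<Rightarrow> int" where
  "mu i = theta (zmul (int period) (unit_vec i))"

text \<open>Coordinates are split off one at a time: each summand is an integer multiple of a
  period, where \<open>theta\<close> is additive and homogeneous.\<close>

lemma theta_period: "theta (zmul (int period) f) = (\<Sum>i\<le>d. mu i * f i)"
proof -
  have partial: "theta (zmul (int period) (\<lambda>i. if i < n then f i else 0)) = (\<Sum>i<n. mu i * f i)" for n
  proof (induction n)
    case 0
    have eq: "zmul (int period) (\<lambda>i. if i < 0 then f i else 0) = 0" by (simp add: fun_eq_iff)
    show ?case unfolding eq theta_0 by simp
  next
    case (Suc n)
    let ?u = "zmul (int period) (unit_vec n)" and ?g = "\<lambda>i. if i < n then f i else 0"
    have eq: "zmul (int period) (\<lambda>i. if i < Suc n then f i else 0) = zmul (f n) ?u + zmul (int period) ?g"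
      by (auto simp: fun_eq_iff unit_vec_def less_Suc_eq)
    have u: "alpha_comb d ?u \<in> B" by (rule period(2))
    have "zmul (f n) ?u = zmul (int period) (zmul (f n) (unit_vec n))" by (auto simp: fun_eq_iff)
    then have "alpha_comb d (zmul (f n) ?u) \<in> B" by (simp only: period(2))
    then have "theta (zmul (f n) ?u + zmul (int period) ?g) = f n * mu n + (\<Sum>i<n. mu i * f i)"
      by (simp only: theta_add_period theta_zmul_period[OF u] Suc mu_def)
    then show ?case unfolding eq by (simp only: sum.lessThan_Suc add.commute mult.commute)
  qed
  have "theta (zmul (int period) f) = theta (restr d (zmul (int period) f))" by (rule theta_restr[symmetric])
  also have "restr d (zmul (int period) f) = zmul (int period) (\<lambda>i. if i < Suc d then f i else 0)"
    by (auto simp: restr_def fun_eq_iff)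
  finally show ?thesis unfolding partial by (simp only: lessThan_Suc_atMost)
qed

lemma theta_in_B:
  assumes "alpha_comb d f \<in> B"
  shows "int period * theta f = (\<Sum>i\<le>d. mu i * f i)"
  unfolding theta_period[symmetric] theta_zmul_period[OF assms] ..

text \<open>Walking \<open>period\<close> times along arrows of type \<open>i\<close> closes up. If
  no cut arrow were met, this would be a cycle of the cut quiver, which is acyclic because the cut
  is bounding.\<close>

lemma mu_pos:
  assumes "i \<le> d"
  shows "mu i > 0"
proof -
  let ?p = "replicate period i"
  have c: "cnt ?p = zmul (int period) (unit_vec i)"
  proof -
    have "count_list (replicate n i) j = (if i = j then n else 0)" for n j by (induction n) auto
    then show ?thesis by (auto simp: cnt_def unit_vec_def fun_eq_iff)
  qed
  have p: "set ?p \<subseteq> {..d}" using assms by auto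
  have "int (eps C (steps d (coset 0) ?p)) = theta (0 + cnt ?p) - theta 0"
    by (rule theta_eps[OF p])
  then have "int (eps C (steps d (coset 0) ?p)) = mu i"
    by (simp only: c mu_def add_0_left theta_0 diff_0_right)
  moreover have "eps C (steps d (coset 0) ?p) \<noteq> 0"
  proof
    assume *: "eps C (steps d (coset 0) ?p) = 0"
    have "coset (0 + cnt ?p) = coset 0"
      unfolding coset_eq_iff c by (simp only: add_0_left diff_0_right period(2))
    then have "is_path QC (coset 0) (steps d (coset 0) ?p) (coset 0)"
      unfolding is_path_QC_iff is_path_QA_iff map_snd_steps using * p by blast
    moreover have "steps d (coset 0) ?p \<noteq> []"
      using period(1) by (cases period) auto
    ultimately show False
      using bounding unfolding boundingA_def acyclic_quiver_def by blast
  qed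
  ultimately show ?thesis by linarith
qed

lemma sum_mu: "(\<Sum>i\<le>d. mu i) = int period"
proof -
  have "alpha_comb d (one_vec d) \<in> B" by (simp only: alpha_comb_one B(1))
  then have "int period * theta (one_vec d) = (\<Sum>i\<le>d. mu i * one_vec d i)" by (rule theta_in_B)
  then show ?thesis unfolding theta_one by (simp add: one_vec_def)
qed

end

section \<open>A basis of A(B, C) by classes of paths\<close>

lemma int_count_mset: "int (count (mset p) i) = cnt p i"
  by (induction p) (auto simp: cnt_def)

lemma cnt_eq_iff: "cnt p = cnt q \<longleftrightarrow> mset p = mset q"
  by (simp add: multiset_eq_iff fun_eq_iff flip: int_count_mset)

context type_A
begin

text \<open>A complete invariant of paths of the cut quiver modulo the commutativity
  relations.\<close>

definition cls :: "(nat \<Rightarrow> int) set \<times> ((nat \<Rightarrow> int) set \<times> nat) list \<Rightarrow> (nat \<Rightarrow> int) set \<times> (nat \<Rightarrow> int)" where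
  "cls = (\<lambda>(X, p). (X, cnt (map snd p)))"

definition cls_mult :: "(nat \<Rightarrow> int) set \<times> (nat \<Rightarrow> int) \<Rightarrow> (nat \<Rightarrow> int) set \<times> (nat \<Rightarrow> int) \<Rightarrow>
    ((nat \<Rightarrow> int) set \<times> (nat \<Rightarrow> int)) option" where
  "cls_mult = (\<lambda>(X, f) (Y, g). if Y = (X #>\<^bsub>root_group d\<^esub> alpha_comb d f) then Some (X, f + g) else None)"

definition path_classes :: "((nat \<Rightarrow> int) set \<times> (nat \<Rightarrow> int)) set" where
  "path_classes = cls ` paths QC"

lemma path_QA_D:
  assumes "is_path QA X p Y"
  shows "X \<in> vs" "p = steps d X (map snd p)" "set (map snd p) \<subseteq> {..d}"
    "Y = X #>\<^bsub>G\<^esub> alpha_comb d (cnt (map snd p))"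
proof -
  show X: "X \<in> vs" using QA.is_path_verts(1)[OF assms] by (simp only: QA_simps)
  then obtain f where f: "X = coset f" by (rule vsE)
  show "p = steps d X (map snd p)" "set (map snd p) \<subseteq> {..d}"
    "Y = X #>\<^bsub>G\<^esub> alpha_comb d (cnt (map snd p))"
    using assms unfolding f is_path_QA_iff coset_shift by blast+
qed

text \<open>The number of cut arrows on a path is a difference of values of \<open>theta\<close>,
  hence depends only on the start and the exponent vector. A reordering of a path that avoids the
  cut therefore avoids it again.\<close>

lemma path_permute:
  assumes "is_path QC X (steps d X p) Y" "mset p = mset q"
  shows "is_path QC X (steps d X q) Y"
proof -
  have c: "cnt p = cnt q" using assms(2) by (simp only: cnt_eq_iff)
  have s: "set p = set q" using assms(2) by (rule mset_eq_setD)
  have "is_path QA X (steps d X p) Y" using assms(1) by (simp only: is_path_QC_iff)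
  then have "X \<in> vs" by (rule path_QA_D)
  then obtain f where f: "X = coset f" by (rule vsE)
  have "set p \<subseteq> {..d}"
    using assms(1) unfolding f is_path_QC_iff is_path_QA_iff map_snd_steps by blast
  then have "int (eps C (steps d X q)) = int (eps C (steps d X p))"
    using theta_eps[of p f] theta_eps[of q f] unfolding f c s by linarith
  then show ?thesis
    using assms(1) unfolding f is_path_QC_iff is_path_QA_iff map_snd_steps c s by simp
qed

text \<open>Sorting by exchanges of neighbours: each exchange is a commutativity relation multiplied
  by paths on both sides. By \<open>path_permute\<close> all intermediate words are paths of the cut
  quiver, so a relation is available for every exchange.\<close>

lemma commutativity_relations_permute:
  fixes S :: "((nat \<Rightarrow> int) set \<times> ((nat \<Rightarrow> int) set \<times> nat) list \<Rightarrow> 'k::field) set"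
  assumes ideal: "ideal S (path_algebra QC)" and rel: "commutativity_relations d B C \<subseteq> S"
    and path: "is_path QC X (steps d X p) Y" and perm: "mset p = mset q"
  shows "single (X, steps d X p) - single (X, steps d X q) \<in> S"
proof -
  interpret ideal S "path_algebra QC" by (rule ideal)
  define ok where "ok X p \<longleftrightarrow> (\<exists>Y. is_path QC X (steps d X p) Y)" for X p
  define r where "r X p q \<longleftrightarrow> single (X, steps d X p) - single (X, steps d X q) \<in> S" for X p q
  have ok_perm: "ok X p" if "ok X q" "mset p = mset q" for X p q
    using that path_permute unfolding ok_def by metis
  have carrier: "single z \<in> carrier (path_algebra QC :: ('k, _) module)" if "z \<in> paths QC" for z
    unfolding path_algebra_def basis_algebra_simps using that by simp
  have path_mult: "x \<otimes>\<^bsub>path_algebra QC\<^esub> y = basis_mult (compose_paths QC) x y" for x y :: "_ \<Rightarrow> 'k"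
    by (simp only: path_algebra_def basis_algebra_simps)
  have r_refl: "r X p p" for X p
    using additive_subgroup.zero_closed[OF ideal.axioms(1)[OF ideal]] unfolding r_def path_algebra_def basis_algebra_simps by (simp only: diff_self)
  have r_trans: "r X p q'" if "r X p q" "r X q q'" for X p q q'
  proof -
    have "(single (X, steps d X p) - single (X, steps d X q)) + (single (X, steps d X q) - single (X, steps d X q')) \<in> S"
      using additive_subgroup.a_closed[OF ideal.axioms(1)[OF ideal] that[unfolded r_def]] unfolding path_algebra_def basis_algebra_simps .
    then show ?thesis unfolding r_def by (simp only: diff_add_cancel add_diff_eq)
  qed
  have prefix: "r X (i # p) (i # q)" if "ok X (i # p)" "r (X #>\<^bsub>G\<^esub> alpha d i) p q" for X i p q
  proof -
    let ?X = "X #>\<^bsub>G\<^esub> alpha d i"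
    have "\<exists>Y. is_path QC X (steps d X (i # p)) Y" using that(1) unfolding ok_def .
    then obtain Y where "is_path QC X (steps d X (i # p)) Y" ..
    then have i: "(X, i) \<in> arcs QC" "is_path QC ?X (steps d ?X p) Y"
      unfolding steps.simps QC.is_path_Cons QC_simps(4) by blast+
    have one: "is_path QC X [(X, i)] ?X"
      unfolding QC.is_path_Cons QC.is_path_Nil QC_simps(3,4) fst_conv
      using i(1) QC.is_path_verts(1)[OF i(2)] by blast
    have "single (X, [(X, i)]) \<otimes>\<^bsub>path_algebra QC\<^esub> (single (?X, steps d ?X p) - single (?X, steps d ?X q)) \<in> S"
      using one by (intro I_l_closed that(2)[unfolded r_def] carrier) (auto simp: paths_def)
    also have "single (X, [(X, i)]) \<otimes>\<^bsub>path_algebra QC\<^esub> (single (?X, steps d ?X p) - single (?X, steps d ?X q))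
        = (single (X, steps d X (i # p)) - single (X, steps d X (i # q)) :: _ \<Rightarrow> 'k)"
      unfolding path_mult using one
      by (subst basis_mult_diff_right) (simp_all add: compose_paths_def)
    finally show ?thesis unfolding r_def .
  qed
  have swap: "r X (i # j # p) (j # i # p)" if ok: "ok X (i # j # p)" for X i j p
  proof -
    let ?Xi = "X #>\<^bsub>G\<^esub> alpha d i" and ?Xj = "X #>\<^bsub>G\<^esub> alpha d j"
    let ?Z = "?Xi #>\<^bsub>G\<^esub> alpha d j"
    have Z: "?Xj #>\<^bsub>G\<^esub> alpha d i = ?Z" by (simp only: r_coset_r_coset add.commute)
    \<comment> \<open>The relation asks for all four arrows of the square to lie outside the cut;
      the reordered path supplies the other two.\<close>
    have ok': "ok X (j # i # p)" using ok by (rule ok_perm) simp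
    obtain Y where "is_path QC X (steps d X (i # j # p)) Y" using ok unfolding ok_def by blast
    then have 1: "(X, i) \<in> arcs QC" "(?Xi, j) \<in> arcs QC" "is_path QC ?Z (steps d ?Z p) Y"
      unfolding steps.simps QC.is_path_Cons QC_simps(4) by blast+
    obtain Y' where "is_path QC X (steps d X (j # i # p)) Y'" using ok' unfolding ok_def by blast
    then have 2: "(X, j) \<in> arcs QC" "(?Xj, i) \<in> arcs QC"
      unfolding steps.simps QC.is_path_Cons QC_simps(4) by blast+
    note Zv = QC.is_path_verts(1)[OF 1(3)]
    have pi: "is_path QC X [(X, i), (?Xi, j)] ?Z" "is_path QC X [(X, j), (?Xj, i)] ?Z"
      unfolding QC.is_path_Cons QC.is_path_Nil QC_simps(3,4) fst_conv Z using 1 2 Zv by blast+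
    have "single (X, [(X, i), (?Xi, j)]) - single (X, [(X, j), (?Xj, i)])
        \<in> (commutativity_relations d B C :: (_ \<Rightarrow> 'k) set)"
      unfolding commutativity_relations_def using 1 2 by blast
    then have "single (X, [(X, i), (?Xi, j)]) - single (X, [(X, j), (?Xj, i)]) \<in> S"
      using rel by blast
    then have "(single (X, [(X, i), (?Xi, j)]) - single (X, [(X, j), (?Xj, i)]))
        \<otimes>\<^bsub>path_algebra QC\<^esub> single (?Z, steps d ?Z p) \<in> S"
      using 1(3) by (intro I_r_closed carrier) (auto simp: paths_def)
    also have "(single (X, [(X, i), (?Xi, j)]) - single (X, [(X, j), (?Xj, i)]))
        \<otimes>\<^bsub>path_algebra QC\<^esub> single (?Z, steps d ?Z p)
        = (single (X, steps d X (i # j # p)) - single (X, steps d X (j # i # p)) :: _ \<Rightarrow> 'k)"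
      unfolding path_mult using pi
      by (subst basis_mult_diff_left) (simp_all add: compose_paths_def Z)
    finally show ?thesis unfolding r_def .
  qed
  have bubble: "r X (i # p @ q) (p @ i # q)" if "ok X (i # p @ q)" for X i p q
    using that
  proof (induction p arbitrary: X)
    case Nil
    then show ?case by (simp only: append_Nil r_refl)
  next
    case (Cons j p)
    have ok': "ok X (j # i # p @ q)" using Cons.prems by (rule ok_perm) simp
    then have "ok (X #>\<^bsub>G\<^esub> alpha d j) (i # p @ q)"
      unfolding ok_def steps.simps(2)[of d X j] QC.is_path_Cons QC_simps(4) by blast
    then have "r (X #>\<^bsub>G\<^esub> alpha d j) (i # p @ q) (p @ i # q)" by (rule Cons.IH)
    then have "r X (j # i # p @ q) (j # p @ i # q)" by (rule prefix[OF ok'])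
    moreover have "r X (i # j # p @ q) (j # i # p @ q)"
      using Cons.prems unfolding append_Cons by (rule swap)
    ultimately show ?case unfolding append_Cons by (rule r_trans[rotated])
  qed
  have "r X p q" if "ok X p" "mset p = mset q" for X p q
    using that
  proof (induction p arbitrary: X q)
    case Nil
    then show ?case by (simp add: r_refl)
  next
    case (Cons i p)
    then have "i \<in> set q" by (metis list.set_intros(1) mset_eq_setD)
    then obtain q1 q2 where q: "q = q1 @ i # q2" by (meson split_list)
    have perm: "mset p = mset (q1 @ q2)" using Cons.prems(2) by (simp add: q)
    have "ok (X #>\<^bsub>G\<^esub> alpha d i) p"
      using Cons.prems(1) unfolding ok_def steps.simps(2)[of d X i] QC.is_path_Cons QC_simps(4) by blast
    then have "r (X #>\<^bsub>G\<^esub> alpha d i) p (q1 @ q2)" using perm by (rule Cons.IH)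
    then have 1: "r X (i # p) (i # q1 @ q2)" by (rule prefix[OF Cons.prems(1)])
    have "ok X (i # q1 @ q2)" using Cons.prems(1) by (rule ok_perm) (simp add: perm)
    then have 2: "r X (i # q1 @ q2) q" unfolding q by (rule bubble)
    show ?case by (rule r_trans[OF 1 2])
  qed
  then show ?thesis using path perm unfolding r_def ok_def by blast
qed

lemma basis_iso_algebraA:
  obtains \<phi> where "basis_iso (algebraA d B C :: ('k::field, _) module) path_classes cls_mult ((\<lambda>X. (X, 0)) ` vs) \<phi>"
proof -
  let ?E = "{(x, []) | x. x \<in> verts QC}"
  interpret P: algebra_basis "paths QC" "compose_paths QC" ?E
    by (rule QC.algebra_basis_paths) (simp only: QC_simps finite_vs)
  define R where "R = (path_algebra QC :: ('k, _) module)"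
  define T where "T = (commutativity_relations d B C :: (_ \<Rightarrow> 'k) set)"
  define S where "S = genideal R T"
  define Q where "Q = quotient_algebra R S"
  have R: "R = basis_algebra (paths QC) (compose_paths QC) ?E"
    by (simp only: R_def path_algebra_def)
  interpret R: ring R unfolding R by (rule P.ring_basis_algebra)
  have path_D: "X \<in> vs \<and> p = steps d X (map snd p) \<and> Y = X #>\<^bsub>G\<^esub> alpha_comb d (cnt (map snd p))"
    if "is_path QC X p Y" for X p Y
    using that path_QA_D[of X p Y] unfolding is_path_QC_iff by blast
  have "T \<subseteq> {single x - single y | x y. x \<in> paths QC \<and> y \<in> paths QC \<and> cls x = cls y}"
  proof
    fix t assume "t \<in> T"
    then obtain X i j where t: "t = single (X, [(X, i), (X #>\<^bsub>G\<^esub> alpha d i, j)])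
        - single (X, [(X, j), (X #>\<^bsub>G\<^esub> alpha d j, i)])"
      and arcs: "(X, i) \<in> arcs QC" "(X #>\<^bsub>G\<^esub> alpha d i, j) \<in> arcs QC"
        "(X, j) \<in> arcs QC" "(X #>\<^bsub>G\<^esub> alpha d j, i) \<in> arcs QC"
      unfolding T_def commutativity_relations_def by blast
    have h: "head QC e \<in> verts QC" if "e \<in> arcs QC" for e
      using that by (rule QC.head_in_verts)
    have "is_path QC X [(X, i), (X #>\<^bsub>G\<^esub> alpha d i, j)] (head QC (X #>\<^bsub>G\<^esub> alpha d i, j))"
      "is_path QC X [(X, j), (X #>\<^bsub>G\<^esub> alpha d j, i)] (head QC (X #>\<^bsub>G\<^esub> alpha d j, i))"
      using arcs h by (simp_all only: QC.is_path_Cons QC.is_path_Nil QC_simps(3,4) fst_conv simp_thms)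
        (simp_all only: QC_simps(4)[symmetric] h)
    moreover have "cls (X, [(X, i), (X #>\<^bsub>G\<^esub> alpha d i, j)]) = cls (X, [(X, j), (X #>\<^bsub>G\<^esub> alpha d j, i)])"
      unfolding cls_def by (simp add: ac_simps del: plus_fun_apply)
    ultimately show "t \<in> {single x - single y | x y. x \<in> paths QC \<and> y \<in> paths QC \<and> cls x = cls y}"
      unfolding t paths_def by blast
  qed
  note T = this
  have T_carrier: "T \<subseteq> carrier R"
  proof
    fix t assume "t \<in> T"
    then obtain x y where t: "t = single x - single y" "x \<in> paths QC" "y \<in> paths QC" using T by blast
    moreover have "support t \<subseteq> {x, y}" unfolding t(1) by (auto simp: single_apply)
    ultimately show "t \<in> carrier R"
      unfolding R basis_algebra_simps using finite_subset[of "support t" "{x, y}"] by blast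
  qed
  have ideal: "ideal S R" unfolding S_def by (rule R.genideal_ideal[OF T_carrier])
  have TS: "T \<subseteq> S" unfolding S_def by (rule R.genideal_self[OF T_carrier])
  have cls_mult: "cls_mult (cls x) (cls y) = map_option cls (compose_paths QC x y)"
    if xy: "x \<in> paths QC" "y \<in> paths QC" for x y
  proof -
    obtain X p Z where x: "x = (X, p)" "is_path QC X p Z" using xy(1) by (auto simp: paths_def)
    obtain Y q where y: "y = (Y, q)" by (cases y)
    have "is_path QC X p Y \<longleftrightarrow> Y = X #>\<^bsub>G\<^esub> alpha_comb d (cnt (map snd p))"
      using x(2) path_D by blast
    then show ?thesis
      unfolding x(1) y cls_def cls_mult_def compose_paths_def by simp
  qed
  have inj: "inj_on cls ?E" by (auto simp: inj_on_def cls_def)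
  have Idl: "single x - single y \<in> S" if xy: "x \<in> paths QC" "y \<in> paths QC" "cls x = cls y" for x y
  proof -
    obtain X p Z where x: "x = (X, p)" "is_path QC X p Z" using xy(1) by (auto simp: paths_def)
    obtain Y q W where y: "y = (Y, q)" "is_path QC Y q W" using xy(2) by (auto simp: paths_def)
    have XY: "Y = X" and c: "cnt (map snd p) = cnt (map snd q)" using xy(3) by (auto simp: x y cls_def)
    have p: "p = steps d X (map snd p)" and q: "q = steps d X (map snd q)"
      using path_D x(2) y(2) XY by blast+
    have "single (X, steps d X (map snd p)) - single (X, steps d X (map snd q)) \<in> S"
      by (rule commutativity_relations_permute[OF ideal[unfolded R_def] TS[unfolded T_def], of X _ Z])
        (use x(2) p c in \<open>simp_all only: cnt_eq_iff\<close>)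
    then show ?thesis unfolding x(1) y(1) XY using p q by (simp only:)
  qed
  have Eimg: "cls ` ?E = (\<lambda>X. (X, 0)) ` vs"
    by (force simp: cls_def QC_simps)
  have algebra: "algebraA d B C = Q"
    by (simp only: algebraA_def Let_def Q_def S_def R_def T_def)
  show thesis
  proof (rule P.quotient_by_classes[OF R S_def Q_def cls_mult inj T Idl])
    fix \<phi>
    assume *: "\<phi> \<in> ring_iso Q (basis_algebra (cls ` paths QC) cls_mult (cls ` ?E))"
      "\<And>c x. x \<in> carrier Q \<Longrightarrow> c \<odot>\<^bsub>Q\<^esub> x \<in> carrier Q"
      "\<And>c x. x \<in> carrier Q \<Longrightarrow> \<phi> (c \<odot>\<^bsub>Q\<^esub> x) = scl c (\<phi> x)"
      "algebra_basis (cls ` paths QC) cls_mult (cls ` ?E)"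
    have "ring Q" unfolding Q_def by (rule ring_quotient_algebra[OF ideal])
    then have "basis_iso Q path_classes cls_mult ((\<lambda>X. (X, 0)) ` vs) \<phi>"
      using * unfolding basis_iso_def basis_iso_axioms_def path_classes_def Eimg by blast
    then show thesis using that unfolding algebra by blast
  qed
qed

end

section \<open>The polytope\<close>

text \<open>The hull is the free sum of two simplices that meet in 0, a relative interior point of
  each with barycentric coordinates proportional to \<open>c\<close>. By \<open>only_rel\<close>
  their linear spans are independent and each simplex has a single relation up to scaling.\<close>

locale two_simplices =
  fixes X1 X2 :: "'x set" and c :: "'x \<Rightarrow> real" and u :: "'x \<Rightarrow> 'a::euclidean_space"
  assumes fin1: "finite X1" and fin2: "finite X2" and disj: "X1 \<inter> X2 = {}"
    and card1: "card X1 \<ge> 2" and card2: "card X2 \<ge> 2"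
    and card_sum: "card X1 + card X2 = DIM('a) + 2"
    and c_pos: "\<And>x. x \<in> X1 \<union> X2 \<Longrightarrow> c x > 0"
    and rel1: "(\<Sum>x\<in>X1. c x *\<^sub>R u x) = 0" and rel2: "(\<Sum>x\<in>X2. c x *\<^sub>R u x) = 0"
    and only_rel: "\<And>t. (\<Sum>x\<in>X1 \<union> X2. t x *\<^sub>R u x) = 0 \<Longrightarrow>
      \<exists>a b. (\<forall>x\<in>X1. t x = a * c x) \<and> (\<forall>x\<in>X2. t x = b * c x)"
begin

abbreviation X where "X \<equiv> X1 \<union> X2"
abbreviation P where "P \<equiv> convex hull (u ` X)"

lemma finite_X: "finite X" using fin1 fin2 by simp

text \<open>On each simplex the coefficients of a relation are a multiple of the positive numbers
  \<open>c\<close>, and a simplex has at least two points. So no relation has exactly one positive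
  or exactly one negative coefficient; injectivity and convex position both rest on this.\<close>

lemma same_sign:
  assumes "(\<Sum>x\<in>X. t x *\<^sub>R u x) = 0" "x \<in> X" "t x \<noteq> 0"
  obtains z where "z \<in> X" "z \<noteq> x" "t z * t x > 0"
proof -
  obtain a b where ab: "\<And>x. x \<in> X1 \<Longrightarrow> t x = a * c x" "\<And>x. x \<in> X2 \<Longrightarrow> t x = b * c x"
    using only_rel[OF assms(1)] by blast
  have other: "\<exists>z\<in>Y. z \<noteq> x" if "card Y \<ge> 2" for Y
  proof (rule ccontr)
    assume "\<not> (\<exists>z\<in>Y. z \<noteq> x)"
    then have "Y \<subseteq> {x}" by blast
    then have "card Y \<le> 1" using card_mono[of "{x}" Y] by simp
    then show False using that by simp
  qed
  have sign: "(e * c z) * (e * c x) > 0" if "e * c x \<noteq> 0" "z \<in> X" for e z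
  proof -
    have "(e * c z) * (e * c x) = (e * e) * (c z * c x)" by simp
    also have "\<dots> > 0"
    proof (rule mult_pos_pos)
      have "e \<noteq> 0" using that(1) by auto
      then show "0 < e * e" using not_real_square_gt_zero[of e] by blast
      show "0 < c z * c x" using c_pos[OF that(2)] c_pos[OF assms(2)] by simp
    qed
    finally show ?thesis .
  qed
  show thesis
  proof (cases "x \<in> X1")
    case True
    obtain z where z: "z \<in> X1" "z \<noteq> x" using other[OF card1] by blast
    have "t z * t x > 0" using sign[of a z] ab(1)[OF True] ab(1)[OF z(1)] z assms(3) by simp
    then show thesis using that[of z] z by blast
  next
    case False
    then have x: "x \<in> X2" using assms(2) by blast
    obtain z where z: "z \<in> X2" "z \<noteq> x" using other[OF card2] by blast
    have "t z * t x > 0" using sign[of b z] ab(2)[OF x] ab(2)[OF z(1)] z assms(3) by simp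
    then show thesis using that[of z] z by blast
  qed
qed

lemma inj_u: "inj_on u X"
proof (rule inj_onI, rule ccontr)
  fix x y assume xy: "x \<in> X" "y \<in> X" "u x = u y" "x \<noteq> y"
  define t where "t z = (if z = x then 1 else if z = y then -1 else 0 :: real)" for z
  have "(\<Sum>z\<in>X. t z *\<^sub>R u z) = (\<Sum>z\<in>{x, y}. t z *\<^sub>R u z)"
    by (rule sum.mono_neutral_right) (use finite_X xy in \<open>auto simp: t_def\<close>)
  also have "\<dots> = 0" using xy by (simp add: t_def)
  finally obtain z where "z \<in> X" "z \<noteq> x" "t z * t x > 0"
    using same_sign[of t x] xy by (auto simp: t_def)
  then show False by (auto simp: t_def split: if_splits)
qed

text \<open>An affine relation avoiding \<open>x0\<close> is a linear relation with coefficient 0 at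
  \<open>x0\<close>, so it vanishes on all of \<open>X1\<close>. On \<open>X2\<close> it is
  \<open>b\<close> times \<open>c\<close>; its coefficients sum to 0 while \<open>c\<close> is
  positive, hence \<open>b = 0\<close>.\<close>

lemma affine_independent_Diff1:
  assumes "x0 \<in> X1"
  shows "\<not> affine_dependent (u ` (X - {x0}))"
proof
  let ?Y = "X - {x0}"
  assume "affine_dependent (u ` ?Y)"
  then obtain U where U: "sum U (u ` ?Y) = 0" "\<exists>w\<in>u ` ?Y. U w \<noteq> 0" "(\<Sum>w\<in>u ` ?Y. U w *\<^sub>R w) = 0"
    using affine_dependent_explicit_finite[of "u ` ?Y"] finite_X by auto
  have inj: "inj_on u ?Y" using inj_u by (rule inj_on_subset) blast
  define t where "t z = (if z = x0 then 0 else U (u z))" for z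
  \<comment> \<open>One summation rule for two uses: for the relation itself and for the sum of its
    coefficients.\<close>
  have t: "(\<Sum>z\<in>X. f (t z) z) = (\<Sum>z\<in>?Y. f (U (u z)) z)" if "\<And>z. f 0 z = 0" for f :: "real \<Rightarrow> 'x \<Rightarrow> 'c::comm_monoid_add"
  proof -
    have "(\<Sum>z\<in>X. f (t z) z) = f (t x0) x0 + (\<Sum>z\<in>?Y. f (t z) z)"
      using finite_X assms by (intro sum.remove) auto
    also have "(\<Sum>z\<in>?Y. f (t z) z) = (\<Sum>z\<in>?Y. f (U (u z)) z)"
      by (rule sum.cong) (auto simp: t_def)
    finally show ?thesis by (simp add: t_def that)
  qed
  have "(\<Sum>z\<in>X. t z *\<^sub>R u z) = 0"
    using t[of "\<lambda>a z. a *\<^sub>R u z"] U(3) by (simp add: sum.reindex[OF inj])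
  then obtain a b where ab: "\<And>x. x \<in> X1 \<Longrightarrow> t x = a * c x" "\<And>x. x \<in> X2 \<Longrightarrow> t x = b * c x"
    using only_rel[of t] by blast
  have "a = 0" using ab(1)[OF assms] c_pos[of x0] assms by (auto simp: t_def)
  then have t1: "t x = 0" if "x \<in> X1" for x using ab(1)[OF that] by simp
  have "(\<Sum>z\<in>X. t z) = 0"
    using t[of "\<lambda>a z. a"] U(1) by (simp add: sum.reindex[OF inj])
  moreover have "(\<Sum>z\<in>X. t z) = (\<Sum>z\<in>X2. t z)"
    using finite_X t1 by (intro sum.mono_neutral_right) auto
  moreover have "(\<Sum>z\<in>X2. t z) = b * (\<Sum>z\<in>X2. c z)"
    using ab(2) by (simp add: sum_distrib_left)
  moreover have "X2 \<noteq> {}" using card2 by auto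
  then have "(\<Sum>z\<in>X2. c z) > 0" using c_pos fin2 by (intro sum_pos) auto
  ultimately have "b = 0" by auto
  then have t0: "t x = 0" if "x \<in> X" for x using ab(2) t1 that by auto
  obtain x where "x \<in> ?Y" "U (u x) \<noteq> 0" using U(2) by blast
  then show False using t0[of x] by (auto simp: t_def)
qed

lemma aff_dim_P: "aff_dim P = int DIM('a)"
proof -
  have "X1 \<noteq> {}" using card1 by auto
  then obtain x0 where x0: "x0 \<in> X1" by blast
  have "inj_on u (X - {x0})" using inj_u by (rule inj_on_subset) blast
  then have "card (u ` (X - {x0})) = card (X - {x0})" by (rule card_image)
  also have "\<dots> = DIM('a) + 1"
    using x0 finite_X card_sum disj fin1 fin2 by (simp add: card_Un_disjoint)
  finally have "aff_dim (u ` (X - {x0})) = int DIM('a)"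
    using aff_dim_affine_independent[OF affine_independent_Diff1[OF x0]] by simp
  moreover have "aff_dim (u ` (X - {x0})) \<le> aff_dim (u ` X)" by (intro aff_dim_subset) blast
  ultimately show ?thesis
    using aff_dim_le_DIM[of "u ` X"] unfolding aff_dim_convex_hull by simp
qed

lemma polytope_P: "polytope P"
  by (rule polytope_convex_hull) (use finite_X in simp)

text \<open>The two relations together write 0 as a combination of all points with positive
  coefficients. Scaled to sum 1, this places 0 in the relative interior, and the hull has full
  dimension.\<close>

lemma zero_in_interior: "0 \<in> interior P"
proof -
  let ?s1 = "\<Sum>x\<in>X1. c x" and ?s2 = "\<Sum>x\<in>X2. c x"
  define s where "s = ?s1 + ?s2"
  have "X1 \<noteq> {}" using card1 by auto
  then have "?s1 > 0" using c_pos fin1 by (intro sum_pos) auto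
  moreover have "?s2 \<ge> 0" using c_pos by (intro sum_nonneg) (auto intro: less_imp_le)
  ultimately have s: "s > 0" by (simp add: s_def)
  have split: "(\<Sum>x\<in>X. f x) = (\<Sum>x\<in>X1. f x) + (\<Sum>x\<in>X2. f x)" for f :: "'x \<Rightarrow> 'c::comm_monoid_add"
    using fin1 fin2 disj by (rule sum.union_disjoint)
  define U where "U w = c (inv_into X u w) / s" for w
  have U: "U (u x) = c x / s" if "x \<in> X" for x using that inj_u by (simp add: U_def)
  have "(\<Sum>w\<in>u ` X. U w) = (\<Sum>x\<in>X. c x / s)"
    unfolding sum.reindex[OF inj_u] using U by (intro sum.cong) auto
  also have "\<dots> = 1" using s by (simp add: split s_def sum_divide_distrib[symmetric] add_divide_distrib[symmetric])
  finally have 1: "(\<Sum>w\<in>u ` X. U w) = 1" .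
  have "(\<Sum>w\<in>u ` X. U w *\<^sub>R w) = (\<Sum>x\<in>X. (1 / s) *\<^sub>R (c x *\<^sub>R u x))"
    unfolding sum.reindex[OF inj_u] using U by (intro sum.cong) auto
  also have "\<dots> = 0" by (simp only: scaleR_sum_right[symmetric] split rel1 rel2) simp
  finally have 0: "(\<Sum>w\<in>u ` X. U w *\<^sub>R w) = 0" .
  have "\<forall>w\<in>u ` X. 0 < U w" using U c_pos s by auto
  then have "0 \<in> rel_interior P"
    using explicit_subset_rel_interior_convex_hull_minimal[of "u ` X"] finite_X 0 1 by blast
  moreover have "affine hull P = UNIV"
    using aff_dim_P aff_dim_eq_full by blast
  ultimately show ?thesis using rel_interior_interior by blast
qed

text \<open>If a proper subset had the same hull, an omitted point would be a convex combination of
  the others. That is a relation with a single negative coefficient, which \<open>same_sign\<close>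
  excludes.\<close>

lemma extreme_points: "{w. w extreme_point_of P} = u ` X"
proof (rule extreme_points_of_convex_hull_eq)
  show "compact (u ` X)" using finite_X by (simp add: finite_imp_compact)
  fix T assume T: "T \<subset> u ` X"
  show "convex hull T \<noteq> P"
  proof
    assume eq: "convex hull T = P"
    obtain x0 where x0: "x0 \<in> X" "u x0 \<notin> T" using T by blast
    let ?Y = "X - {x0}"
    have "u x0 \<in> convex hull T" unfolding eq using x0 by (intro hull_inc) blast
    moreover have "T \<subseteq> u ` ?Y" using T x0 by blast
    ultimately have "u x0 \<in> convex hull (u ` ?Y)" using hull_mono by blast
    then obtain U where U: "\<forall>w\<in>u ` ?Y. 0 \<le> U w" "(\<Sum>w\<in>u ` ?Y. U w *\<^sub>R w) = u x0"
      using convex_hull_finite[of "u ` ?Y"] finite_X by auto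
    have inj: "inj_on u ?Y" using inj_u by (rule inj_on_subset) blast
    define t where "t z = (if z = x0 then -1 else U (u z))" for z
    have "(\<Sum>z\<in>X. t z *\<^sub>R u z) = t x0 *\<^sub>R u x0 + (\<Sum>z\<in>?Y. t z *\<^sub>R u z)"
      using finite_X x0 by (intro sum.remove) auto
    also have "(\<Sum>z\<in>?Y. t z *\<^sub>R u z) = (\<Sum>z\<in>?Y. U (u z) *\<^sub>R u z)"
      by (rule sum.cong) (auto simp: t_def)
    also have "\<dots> = u x0" using U(2) by (simp add: sum.reindex[OF inj])
    finally have "(\<Sum>z\<in>X. t z *\<^sub>R u z) = 0" by (simp add: t_def)
    then obtain z where "z \<in> X" "z \<noteq> x0" "t z * t x0 > 0"
      using same_sign[of t x0] x0 by (auto simp: t_def)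
    then show False using U(1) by (auto simp: t_def not_less[symmetric])
  qed
qed

text \<open>A facet misses the interior point 0, so it cannot contain all points of
  \<open>X1\<close>, whose weighted mean is 0. Its vertices therefore lie among the points that
  remain after deleting one point of \<open>X1\<close>, and these are affinely independent.\<close>

lemma facet_simplex:
  assumes "S facet_of P"
  shows "\<exists>n. n simplex S"
proof -
  have face: "S face_of P" and dim: "aff_dim S = aff_dim P - 1"
    using assms by (auto simp: facet_of_def)
  then have "S \<noteq> P" by auto
  then have "S \<inter> interior P = {}" using face by (intro face_of_disjoint_interior)
  then have notin: "0 \<notin> S" using zero_in_interior by blast
  obtain T where T: "T \<subseteq> u ` X" "S = convex hull T"
    using face_of_convex_hull_subset[OF _ face] finite_X by (auto simp: finite_imp_compact)
  have "\<exists>x0\<in>X1. u x0 \<notin> T"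
  proof (rule ccontr)
    assume "\<not> (\<exists>x0\<in>X1. u x0 \<notin> T)"
    then have sub: "u ` X1 \<subseteq> T" by blast
    have "X1 \<noteq> {}" using card1 by auto
    then have s: "(\<Sum>x\<in>X1. c x) > 0" using c_pos fin1 by (intro sum_pos) auto
    have "(\<Sum>x\<in>X1. (c x / (\<Sum>x\<in>X1. c x)) *\<^sub>R u x) \<in> convex hull T"
    proof (rule convex_sum)
      show "(\<Sum>x\<in>X1. c x / (\<Sum>x\<in>X1. c x)) = 1" using s by (simp add: sum_divide_distrib[symmetric])
      show "0 \<le> c x / (\<Sum>x\<in>X1. c x)" if "x \<in> X1" for x using s c_pos[of x] that by simp
      show "u x \<in> convex hull T" if "x \<in> X1" for x using sub that by (intro hull_inc) blast
    qed (auto simp: fin1)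
    moreover have "(\<Sum>x\<in>X1. (c x / (\<Sum>x\<in>X1. c x)) *\<^sub>R u x) = (1 / (\<Sum>x\<in>X1. c x)) *\<^sub>R (\<Sum>x\<in>X1. c x *\<^sub>R u x)"
      by (simp add: scaleR_sum_right)
    ultimately show False using notin rel1 by (simp add: T(2))
  qed
  then obtain x0 where x0: "x0 \<in> X1" "u x0 \<notin> T" by blast
  have "T \<subseteq> u ` (X - {x0})" using T(1) x0 by blast
  then have "\<not> affine_dependent T"
    using affine_independent_Diff1[OF x0(1)] affine_dependent_subset by blast
  then show ?thesis
    unfolding simplex_def T(2) by (intro exI[of _ "int (card T) - 1"] exI[of _ T]) simp
qed

end

section \<open>The data of type \<open>\<A>\<A>\<close>-tilde\<close>

context type_A
begin

definition D :: "(nat \<Rightarrow> int) set" where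
  "D = {f. restr d f = f \<and> alpha_comb d f \<in> B \<and> theta f = 0}"

lemma D_zero: "0 \<in> D"
proof -
  have "restr d 0 = 0" by (rule restr_id) simp
  then show ?thesis unfolding D_def using B(1) by (simp only: mem_Collect_eq alpha_comb_0 theta_0 simp_thms)
qed

lemma theta_uminus_period:
  assumes "alpha_comb d f \<in> B"
  shows "theta (- f) = - theta f"
proof -
  have "theta (f + - f) = theta f + theta (- f)" by (rule theta_add_period[OF assms])
  then show ?thesis unfolding add.right_inverse theta_0 by linarith
qed

lemma D_diff:
  assumes "f \<in> D" "g \<in> D"
  shows "f - g \<in> D"
proof -
  have fg: "restr d f = f" "restr d g = g" "alpha_comb d f \<in> B" "alpha_comb d g \<in> B" "theta f = 0" "theta g = 0"
    using assms unfolding D_def by blast+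
  have "restr d (f - g) = restr d f - restr d g" by (auto simp: restr_def fun_eq_iff)
  then have 1: "restr d (f - g) = f - g" by (simp only: fg)
  have "alpha_comb d f + - alpha_comb d g \<in> B" using fg B by blast
  then have 2: "alpha_comb d (f - g) \<in> B" by (simp only: alpha_comb_diff add_uminus_conv_diff)
  have "theta (f + - g) = theta f + theta (- g)" by (rule theta_add_period[OF fg(3)])
  then have "theta (f - g) = 0"
    by (simp only: theta_uminus_period[OF fg(4)] fg add_uminus_conv_diff diff_self)
  then show ?thesis using 1 2 unfolding D_def by blast
qed

lemma D_mu:
  assumes "f \<in> D"
  shows "(\<Sum>i\<le>d. mu i * f i) = 0"
proof -
  have "alpha_comb d f \<in> B" "theta f = 0" using assms unfolding D_def by blast+
  then show ?thesis using theta_in_B[of f] by simp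
qed

text \<open>As \<open>mu 0 > 0\<close>, the equation in \<open>D_mu\<close> recovers coordinate 0
  from the others. So \<open>d\<close> coordinates determine an element of \<open>D\<close>, the
  number that the construction of the vertices requires.\<close>

lemma D_eq_0:
  assumes "f \<in> D" "\<And>i. 1 \<le> i \<Longrightarrow> i \<le> d \<Longrightarrow> f i = 0"
  shows "f = 0"
proof -
  have "(\<Sum>i\<le>d. mu i * f i) = (\<Sum>i\<in>{0}. mu i * f i)"
    by (rule sum.mono_neutral_right) (use assms(2) in \<open>auto simp: Suc_le_eq\<close>)
  then have "f 0 = 0" using D_mu[OF assms(1)] mu_pos[of 0] by simp
  have f: "restr d f = f" using assms(1) unfolding D_def by blast
  have gt: "f i = 0" if "i > d" for i
    using fun_cong[OF f, of i] that by (simp add: restr_def)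
  show ?thesis
  proof
    fix i
    have "i = 0 \<or> (1 \<le> i \<and> i \<le> d) \<or> i > d" by linarith
    then show "f i = 0 i" using assms(2)[of i] gt[of i] \<open>f 0 = 0\<close> by auto
  qed
qed

text \<open>A vector orthogonal to all of these is proportional to \<open>mu\<close>. As they lie in
  \<open>D\<close>, this gives the uniqueness of the linear relations among the vertices.\<close>

definition test_vec :: "nat \<Rightarrow> nat \<Rightarrow> int" where
  "test_vec i = zmul (int period) (zmul (mu 0) (unit_vec i) - zmul (mu i) (unit_vec 0))"

lemma test_vec_in_D:
  assumes "i \<le> d"
  shows "test_vec i \<in> D"
proof -
  let ?g = "zmul (mu 0) (unit_vec i) - zmul (mu i) (unit_vec 0)"
  have "restr d (test_vec i) = test_vec i"
    using assms by (auto simp: restr_def test_vec_def unit_vec_def fun_eq_iff)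
  moreover have "alpha_comb d (test_vec i) \<in> B"
    unfolding test_vec_def by (rule period(2))
  moreover have "theta (test_vec i) = 0"
  proof -
    have "theta (test_vec i) = (\<Sum>j\<le>d. mu j * ?g j)"
      unfolding test_vec_def by (rule theta_period)
    also have "\<dots> = (\<Sum>j\<le>d. (if j = i then mu i * mu 0 else 0) - (if j = 0 then mu 0 * mu i else 0))"
      by (intro sum.cong refl) (auto simp: unit_vec_def)
    also have "\<dots> = 0" using assms by (simp add: sum_subtractf)
    finally show ?thesis .
  qed
  ultimately show ?thesis unfolding D_def by blast
qed

lemma theta_mono:
  assumes "\<And>i. g i \<ge> 0"
  shows "theta f \<le> theta (f + g)"
proof -
  have nn: "restr d g i \<ge> 0" for i using assms by (simp add: restr_def)
  obtain p where p: "set p \<subseteq> {..d}" "cnt p = restr d g"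
    using cnt_list_exists[of "restr d g" d] nn by (metis restr_restr)
  have "theta (f + g) = theta (restr d (f + g))" by (rule theta_restr[symmetric])
  also have "\<dots> = theta (restr d (f + cnt p))" by (simp only: restr_add p restr_restr)
  also have "\<dots> = theta (f + cnt p)" by (rule theta_restr)
  finally show ?thesis using theta_eps[OF p(1), of f] by linarith
qed

end

section \<open>Lattices of integer vectors as images of Hom(N, Z)\<close>

lemma additive_expansion:
  fixes w :: "int ^ 'n::finite" and m :: "int ^ 'n \<Rightarrow> int"
  assumes "Modules.additive m"
  shows "m w = (\<Sum>i\<in>UNIV. m (axis i 1) * w $ i)"
proof -
  interpret m: additive m by fact
  have axis: "m (axis i n) = m (axis i 1) * n" for i n
  proof -
    interpret a: additive "\<lambda>n. m (axis i n)"
    proof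
      fix p q :: int
      have "axis i (p + q) = axis i p + axis i q" by (simp add: axis_def vec_eq_iff)
      then show "m (axis i (p + q)) = m (axis i p) + m (axis i q)" by (simp add: m.add)
    qed
    have nat: "m (axis i (int k)) = m (axis i 1) * int k" for k
      by (induction k) (simp_all add: a.zero a.add distrib_left)
    show ?thesis
    proof (cases "n \<ge> 0")
      case True
      then show ?thesis using nat[of "nat n"] by simp
    next
      case False
      then show ?thesis using nat[of "nat (- n)"] a.minus[of n] by simp
    qed
  qed
  have "w = (\<Sum>i\<in>UNIV. axis i (w $ i))" by (simp add: vec_eq_iff axis_def)
  then have "m w = m (\<Sum>i\<in>UNIV. axis i (w $ i))" by simp
  also have "\<dots> = (\<Sum>i\<in>UNIV. m (axis i (w $ i)))" by (rule m.sum)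
  also have "\<dots> = (\<Sum>i\<in>UNIV. m (axis i 1) * w $ i)" by (rule sum.cong[OF refl axis])
  finally show ?thesis .
qed

text \<open>Generators of \<open>D\<close> are the rows of a matrix with columns \<open>w x\<close>.
  An additive map on \<open>\<int>\<^sup>n\<close> is a row of coefficients, so applying all such
  maps to the columns yields exactly the combinations of the rows.\<close>

lemma ex_basis:
  fixes D :: "('x \<Rightarrow> int) set" and c :: "nat \<Rightarrow> 'x"
  assumes "0 \<in> D" "\<And>f g. f \<in> D \<Longrightarrow> g \<in> D \<Longrightarrow> f - g \<in> D"
    and "\<And>f. f \<in> D \<Longrightarrow> (\<And>k. k < CARD('n::finite) \<Longrightarrow> f (c k) = 0) \<Longrightarrow> f = 0"
  obtains w :: "'x \<Rightarrow> int ^ 'n" where "D = {\<lambda>x. m (w x) | m. Modules.additive m}"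
proof -
  obtain b where b: "\<And>k. k < CARD('n) \<Longrightarrow> b k \<in> D"
    "\<And>f. f \<in> D \<Longrightarrow> \<exists>m. f = (\<lambda>x. \<Sum>k<CARD('n). m k * b k x)"
    using sublattice_generators[of D "CARD('n)" c, OF assms] by blast
  obtain h :: "'n \<Rightarrow> nat" where h: "bij_betw h UNIV {..<CARD('n)}"
    using finite_same_card_bij[of "UNIV :: 'n set" "{..<CARD('n)}"] by auto
  define w :: "'x \<Rightarrow> int ^ 'n" where "w x = (\<chi> i. b (h i) x)" for x
  have neg: "- f \<in> D" if "f \<in> D" for f
    using assms(2)[OF assms(1) that] by (simp only: diff_0)
  have add: "f + g \<in> D" if "f \<in> D" "g \<in> D" for f g
    using assms(2)[OF that(1) neg[OF that(2)]] by (simp only: diff_minus_eq_add)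
  have mult: "zmul (int n) f \<in> D" if "f \<in> D" for n f
  proof (induction n)
    case 0
    show ?case by (simp only: of_nat_0 zmul_0 assms(1))
  next
    case (Suc n)
    have "zmul (int (Suc n)) f = zmul (int n) f + f" by (simp add: zmul_def fun_eq_iff distrib_right)
    then show ?case using add[OF Suc that] by (simp only:)
  qed
  have mult': "zmul n f \<in> D" if "f \<in> D" for n f
  proof (cases "n \<ge> 0")
    case True
    then show ?thesis using mult[OF that, of "nat n"] by simp
  next
    case False
    then have "zmul n f = - zmul (int (nat (- n))) f" by (auto simp: fun_eq_iff)
    then show ?thesis using neg[OF mult[OF that]] by (simp only:)
  qed
  have "D = {\<lambda>x. m (w x) | m. Modules.additive m}"
  proof (rule equalityI; rule subsetI)
    fix f assume "f \<in> D"
    then obtain m where m: "f = (\<lambda>x. \<Sum>k<CARD('n). m k * b k x)" using b(2) by blast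
    let ?m = "\<lambda>v :: int ^ 'n. \<Sum>i\<in>UNIV. m (h i) * v $ i"
    have add_m: "Modules.additive ?m"
      by (rule additive.intro) (simp add: distrib_left sum.distrib)
    have "f = (\<lambda>x. ?m (w x))"
      unfolding m w_def using sum.reindex_bij_betw[OF h, of "\<lambda>k. m k * b k _"] by simp
    then show "f \<in> {\<lambda>x. m (w x) | m. Modules.additive m}"
      using add_m unfolding mem_Collect_eq by (intro exI[of _ ?m] conjI)
  next
    fix f :: "'x \<Rightarrow> int" assume "f \<in> {\<lambda>x. m (w x) | m. Modules.additive m}"
    then obtain m :: "int ^ 'n \<Rightarrow> int" where m: "Modules.additive m" "f = (\<lambda>x. m (w x))" by blast
    have sum: "(\<lambda>x. \<Sum>i\<in>A. a i * b (h i) x) \<in> D" if "finite A" for A and a :: "'n \<Rightarrow> int"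
      using that
    proof (induction A)
      case empty
      then show ?case using assms(1) by (simp add: zero_fun_def)
    next
      case (insert i A)
      have "b (h i) \<in> D" using h by (intro b(1)) (auto simp: bij_betw_def)
      then have "zmul (a i) (b (h i)) + (\<lambda>x. \<Sum>i\<in>A. a i * b (h i) x) \<in> D"
        by (intro add mult' insert.IH)
      moreover have "(\<lambda>x. \<Sum>i\<in>insert i A. a i * b (h i) x) = zmul (a i) (b (h i)) + (\<lambda>x. \<Sum>i\<in>A. a i * b (h i) x)"
        using insert.hyps by (auto simp: fun_eq_iff)
      ultimately show ?case by (simp only:)
    qed
    have lin: "m (\<chi> i. g i) = (\<Sum>i\<in>UNIV. m (axis i 1) * g i)" for g :: "'n \<Rightarrow> int"
      using additive_expansion[OF m(1), of "\<chi> i. g i"] by simp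
    show "f \<in> D" unfolding m(2) w_def lin by (rule sum) simp
  qed
  then show thesis by (rule that)
qed

text \<open>The assumption \<open>basis\<close> prescribes the image of \<open>A_P\<close>: the
  values of additive maps at the future vertices are the elements of the sum of both lattices
  \<open>D\<close>. Indexing by a sum type treats both families of vertices as one.\<close>

locale AA_datum = A1: type_A d1 B1 C1 + A2: type_A d2 B2 C2
  for d1 B1 C1 d2 B2 C2 +
  fixes vv :: "nat + nat \<Rightarrow> int ^ 'n::finite"
  assumes card_n: "CARD('n) = d1 + d2"
    and basis: "{f. f \<circ> Inl \<in> A1.D \<and> f \<circ> Inr \<in> A2.D} = {\<lambda>x. m (vv x) | m. Modules.additive m}"
begin

abbreviation X :: "(nat + nat) set" where "X \<equiv> {..d1} <+> {..d2}"
abbreviation u where "u x \<equiv> lat (vv x)"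
abbreviation P where "P \<equiv> convex hull (u ` X)"
abbreviation v where "v i \<equiv> vv (Inl i)"
abbreviation v' where "v' i \<equiv> vv (Inr i)"

lemma additive_in_D:
  "Modules.additive m \<Longrightarrow> (\<lambda>i. m (v i)) \<in> A1.D \<and> (\<lambda>i. m (v' i)) \<in> A2.D"
proof -
  assume "Modules.additive m"
  then have "(\<lambda>x. m (vv x)) \<in> {f. f \<circ> Inl \<in> A1.D \<and> f \<circ> Inr \<in> A2.D}" unfolding basis by blast
  then show ?thesis by (simp add: comp_def)
qed

lemma D_additive:
  assumes "f \<in> A1.D" "g \<in> A2.D"
  obtains m where "Modules.additive m" "\<And>i. m (v i) = f i" "\<And>i. m (v' i) = g i"
proof -
  have "case_sum f g \<in> {f. f \<circ> Inl \<in> A1.D \<and> f \<circ> Inr \<in> A2.D}"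
    using assms by (simp add: comp_def)
  then obtain m :: "int ^ 'n \<Rightarrow> int" where m: "Modules.additive m" "case_sum f g = (\<lambda>x. m (vv x))"
    unfolding basis by blast
  show thesis
    using that[of m] m(1) fun_cong[OF m(2), of "Inl _"] fun_cong[OF m(2), of "Inr _"] by simp
qed

lemma additive_component: "Modules.additive (\<lambda>w :: int ^ 'n. w $ k)"
  by (rule additive.intro) simp

lemma real_relation:
  assumes "(\<Sum>x\<in>X. t x *\<^sub>R u x) = 0" "Modules.additive m"
  shows "(\<Sum>x\<in>X. t x * real_of_int (m (vv x))) = 0"
proof -
  have comp: "(\<Sum>x\<in>X. t x * real_of_int (vv x $ i)) = 0" for i
  proof -
    have "(\<Sum>x\<in>X. t x *\<^sub>R u x) $ i = 0" using assms(1) by simp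
    then show ?thesis by (simp add: lat_def)
  qed
  have "(\<Sum>x\<in>X. t x * real_of_int (m (vv x)))
      = (\<Sum>i\<in>UNIV. real_of_int (m (axis i 1)) * (\<Sum>x\<in>X. t x * real_of_int (vv x $ i)))"
    unfolding additive_expansion[OF assms(2), of "vv _"]
    by (simp add: sum_distrib_left, subst sum.swap, simp add: ac_simps)
  then show ?thesis by (simp add: comp)
qed

lemma sum_X: "(\<Sum>x\<in>X. f x) = (\<Sum>i\<le>d1. f (Inl i)) + (\<Sum>i\<le>d2. f (Inr i))"
  by (simp add: sum.Plus)

sublocale P: two_simplices "Inl ` {..d1}" "Inr ` {..d2}"
  "case_sum (\<lambda>i. real_of_int (A1.mu i)) (\<lambda>i. real_of_int (A2.mu i))" "\<lambda>x. lat (vv x)"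
proof
  show "finite (Inl ` {..d1} :: (nat + nat) set)" "finite (Inr ` {..d2} :: (nat + nat) set)"
    "Inl ` {..d1} \<inter> Inr ` {..d2} = ({} :: (nat + nat) set)"
    by auto
  show "card (Inl ` {..d1} :: (nat + nat) set) \<ge> 2" "card (Inr ` {..d2} :: (nat + nat) set) \<ge> 2"
    using A1.d A2.d by (simp_all add: card_image)
  show "card (Inl ` {..d1} :: (nat + nat) set) + card (Inr ` {..d2} :: (nat + nat) set) = DIM(real ^ 'n) + 2"
    by (simp add: card_image card_n)
  show "case_sum (\<lambda>i. real_of_int (A1.mu i)) (\<lambda>i. real_of_int (A2.mu i)) x > 0"
    if "x \<in> Inl ` {..d1} \<union> Inr ` {..d2}" for x
    using that A1.mu_pos A2.mu_pos by auto
  show "(\<Sum>x\<in>Inl ` {..d1}. case_sum (\<lambda>i. real_of_int (A1.mu i)) (\<lambda>i. real_of_int (A2.mu i)) x *\<^sub>R u x) = 0"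
  proof -
    have "(\<Sum>i\<le>d1. A1.mu i * v i $ k) = 0" for k
      by (rule A1.D_mu) (use additive_in_D[OF additive_component] in blast)
    then have "real_of_int (\<Sum>i\<le>d1. A1.mu i * v i $ k) = 0" for k
      by (simp only: of_int_0)
    then have "(\<Sum>i\<le>d1. real_of_int (A1.mu i) * real_of_int (v i $ k)) = 0" for k
      by (simp only: of_int_sum of_int_mult)
    then show ?thesis by (simp add: sum.reindex vec_eq_iff lat_def)
  qed
  show "(\<Sum>x\<in>Inr ` {..d2}. case_sum (\<lambda>i. real_of_int (A1.mu i)) (\<lambda>i. real_of_int (A2.mu i)) x *\<^sub>R u x) = 0"
  proof -
    have "(\<Sum>i\<le>d2. A2.mu i * v' i $ k) = 0" for k
      by (rule A2.D_mu) (use additive_in_D[OF additive_component] in blast)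
    then have "real_of_int (\<Sum>i\<le>d2. A2.mu i * v' i $ k) = 0" for k
      by (simp only: of_int_0)
    then have "(\<Sum>i\<le>d2. real_of_int (A2.mu i) * real_of_int (v' i $ k)) = 0" for k
      by (simp only: of_int_sum of_int_mult)
    then show ?thesis by (simp add: sum.reindex vec_eq_iff lat_def)
  qed
  fix t assume "(\<Sum>x\<in>Inl ` {..d1} \<union> Inr ` {..d2}. t x *\<^sub>R u x) = 0"
  then have t: "(\<Sum>x\<in>X. t x *\<^sub>R u x) = 0" by (simp only: Plus_def)
  \<comment> \<open>A real relation among the vertices is annihilated by every additive map, hence
    its coefficients are orthogonal to both lattices \<open>D\<close>.\<close>
  have rel: "(\<Sum>i\<le>d1. t (Inl i) * real_of_int (f i)) + (\<Sum>i\<le>d2. t (Inr i) * real_of_int (g i)) = 0"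
    if fg: "f \<in> A1.D" "g \<in> A2.D" for f g
  proof -
    obtain m where m: "Modules.additive m" "\<And>i. m (v i) = f i" "\<And>i. m (v' i) = g i"
      using D_additive[OF fg] by blast
    show ?thesis using real_relation[OF t m(1)] by (simp add: sum_X m)
  qed
  \<comment> \<open>Orthogonality to \<open>test_vec i\<close> compares the coefficient at
    \<open>i\<close> with the one at 0.\<close>
  have e1: "t (Inl i) = (t (Inl 0) / A1.mu 0) * A1.mu i" if i: "i \<le> d1" for i
  proof -
    have "(\<Sum>j\<le>d1. t (Inl j) * real_of_int (A1.test_vec i j))
        = (\<Sum>j\<le>d1. A1.period * ((if j = i then t (Inl i) * A1.mu 0 else 0) - (if j = 0 then t (Inl 0) * A1.mu i else 0)))"
      by (rule sum.cong) (auto simp: A1.test_vec_def unit_vec_def algebra_simps)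
    also have "\<dots> = A1.period * (t (Inl i) * A1.mu 0 - t (Inl 0) * A1.mu i)"
      using i by (simp add: sum_distrib_left[symmetric] sum_subtractf)
    finally have "A1.period * (t (Inl i) * A1.mu 0 - t (Inl 0) * A1.mu i) = 0"
      using rel[OF A1.test_vec_in_D[OF i] A2.D_zero] by simp
    then show ?thesis using A1.period(1) A1.mu_pos[of 0] by (simp add: field_simps)
  qed
  have e2: "t (Inr i) = (t (Inr 0) / A2.mu 0) * A2.mu i" if i: "i \<le> d2" for i
  proof -
    have "(\<Sum>j\<le>d2. t (Inr j) * real_of_int (A2.test_vec i j))
        = (\<Sum>j\<le>d2. A2.period * ((if j = i then t (Inr i) * A2.mu 0 else 0) - (if j = 0 then t (Inr 0) * A2.mu i else 0)))"
      by (rule sum.cong) (auto simp: A2.test_vec_def unit_vec_def algebra_simps)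
    also have "\<dots> = A2.period * (t (Inr i) * A2.mu 0 - t (Inr 0) * A2.mu i)"
      using i by (simp add: sum_distrib_left[symmetric] sum_subtractf)
    finally have "A2.period * (t (Inr i) * A2.mu 0 - t (Inr 0) * A2.mu i) = 0"
      using rel[OF A1.D_zero A2.test_vec_in_D[OF i]] by simp
    then show ?thesis using A2.period(1) A2.mu_pos[of 0] by (simp add: field_simps)
  qed
  show "\<exists>a b. (\<forall>x\<in>Inl ` {..d1}. t x = a * case_sum (\<lambda>i. real_of_int (A1.mu i)) (\<lambda>i. real_of_int (A2.mu i)) x)
      \<and> (\<forall>x\<in>Inr ` {..d2}. t x = b * case_sum (\<lambda>i. real_of_int (A1.mu i)) (\<lambda>i. real_of_int (A2.mu i)) x)"
  proof (rule exI[of _ "t (Inl 0) / A1.mu 0"], rule exI[of _ "t (Inr 0) / A2.mu 0"],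
      intro conjI ballI; elim imageE)
    fix x :: "nat + nat" and i assume i: "x = Inl i" "i \<in> {..d1}"
    show "t x = t (Inl 0) / A1.mu 0 * case_sum (\<lambda>i. real_of_int (A1.mu i)) (\<lambda>i. real_of_int (A2.mu i)) x"
      unfolding i sum.case using i(2) by (intro e1) simp
  next
    fix x :: "nat + nat" and i assume i: "x = Inr i" "i \<in> {..d2}"
    show "t x = t (Inr 0) / A2.mu 0 * case_sum (\<lambda>i. real_of_int (A1.mu i)) (\<lambda>i. real_of_int (A2.mu i)) x"
      unfolding i sum.case using i(2) by (intro e2) simp
  qed
qed

lemma inj_vv: "inj_on vv X"
proof -
  have "inj_on (lat \<circ> vv) X" using P.inj_u unfolding Plus_def comp_def .
  then show ?thesis by (rule inj_on_imageI2)
qed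

lemma lat_inj: "lat x = lat y \<longleftrightarrow> x = y"
  by (auto simp: lat_def vec_eq_iff)

text \<open>\<open>L\<close> and \<open>R\<close> read off the coefficients at the
  \<open>v i\<close> and at the \<open>v' j\<close>, and \<open>el\<close> is their inverse. This
  identifies \<open>F\<close> with the sum of the two lattices of coefficient vectors.\<close>

definition coord :: "(int ^ 'n \<Rightarrow>\<^sub>0 int) \<Rightarrow> nat + nat \<Rightarrow> int" where
  "coord f = (\<lambda>x. if x \<in> X then Poly_Mapping.lookup f (vv x) else 0)"
definition L :: "(int ^ 'n \<Rightarrow>\<^sub>0 int) \<Rightarrow> nat \<Rightarrow> int" where "L f = (\<lambda>i. coord f (Inl i))"
definition R :: "(int ^ 'n \<Rightarrow>\<^sub>0 int) \<Rightarrow> nat \<Rightarrow> int" where "R f = (\<lambda>i. coord f (Inr i))"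
definition phi :: "(int ^ 'n \<Rightarrow>\<^sub>0 int) \<Rightarrow> int" where "phi f = A1.theta (L f) - A2.theta (R f)"
definition FF :: "(int ^ 'n \<Rightarrow>\<^sub>0 int) set" where "FF = {f. Poly_Mapping.keys f \<subseteq> vv ` X}"
text \<open>\<open>deg\<close> takes the polytope as an explicit argument here, because
  \<open>I\<close> is itself a parameter of the interpretation \<open>AA\<close> that
  follows.\<close>

definition I :: "(int ^ 'n \<Rightarrow>\<^sub>0 int) set set" where
  "I = AA_construction.deg (convex hull ((\<lambda>x. lat (vv x)) ` X)) ` {f \<in> FF. phi f \<ge> 0}"
definition el :: "(nat \<Rightarrow> int) \<Rightarrow> (nat \<Rightarrow> int) \<Rightarrow> int ^ 'n \<Rightarrow>\<^sub>0 int" where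
  "el a b = (\<Sum>i\<le>d1. frag_cmul (a i) (frag_of (v i))) + (\<Sum>i\<le>d2. frag_cmul (b i) (frag_of (v' i)))"

sublocale AA: AA_construction "convex hull ((\<lambda>x. lat (vv x)) ` X)" d1 d2 "\<lambda>i. vv (Inl i)" "\<lambda>i. vv (Inr i)" I .

lemma V_eq: "AA.V = vv ` X"
proof -
  have eq: "lat w extreme_point_of P \<longleftrightarrow> lat w \<in> u ` X" for w :: "int ^ 'n"
    using P.extreme_points unfolding Plus_def by blast
  show ?thesis unfolding AA.V_def eq image_iff lat_inj by blast
qed

lemma carrier_F: "carrier AA.F = FF" by (simp add: FF_def free_Abelian_group_def V_eq)

lemma mem_X: "Inl i \<in> X \<longleftrightarrow> i \<le> d1" "Inr j \<in> X \<longleftrightarrow> j \<le> d2"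
  by auto

lemma lookup_vv: "x \<in> X \<Longrightarrow> y \<in> X \<Longrightarrow> Poly_Mapping.lookup (frag_of (vv x)) (vv y) = (if y = x then 1 else 0)"
  using inj_on_eq_iff[OF inj_vv, of y x] by simp

lemma L_add: "L (f + g) = L f + L g" and R_add: "R (f + g) = R f + R g"
  by (rule ext, simp add: L_def R_def coord_def lookup_add)+
lemma L_diff: "L (f - g) = L f - L g" and R_diff: "R (f - g) = R f - R g"
  by (rule ext, simp add: L_def R_def coord_def lookup_minus)+
lemma L_0: "L 0 = 0" and R_0: "R 0 = 0"
  by (rule ext, simp add: L_def R_def coord_def )+
lemma L_cmul: "L (frag_cmul c f) = zmul c (L f)" and R_cmul: "R (frag_cmul c f) = zmul c (R f)"
  by (rule ext, simp add: L_def R_def coord_def )+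
lemma L_v: "i \<le> d1 \<Longrightarrow> L (frag_of (v i)) = unit_vec i" and R_v: "i \<le> d1 \<Longrightarrow> R (frag_of (v i)) = 0"
  by (rule ext; auto simp: L_def R_def coord_def unit_vec_def lookup_vv mem_X simp del: lookup_frag_of)+
lemma L_v': "i \<le> d2 \<Longrightarrow> L (frag_of (v' i)) = 0" and R_v': "i \<le> d2 \<Longrightarrow> R (frag_of (v' i)) = unit_vec i"
  by (rule ext; auto simp: L_def R_def coord_def unit_vec_def lookup_vv mem_X simp del: lookup_frag_of)+
lemma restr_L: "restr d1 (L f) = L f" and restr_R: "restr d2 (R f) = R f"
  by (rule ext, simp add: restr_def L_def R_def coord_def mem_X)+

lemma F_eqI:
  assumes "f \<in> FF" "g \<in> FF" "L f = L g" "R f = R g"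
  shows "f = g"
proof (rule poly_mapping_eqI)
  fix w
  have c: "coord f x = coord g x" for x
    using fun_cong[OF assms(3)] fun_cong[OF assms(4)] by (cases x) (auto simp: L_def R_def)
  show "Poly_Mapping.lookup f w = Poly_Mapping.lookup g w"
  proof (cases "w \<in> vv ` X")
    case True
    then obtain x where x: "x \<in> X" "w = vv x" by blast
    then show ?thesis using c[of x] unfolding coord_def by (simp only: if_True)
  next
    case False
    then have "w \<notin> Poly_Mapping.keys f" "w \<notin> Poly_Mapping.keys g" using assms by (auto simp: FF_def)
    then show ?thesis by (simp add: in_keys_iff)
  qed
qed

lemma FF_closed: "0 \<in> FF" "f \<in> FF \<Longrightarrow> g \<in> FF \<Longrightarrow> f + g \<in> FF" "f \<in> FF \<Longrightarrow> g \<in> FF \<Longrightarrow> f - g \<in> FF"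
  "f \<in> FF \<Longrightarrow> - f \<in> FF" "f \<in> FF \<Longrightarrow> frag_cmul c f \<in> FF" "x \<in> X \<Longrightarrow> frag_of (vv x) \<in> FF"
  unfolding FF_def using keys_add[of f g] keys_diff[of f g] keys_cmul[of c f] by auto

lemma FF_sum: "(\<And>x. x \<in> A \<Longrightarrow> f x \<in> FF) \<Longrightarrow> sum f A \<in> FF"
  by (induction A rule: infinite_finite_induct) (auto intro: FF_closed)

lemma L_sum: "L (sum f A) = (\<Sum>x\<in>A. L (f x))" and R_sum: "R (sum f A) = (\<Sum>x\<in>A. R (f x))"
  by (induction A rule: infinite_finite_induct) (simp_all only: sum.infinite sum.empty sum.insert L_0 L_add R_0 R_add simp_thms)

lemma sum_fun: "(\<Sum>x\<in>A. f x) i = (\<Sum>x\<in>A. f x i)" for f :: "'y \<Rightarrow> 'z \<Rightarrow> int"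
  by (induction A rule: infinite_finite_induct) auto

lemma sum_unit_vec: "(\<Sum>i\<le>d. zmul (a i) (unit_vec i)) = restr d a"
  by (rule ext) (auto simp: sum_fun unit_vec_def restr_def if_distrib cong: if_cong)

lemma L_el: "L (el a b) = restr d1 a" and R_el: "R (el a b) = restr d2 b"
proof -
  have 1: "(\<Sum>i\<le>d1. L (frag_cmul (a i) (frag_of (v i)))) = restr d1 a"
    "(\<Sum>i\<le>d1. R (frag_cmul (a i) (frag_of (v i)))) = (\<Sum>i\<le>d1. 0)"
    unfolding sum_unit_vec[symmetric] by (intro sum.cong refl; simp only: L_cmul R_cmul L_v R_v atMost_iff zmul_zero)+
  have 2: "(\<Sum>i\<le>d2. R (frag_cmul (b i) (frag_of (v' i)))) = restr d2 b"
    "(\<Sum>i\<le>d2. L (frag_cmul (b i) (frag_of (v' i)))) = (\<Sum>i\<le>d2. 0)"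
    unfolding sum_unit_vec[symmetric] by (intro sum.cong refl; simp only: L_cmul R_cmul L_v' R_v' atMost_iff zmul_zero)+
  show "L (el a b) = restr d1 a" "R (el a b) = restr d2 b"
    by (simp_all only: el_def L_add R_add L_sum R_sum 1 2 sum.neutral_const add_0_left add_0_right)
qed

lemma el_in_FF: "el a b \<in> FF"
  unfolding el_def by (intro FF_closed FF_sum) auto

end

section \<open>The group H, the upper set and the labelling of the vertices\<close>

context AA_datum
begin

text \<open>This is \<open>A_P(M)\<close>, by \<open>A_P_image\<close>; adding the multiples of
  \<open>pv\<close> gives \<open>K\<close>.\<close>

definition KD :: "(int ^ 'n \<Rightarrow>\<^sub>0 int) set" where
  "KD = {f \<in> FF. L f \<in> A1.D \<and> R f \<in> A2.D}"

abbreviation pv where "pv \<equiv> el (one_vec d1) (one_vec d2)"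
abbreviation sg where "sg \<equiv> el (one_vec d1) 0"

lemma sum_V: "(\<Sum>w\<in>AA.V. f w) = (\<Sum>i\<le>d1. f (v i)) + (\<Sum>i\<le>d2. f (v' i))"
  for f :: "_ \<Rightarrow> 'z::comm_monoid_add"
proof -
  have "(\<Sum>w\<in>AA.V. f w) = (\<Sum>x\<in>X. f (vv x))"
    unfolding V_eq using inj_vv by (rule sum.reindex_cong) (rule refl)+
  then show ?thesis by (simp add: sum.Plus)
qed

lemma pvec_eq: "AA.pvec = pv"
  unfolding AA.pvec_def sum_V el_def by (simp add: one_vec_def)

lemma A_P_eq: "AA.A_P m = el (\<lambda>i. m (v i)) (\<lambda>i. m (v' i))"
  unfolding AA.A_P_def sum_V el_def ..

lemma el_LR: "f \<in> FF \<Longrightarrow> el (L f) (R f) = f"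
  by (rule F_eqI) (simp_all only: el_in_FF L_el R_el restr_L restr_R)

lemma D1_restr: "f \<in> A1.D \<Longrightarrow> restr d1 f = f" and D2_restr: "f \<in> A2.D \<Longrightarrow> restr d2 f = f"
  by (simp_all only: A1.D_def A2.D_def mem_Collect_eq)

lemma A_P_image: "{AA.A_P m | m. m \<in> AA.M} = KD"
proof (rule equalityI; rule subsetI)
  fix f assume "f \<in> {AA.A_P m | m. m \<in> AA.M}"
  then obtain m where m: "Modules.additive m" "f = AA.A_P m" unfolding AA.M_def by blast
  have D: "(\<lambda>i. m (v i)) \<in> A1.D" "(\<lambda>i. m (v' i)) \<in> A2.D" using additive_in_D[OF m(1)] by blast+
  show "f \<in> KD"
    unfolding KD_def m(2) A_P_eq mem_Collect_eq L_el R_el D1_restr[OF D(1)] D2_restr[OF D(2)]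
    using D el_in_FF by blast
next
  fix f assume "f \<in> KD"
  then have f: "f \<in> FF" "L f \<in> A1.D" "R f \<in> A2.D" unfolding KD_def by blast+
  obtain m where m: "Modules.additive m" "\<And>i. m (v i) = L f i" "\<And>i. m (v' i) = R f i"
    using D_additive[OF f(2,3)] by blast
  have "AA.A_P m = el (L f) (R f)" unfolding A_P_eq m(2,3) ..
  then have "AA.A_P m = f" using el_LR[OF f(1)] by (simp only:)
  then show "f \<in> {AA.A_P m | m. m \<in> AA.M}" using m(1) unfolding AA.M_def by blast
qed

lemma K_iff: "f \<in> AA.K \<longleftrightarrow> (\<exists>k c. k \<in> KD \<and> f = k + frag_cmul c pv)"
  unfolding AA.K_def A_P_image[symmetric] pvec_eq by blast

lemma KD_closed: "0 \<in> KD" "f \<in> KD \<Longrightarrow> g \<in> KD \<Longrightarrow> f - g \<in> KD" "KD \<subseteq> FF"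
proof -
  show "0 \<in> KD" unfolding KD_def mem_Collect_eq L_0 R_0 using FF_closed(1) A1.D_zero A2.D_zero by blast
  show "KD \<subseteq> FF" unfolding KD_def by blast
  assume "f \<in> KD" "g \<in> KD"
  then show "f - g \<in> KD"
    unfolding KD_def mem_Collect_eq L_diff R_diff using FF_closed(3) A1.D_diff A2.D_diff by blast
qed

lemma K_closed: "0 \<in> AA.K" "f \<in> AA.K \<Longrightarrow> g \<in> AA.K \<Longrightarrow> f - g \<in> AA.K" "AA.K \<subseteq> FF"
proof -
  have "0 = 0 + frag_cmul 0 pv" by simp
  then show "0 \<in> AA.K" unfolding K_iff using KD_closed(1) by blast
  show "AA.K \<subseteq> FF" unfolding K_iff subset_iff using KD_closed(3) FF_closed(2,5) el_in_FF by blast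
  assume "f \<in> AA.K" "g \<in> AA.K"
  then obtain k c k' c' where *: "k \<in> KD" "f = k + frag_cmul c pv" "k' \<in> KD" "g = k' + frag_cmul c' pv"
    unfolding K_iff by blast
  have "f - g = (k - k') + frag_cmul (c - c') pv"
    unfolding * by (simp add: frag_cmul_diff_distrib)
  then show "f - g \<in> AA.K" unfolding K_iff using KD_closed(2)[OF *(1,3)] by blast
qed

lemma K_uminus: "f \<in> AA.K \<Longrightarrow> - f \<in> AA.K"
  using K_closed(2)[OF K_closed(1)] by (simp only: diff_0)
lemma K_add: "f \<in> AA.K \<Longrightarrow> g \<in> AA.K \<Longrightarrow> f + g \<in> AA.K"
  using K_closed(2)[OF _ K_uminus] by (simp only: diff_minus_eq_add)

lemma theta_KD: "f \<in> KD \<Longrightarrow> A1.theta (L f) = 0 \<and> A2.theta (R f) = 0 \<and>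
    alpha_comb d1 (L f) \<in> B1 \<and> alpha_comb d2 (R f) \<in> B2"
  unfolding KD_def A1.D_def A2.D_def by blast

lemma L_add_pv: "L (g + frag_cmul c pv) = L g + zmul c (one_vec d1)"
  and R_add_pv: "R (g + frag_cmul c pv) = R g + zmul c (one_vec d2)"
  by (simp_all only: L_add R_add L_cmul R_cmul L_el R_el restr_one)

lemma restr_0: "restr n 0 = 0"
  by (rule restr_id) simp

lemma L_add_sg: "L (g + frag_cmul c sg) = L g + zmul c (one_vec d1)"
  and R_add_sg: "R (g + frag_cmul c sg) = R g"
  by (simp_all only: L_add R_add L_cmul R_cmul L_el R_el restr_one restr_0 zmul_zero add_0_right)

lemma phi_add_KD:
  assumes "k \<in> KD"
  shows "phi (k + g) = phi g"
proof -
  note k = theta_KD[OF assms]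
  have "A1.theta (L k + L g) = A1.theta (L g)" "A2.theta (R k + R g) = A2.theta (R g)"
    using A1.theta_add_period[of "L k" "L g"] A2.theta_add_period[of "R k" "R g"] k by linarith+
  then show ?thesis unfolding phi_def L_add R_add by (simp only:)
qed

text \<open>\<open>pv\<close> raises both potentials by the same amount. This is why their
  difference descends to \<open>H\<close>, while neither potential does so alone.\<close>

lemma phi_add_pv: "phi (g + frag_cmul c pv) = phi g"
  unfolding phi_def L_add_pv R_add_pv A1.theta_add_one A2.theta_add_one by simp

text \<open>\<open>sg\<close> is a lift of \<open>s\<close> with all ones on the left and zeros on
  the right, so only the left potential grows.\<close>

lemma phi_add_sg: "phi (g + frag_cmul c sg) = phi g + c"
  unfolding phi_def L_add_sg R_add_sg A1.theta_add_one by simp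

lemma phi_add_K:
  assumes "k \<in> AA.K"
  shows "phi (k + g) = phi g"
proof -
  obtain k' c where k: "k' \<in> KD" "k = k' + frag_cmul c pv" using assms unfolding K_iff by blast
  have "k + g = k' + (g + frag_cmul c pv)" unfolding k by (simp add: ac_simps)
  then show ?thesis using phi_add_KD[OF k(1)] phi_add_pv by (simp only:)
qed

lemma phi_0: "phi 0 = 0"
  unfolding phi_def L_0 R_0 A1.theta_0 A2.theta_0 by simp

lemma subgroup_K: "subgroup AA.K AA.F"
proof (rule group.subgroupI)
  show "group AA.F" by simp
  show "AA.K \<subseteq> carrier AA.F" unfolding carrier_F by (rule K_closed(3))
  show "AA.K \<noteq> {}" using K_closed(1) by blast
  show "inv\<^bsub>AA.F\<^esub> a \<in> AA.K" if "a \<in> AA.K" for a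
  proof -
    have "a \<in> carrier AA.F" using that K_closed(3) unfolding carrier_F by blast
    then have "inv\<^bsub>AA.F\<^esub> a = - a" by simp
    then show ?thesis using K_uminus[OF that] by (simp only:)
  qed
  show "a \<otimes>\<^bsub>AA.F\<^esub> b \<in> AA.K" if "a \<in> AA.K" "b \<in> AA.K" for a b
    unfolding mult_free_Abelian_group using that by (rule K_add)
qed

lemma comm_F: "comm_group AA.F" by (rule abelian_free_Abelian_group)
lemma normal_K: "AA.K \<lhd> AA.F"
  using comm_group.subgroup_imp_normal[OF comm_F subgroup_K] .

sublocale H: comm_group AA.H
  unfolding AA.H_def by (rule comm_group.abelian_FactGroup[OF comm_F subgroup_K])

lemma carrier_H: "carrier AA.H = AA.deg ` FF"
  unfolding AA.H_def FactGroup_def partial_object.select_convs RCOSETS_def carrier_F AA.deg_def by blast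

lemma deg_closed: "f \<in> FF \<Longrightarrow> AA.deg f \<in> carrier AA.H"
  unfolding carrier_H by blast

lemma deg_set: "AA.deg f = (\<lambda>k. k + f) ` AA.K"
  unfolding AA.deg_def r_coset_def mult_free_Abelian_group by blast

lemma deg_eq_iff: "AA.deg f = AA.deg g \<longleftrightarrow> f - g \<in> AA.K"
proof
  assume "AA.deg f = AA.deg g"
  moreover have "0 + f \<in> AA.deg f" unfolding deg_set using K_closed(1) by (rule imageI)
  ultimately obtain k where "k \<in> AA.K" "0 + f = k + g" unfolding deg_set by blast
  then show "f - g \<in> AA.K" by (metis add_0 add_diff_cancel_right')
next
  have sub: "AA.deg f \<subseteq> AA.deg g" if "f - g \<in> AA.K" for f g
  proof
    fix h assume "h \<in> AA.deg f"
    then obtain k where k: "k \<in> AA.K" "h = k + f" unfolding deg_set by blast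
    have "h = (k + (f - g)) + g" unfolding k by simp
    then show "h \<in> AA.deg g" unfolding deg_set using K_add[OF k(1) that] by blast
  qed
  assume *: "f - g \<in> AA.K"
  moreover have "g - f \<in> AA.K" using K_uminus[OF *] by (simp only: minus_diff_eq)
  ultimately show "AA.deg f = AA.deg g" using sub by blast
qed

lemma deg_mult: "f \<in> FF \<Longrightarrow> g \<in> FF \<Longrightarrow> AA.deg f \<otimes>\<^bsub>AA.H\<^esub> AA.deg g = AA.deg (f + g)"
  using normal.rcos_sum[OF normal_K, of f g]
  unfolding carrier_F AA.deg_def AA.H_def mult_free_Abelian_group FactGroup_def monoid.select_convs by blast

lemma deg_0: "AA.deg 0 = \<one>\<^bsub>AA.H\<^esub>"
  unfolding AA.H_def FactGroup_def monoid.select_convs deg_set by simp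

lemma deg_uminus:
  assumes "f \<in> FF"
  shows "inv\<^bsub>AA.H\<^esub> AA.deg f = AA.deg (- f)"
proof (rule H.inv_equality)
  show "AA.deg (- f) \<otimes>\<^bsub>AA.H\<^esub> AA.deg f = \<one>\<^bsub>AA.H\<^esub>"
    using deg_mult[OF FF_closed(4)[OF assms] assms] by (simp only: add.left_inverse deg_0)
qed (intro deg_closed FF_closed assms)+

lemma deg_pow:
  assumes "f \<in> FF"
  shows "AA.deg f [^]\<^bsub>AA.H\<^esub> (n :: nat) = AA.deg (frag_cmul (int n) f)"
proof (induction n)
  case 0
  show ?case by (simp only: H.nat_pow_0 of_nat_0 frag_cmul_zero deg_0)
next
  case (Suc n)
  have "frag_cmul (int n) f + f = frag_cmul (int (Suc n)) f"
    by (simp add: frag_cmul_distrib)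
  then show ?case
    unfolding H.nat_pow_Suc Suc deg_mult[OF FF_closed(5)[OF assms] assms] by (simp only:)
qed

lemma phi_deg: "AA.deg f = AA.deg g \<Longrightarrow> phi f = phi g"
  unfolding deg_eq_iff using phi_add_K[of "f - g" g] by (simp only: diff_add_cancel)

lemma I_iff: "f \<in> FF \<Longrightarrow> AA.deg f \<in> I \<longleftrightarrow> phi f \<ge> 0"
proof
  assume "f \<in> FF" "AA.deg f \<in> I"
  then obtain g where "AA.deg f = AA.deg g" "phi g \<ge> 0" unfolding I_def by blast
  then show "phi f \<ge> 0" using phi_deg by metis
next
  assume "f \<in> FF" "phi f \<ge> 0"
  then show "AA.deg f \<in> I" unfolding I_def by blast
qed

lemma xbar_eq: "AA.xbar i = AA.deg (frag_of (v i))" "AA.xbar' i = AA.deg (frag_of (v' i))"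
  by (simp_all only: AA.xbar_def AA.xbar'_def)

lemma s_eq: "AA.s = AA.deg sg"
proof -
  have "(\<Sum>i\<le>d1. frag_of (v i)) = sg" unfolding el_def by (simp add: one_vec_def)
  then show ?thesis unfolding AA.s_def by (simp only:)
qed

lemma cmul_sg_FF: "frag_cmul c sg \<in> FF" by (intro FF_closed el_in_FF)

text \<open>\<open>phi\<close> has integer values and \<open>s\<close> adds 1, so the complement of
  \<open>I\<close>, shifted by \<open>s\<close>, is the set where \<open>phi\<close> is at most
  0.\<close>

lemma J_iff:
  assumes f: "f \<in> FF"
  shows "AA.deg f \<in> AA.J \<longleftrightarrow> phi f = 0"
proof
  assume "AA.deg f \<in> AA.J"
  then obtain h where h: "AA.deg f \<in> I" "h \<in> carrier AA.H - I" "AA.deg f = h \<otimes>\<^bsub>AA.H\<^esub> AA.s"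
    unfolding AA.J_def by blast
  then obtain g where g: "g \<in> FF" "h = AA.deg g" unfolding carrier_H by blast
  have "phi g < 0" using h(2) g I_iff[OF g(1)] by auto
  moreover have "AA.deg f = AA.deg (g + frag_cmul 1 sg)"
    using h(3) deg_mult[OF g(1) el_in_FF] unfolding g s_eq by (simp only: frag_cmul_one)
  then have "phi f = phi g + 1" using phi_deg phi_add_sg by metis
  ultimately show "phi f = 0" using h(1) I_iff[OF f] by linarith
next
  assume 0: "phi f = 0"
  define g where "g = f + frag_cmul (- 1) sg"
  have g: "g \<in> FF" unfolding g_def by (intro FF_closed el_in_FF f)
  have "phi g = -1" unfolding g_def phi_add_sg 0 by simp
  then have "AA.deg g \<in> carrier AA.H - I" using deg_closed[OF g] I_iff[OF g] by auto
  moreover have "AA.deg f = AA.deg g \<otimes>\<^bsub>AA.H\<^esub> AA.s"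
  proof -
    have "g + sg = f" unfolding g_def by simp
    then show ?thesis unfolding s_eq deg_mult[OF g el_in_FF] by (simp only:)
  qed
  moreover have "AA.deg f \<in> I" unfolding I_iff[OF f] 0 by simp
  ultimately show "AA.deg f \<in> AA.J" unfolding AA.J_def by blast
qed

text \<open>Adding left generators never decreases \<open>A1.theta\<close>, and subtracting right
  ones never increases \<open>A2.theta\<close>. So \<open>phi\<close> is monotone for the order on
  \<open>H\<close>.\<close>

lemma nontrivial_upper_set: "AA.nontrivial_upper_set"
  unfolding AA.nontrivial_upper_set_def
proof (intro conjI ballI impI)
  show "I \<subseteq> carrier AA.H" unfolding I_def carrier_H by blast
  show "I \<noteq> {}" using I_iff[OF FF_closed(1)] phi_0 by auto
  have f: "0 + frag_cmul (- 1) sg \<in> FF" by (intro FF_closed el_in_FF)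
  have "phi (0 + frag_cmul (- 1) sg) = - 1" unfolding phi_add_sg phi_0 by simp
  then show "I \<noteq> carrier AA.H" using I_iff[OF f] deg_closed[OF f] by auto
  fix h g assume h: "h \<in> I" and g: "g \<in> carrier AA.H" and geq: "AA.geqH g h"
  obtain f where f: "f \<in> FF" "h = AA.deg f" using h unfolding I_def by blast
  obtain f' where f': "f' \<in> FF" "g = AA.deg f'" using g unfolding carrier_H by blast
  obtain a b :: "nat \<Rightarrow> nat" where ab: "g \<otimes>\<^bsub>AA.H\<^esub> inv\<^bsub>AA.H\<^esub> h =
      AA.deg ((\<Sum>i\<le>d1. frag_cmul (int (a i)) (frag_of (v i))) - (\<Sum>i\<le>d2. frag_cmul (int (b i)) (frag_of (v' i))))"
    using geq unfolding AA.geqH_def by blast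
  let ?q = "el (\<lambda>i. int (a i)) (\<lambda>i. - int (b i))"
  have q: "(\<Sum>i\<le>d1. frag_cmul (int (a i)) (frag_of (v i))) - (\<Sum>i\<le>d2. frag_cmul (int (b i)) (frag_of (v' i))) = ?q"
    unfolding el_def by (simp add: sum_negf[symmetric])
  have "AA.deg (f' + - f) = AA.deg ?q"
    using ab unfolding f f' deg_uminus[OF f(1)] deg_mult[OF f'(1) FF_closed(4)[OF f(1)]] q .
  then have "f' + - f - ?q \<in> AA.K" unfolding deg_eq_iff .
  then have "phi ((f' + - f - ?q) + (f + ?q)) = phi (f + ?q)" by (rule phi_add_K)
  moreover have "(f' + - f - ?q) + (f + ?q) = f'" by simp
  ultimately have "phi f' = phi (f + ?q)" by (simp only:)
  moreover have "A1.theta (L f) \<le> A1.theta (L (f + ?q))"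
    unfolding L_add L_el by (rule A1.theta_mono) (simp add: restr_def)
  moreover have "A2.theta (R (f + ?q)) \<le> A2.theta (R f)"
  proof -
    have "A2.theta (R (f + ?q)) \<le> A2.theta (R (f + ?q) + restr d2 (\<lambda>i. int (b i)))"
      by (rule A2.theta_mono) (simp add: restr_def)
    also have "R (f + ?q) + restr d2 (\<lambda>i. int (b i)) = R f"
      unfolding R_add R_el by (rule ext) (simp add: restr_def)
    finally show ?thesis .
  qed
  ultimately have "phi f \<le> phi f'" unfolding phi_def by linarith
  then show "g \<in> I" using h unfolding f f' I_iff[OF f(1)] I_iff[OF f'(1)] by linarith
qed

text \<open>\<open>phi\<close> need not be additive. This is its linear part with the denominators
  cleared by both periods; it vanishes on \<open>K\<close> and thus induces a homomorphism on
  \<open>H\<close>.\<close>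

definition psi :: "(int ^ 'n \<Rightarrow>\<^sub>0 int) \<Rightarrow> int" where
  "psi f = int A2.period * (\<Sum>i\<le>d1. A1.mu i * L f i) - int A1.period * (\<Sum>i\<le>d2. A2.mu i * R f i)"

lemma psi_add: "psi (f + g) = psi f + psi g" and psi_diff: "psi (f - g) = psi f - psi g"
  unfolding psi_def L_add R_add L_diff R_diff
  by (simp_all add: distrib_left right_diff_distrib sum.distrib sum_subtractf)

lemma psi_cmul: "psi (frag_cmul c f) = c * psi f"
proof -
  have "(\<Sum>i\<le>d1. A1.mu i * (c * L f i)) = c * (\<Sum>i\<le>d1. A1.mu i * L f i)"
    "(\<Sum>i\<le>d2. A2.mu i * (c * R f i)) = c * (\<Sum>i\<le>d2. A2.mu i * R f i)"
    by (simp_all add: sum_distrib_left ac_simps)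
  then show ?thesis
    unfolding psi_def L_cmul R_cmul zmul_apply by (simp add: right_diff_distrib ac_simps)
qed

lemma psi_KD:
  assumes "f \<in> KD"
  shows "psi f = 0"
proof -
  have "L f \<in> A1.D" "R f \<in> A2.D" using assms unfolding KD_def by blast+
  then show ?thesis unfolding psi_def using A1.D_mu A2.D_mu by simp
qed

lemma psi_pv: "psi pv = 0"
proof -
  have "(\<Sum>i\<le>d1. A1.mu i * one_vec d1 i) = int A1.period" "(\<Sum>i\<le>d2. A2.mu i * one_vec d2 i) = int A2.period"
    using A1.sum_mu A2.sum_mu by (simp_all add: one_vec_def)
  then show ?thesis unfolding psi_def L_el R_el restr_one by simp
qed

lemma psi_K: "k \<in> AA.K \<Longrightarrow> psi k = 0"
  unfolding K_iff using psi_KD psi_pv by (auto simp: psi_add psi_cmul)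

lemma psi_v: "i \<le> d1 \<Longrightarrow> psi (frag_of (v i)) > 0" and psi_v': "i \<le> d2 \<Longrightarrow> psi (frag_of (v' i)) < 0"
proof -
  assume i: "i \<le> d1"
  have "(\<Sum>j\<le>d1. A1.mu j * unit_vec i j) = A1.mu i"
    using i by (simp add: unit_vec_def if_distrib cong: if_cong)
  then show "psi (frag_of (v i)) > 0"
    unfolding psi_def L_v[OF i] R_v[OF i] using A1.mu_pos[OF i] A2.period(1) by simp
next
  assume i: "i \<le> d2"
  have "(\<Sum>j\<le>d2. A2.mu j * unit_vec i j) = A2.mu i"
    using i by (simp add: unit_vec_def if_distrib cong: if_cong)
  then show "psi (frag_of (v' i)) < 0"
    unfolding psi_def L_v'[OF i] R_v'[OF i] using A2.mu_pos[OF i] A1.period(1) by simp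
qed

text \<open>Multiplied by both periods, the two halves of \<open>f\<close> become periods, and
  \<open>psi f = 0\<close> says that they have the same potential \<open>t\<close>. Subtracting
  \<open>t\<close> times \<open>pv\<close> brings both potentials to 0 and leads into
  \<open>KD\<close>.\<close>

lemma psi_eq_0:
  assumes f: "f \<in> FF" and 0: "psi f = 0"
  shows "frag_cmul (int (A1.period * A2.period)) f \<in> AA.K"
proof -
  let ?N = "int (A1.period * A2.period)"
  define t where "t = A1.theta (zmul ?N (L f))"
  have z1: "zmul ?N (L f) = zmul (int A1.period) (zmul (int A2.period) (L f))"
    and z2: "zmul ?N (R f) = zmul (int A2.period) (zmul (int A1.period) (R f))"
    by (rule ext; simp add: ac_simps)+
  have "t = int A2.period * (\<Sum>i\<le>d1. A1.mu i * L f i)"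
    unfolding t_def z1 A1.theta_period by (simp add: sum_distrib_left ac_simps)
  moreover have "A2.theta (zmul ?N (R f)) = int A1.period * (\<Sum>i\<le>d2. A2.mu i * R f i)"
    unfolding z2 A2.theta_period by (simp add: sum_distrib_left ac_simps)
  ultimately have t2: "A2.theta (zmul ?N (R f)) = t" using 0 unfolding psi_def by linarith
  define k where "k = frag_cmul ?N f + frag_cmul (- t) pv"
  have "k \<in> KD"
  proof -
    have "L k \<in> A1.D" unfolding A1.D_def mem_Collect_eq
    proof (intro conjI)
      show "restr d1 (L k) = L k" by (rule restr_L)
      show "alpha_comb d1 (L k) \<in> B1"
        unfolding k_def L_add_pv L_cmul z1 alpha_comb_add alpha_comb_zmul[of d1 "- t"] alpha_comb_one zmul_zero add_0_right
        by (rule A1.period(2))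
      show "A1.theta (L k) = 0" unfolding k_def L_add_pv L_cmul A1.theta_add_one t_def by simp
    qed
    moreover have "R k \<in> A2.D" unfolding A2.D_def mem_Collect_eq
    proof (intro conjI)
      show "restr d2 (R k) = R k" by (rule restr_R)
      show "alpha_comb d2 (R k) \<in> B2"
        unfolding k_def R_add_pv R_cmul z2 alpha_comb_add alpha_comb_zmul[of d2 "- t"] alpha_comb_one zmul_zero add_0_right
        by (rule A2.period(2))
      show "A2.theta (R k) = 0" unfolding k_def R_add_pv R_cmul A2.theta_add_one t2 by simp
    qed
    moreover have "k \<in> FF" unfolding k_def by (intro FF_closed el_in_FF f)
    ultimately show ?thesis unfolding KD_def by blast
  qed
  moreover have "frag_cmul ?N f = k + frag_cmul t pv" unfolding k_def by (simp add: add.assoc flip: frag_cmul_distrib)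
  ultimately show ?thesis unfolding K_iff by blast
qed

lemma labelling: "AA.labelling"
proof -
  obtain g where g: "g \<in> psi ` FF" "\<And>a. a \<in> psi ` FF \<Longrightarrow> g dvd a"
  proof (rule int_subgroup_generator[of "psi ` FF"])
    have "psi 0 = 0" using psi_K[OF K_closed(1)] .
    then show "0 \<in> psi ` FF" using FF_closed(1) by force
    show "a - b \<in> psi ` FF" if ab: "a \<in> psi ` FF" "b \<in> psi ` FF" for a b
    proof -
      obtain f where f: "f \<in> FF" "a = psi f" using ab(1) by blast
      obtain h where h: "h \<in> FF" "b = psi h" using ab(2) by blast
      show ?thesis by (rule image_eqI[OF _ FF_closed(3)[OF f(1) h(1)]]) (simp only: f h psi_diff)
    qed
  qed blast
  have v0: "frag_of (v 0) \<in> FF" by (intro FF_closed) auto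
  have "g \<noteq> 0" using g(2)[OF imageI[OF v0]] psi_v[of 0] by auto
  \<comment> \<open>\<open>g\<close> generates the values of \<open>psi\<close>, but may be
    negative. Dividing by its absolute value keeps the sign of \<open>psi\<close>, which has to be
    positive at the \<open>v i\<close>.\<close>
  define h where "h = \<bar>g\<bar>"
  have h: "h > 0" "\<And>f. f \<in> FF \<Longrightarrow> h dvd psi f" using \<open>g \<noteq> 0\<close> g(2) by (auto simp: h_def)
  define \<pi> where "\<pi> c = psi (SOME f. f \<in> FF \<and> AA.deg f = c) div h" for c
  have \<pi>: "\<pi> (AA.deg f) = psi f div h" if "f \<in> FF" for f
  proof -
    let ?g = "SOME g. g \<in> FF \<and> AA.deg g = AA.deg f"
    have "?g \<in> FF \<and> AA.deg ?g = AA.deg f" by (rule someI[of _ f]) (simp add: that)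
    then have "?g - f \<in> AA.K" unfolding deg_eq_iff by blast
    then have "psi (?g - f) = 0" by (rule psi_K)
    then show ?thesis unfolding \<pi>_def psi_diff by simp
  qed
  have mult: "\<pi> (AA.deg f) * h = psi f" if "f \<in> FF" for f
    unfolding \<pi>[OF that] using h(2)[OF that] by simp
  have "AA.projection_mod_torsion \<pi>"
    unfolding AA.projection_mod_torsion_def
  proof (intro conjI)
    show "\<pi> \<in> hom AA.H integer_group"
    proof (rule homI)
      fix x y assume "x \<in> carrier AA.H" "y \<in> carrier AA.H"
      then obtain f f' where f: "f \<in> FF" "x = AA.deg f" and f': "f' \<in> FF" "y = AA.deg f'"
        unfolding carrier_H by blast
      have "\<pi> (AA.deg (f + f')) * h = (\<pi> (AA.deg f) + \<pi> (AA.deg f')) * h"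
        unfolding distrib_right mult[OF f(1)] mult[OF f'(1)] mult[OF FF_closed(2)[OF f(1) f'(1)]] psi_add ..
      then show "\<pi> (x \<otimes>\<^bsub>AA.H\<^esub> y) = \<pi> x \<otimes>\<^bsub>integer_group\<^esub> \<pi> y"
        unfolding f f' deg_mult[OF f(1) f'(1)] using h(1) by simp
    qed simp
    show "\<pi> ` carrier AA.H = UNIV"
    proof -
      obtain f where f: "f \<in> FF" "psi f = g" using g(1) by blast
      have "z \<in> \<pi> ` carrier AA.H" for z
      proof -
        let ?f = "frag_cmul (z * sgn g) f"
        have ff: "?f \<in> FF" using f(1) by (rule FF_closed)
        have "psi ?f = z * h" unfolding psi_cmul f(2) h_def by (simp add: abs_sgn ac_simps)
        then have "\<pi> (AA.deg ?f) = z" unfolding \<pi>[OF ff] using h(1) by simp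
        then show ?thesis by (rule image_eqI[OF sym deg_closed[OF ff]])
      qed
      then show ?thesis by blast
    qed
    show "kernel AA.H integer_group \<pi> = {h \<in> carrier AA.H. \<exists>n::nat. n > 0 \<and> h [^]\<^bsub>AA.H\<^esub> n = \<one>\<^bsub>AA.H\<^esub>}"
    proof -
      have "\<pi> (AA.deg f) = 0 \<longleftrightarrow> (\<exists>n::nat. n > 0 \<and> AA.deg f [^]\<^bsub>AA.H\<^esub> n = \<one>\<^bsub>AA.H\<^esub>)" if f: "f \<in> FF" for f
      proof
        assume "\<pi> (AA.deg f) = 0"
        then have "psi f = 0" using mult[OF f] by simp
        then have "frag_cmul (int (A1.period * A2.period)) f - 0 \<in> AA.K"
          using psi_eq_0[OF f] by simp
        then have "AA.deg f [^]\<^bsub>AA.H\<^esub> (A1.period * A2.period) = \<one>\<^bsub>AA.H\<^esub>"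
          unfolding deg_pow[OF f] deg_0[symmetric] deg_eq_iff .
        then show "\<exists>n::nat. n > 0 \<and> AA.deg f [^]\<^bsub>AA.H\<^esub> n = \<one>\<^bsub>AA.H\<^esub>"
          using A1.period(1) A2.period(1) by (intro exI[of _ "A1.period * A2.period"]) simp
      next
        assume "\<exists>n::nat. n > 0 \<and> AA.deg f [^]\<^bsub>AA.H\<^esub> n = \<one>\<^bsub>AA.H\<^esub>"
        then obtain n :: nat where n: "n > 0" "AA.deg f [^]\<^bsub>AA.H\<^esub> n = \<one>\<^bsub>AA.H\<^esub>" by blast
        then have "frag_cmul (int n) f - 0 \<in> AA.K" unfolding deg_pow[OF f] deg_0[symmetric] deg_eq_iff by blast
        then have "psi (frag_cmul (int n) f) = 0" using psi_K by simp
        then have "psi f = 0" using n(1) unfolding psi_cmul by simp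
        then show "\<pi> (AA.deg f) = 0" unfolding \<pi>[OF f] by simp
      qed
      then show ?thesis unfolding kernel_def carrier_H by auto
    qed
  qed
  moreover have "\<forall>i\<le>d1. \<pi> (AA.xbar i) > 0"
  proof (intro allI impI)
    fix i assume i: "i \<le> d1"
    have "frag_of (v i) \<in> FF" using i by (intro FF_closed) auto
    then show "\<pi> (AA.xbar i) > 0"
      unfolding xbar_eq using mult[of "frag_of (v i)"] psi_v[OF i] h(1) by (metis zero_less_mult_pos2)
  qed
  moreover have "\<forall>i\<le>d2. \<pi> (AA.xbar' i) < 0"
  proof (intro allI impI)
    fix i assume i: "i \<le> d2"
    have "frag_of (v' i) \<in> FF" using i by (intro FF_closed) auto
    then have "\<pi> (AA.xbar' i) * h < 0"
      unfolding xbar_eq using mult[of "frag_of (v' i)"] psi_v'[OF i] by simp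
    then show "\<pi> (AA.xbar' i) < 0" using h(1) by (simp add: mult_less_0_iff)
  qed
  moreover have "bij_betw (case_sum v v') ({..d1} <+> {..d2}) AA.V"
  proof -
    have "case_sum v v' = vv" by (rule ext) (simp split: sum.split)
    then show ?thesis using inj_vv unfolding bij_betw_def V_eq by simp
  qed
  ultimately show ?thesis
    unfolding AA.labelling_def using A1.d A2.d card_n by metis
qed

lemma card_V: "card AA.V = CARD('n) + 2"
  unfolding V_eq card_image[OF inj_vv] by (simp add: card_Plus card_n)

lemma simplicial: "AA.simplicial_lattice_polytope"
proof -
  have X: "Inl ` {..d1} \<union> Inr ` {..d2} = X" by (simp only: Plus_def)
  have "x \<in> range lat" if "x extreme_point_of P" for x
    using that P.extreme_points unfolding X by blast
  then show ?thesis
    unfolding AA.simplicial_lattice_polytope_def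
    using P.polytope_P P.aff_dim_P P.facet_simplex unfolding X by simp
qed

end

context AA_datum
begin

subsection \<open>The map \<open>Psi\<close>\<close>

text \<open>Sends a vertex of the polytope to its root. It mediates between \<open>F\<close> and the
  lattice of the quiver: on \<open>sig f\<close>, \<open>Psi\<close> is the class of
  \<open>deg f\<close> modulo \<open>s\<close>.\<close>

definition sig :: "(int ^ 'n \<Rightarrow>\<^sub>0 int) \<Rightarrow> pt" where
  "sig f = (alpha_comb d1 (L f), alpha_comb d2 (R f))"

lemma LL_simps: "carrier AA.LL = root_lattice d1 \<times> root_lattice d2" "x \<otimes>\<^bsub>AA.LL\<^esub> y = x + y" "\<one>\<^bsub>AA.LL\<^esub> = 0"
  by (simp_all only: AA.LL_def add_group_def partial_object.select_convs monoid.select_convs)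

lemma comm_LL: "comm_group AA.LL"
  unfolding AA.LL_def
proof (rule comm_group_add_group)
  show "0 \<in> root_lattice d1 \<times> root_lattice d2"
    unfolding zero_prod_def using root_lattice_closed(1) by blast
  show "x - y \<in> root_lattice d1 \<times> root_lattice d2"
    if "x \<in> root_lattice d1 \<times> root_lattice d2" "y \<in> root_lattice d1 \<times> root_lattice d2" for x y
    using that root_lattice_closed(2)[of "fst x" d1 "fst y"] root_lattice_closed(2)[of "snd x" d2 "snd y"]
    unfolding mem_Times_iff fst_diff snd_diff by blast
qed

lemma sig_add: "sig (f + g) = sig f + sig g" and sig_diff: "sig (f - g) = sig f - sig g"
  and sig_0: "sig 0 = 0"
  unfolding sig_def L_add R_add L_diff R_diff L_0 R_0 alpha_comb_add alpha_comb_diff alpha_comb_0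
  by (simp_all only: add_Pair diff_Pair zero_prod_def)

lemma sig_closed: "sig f \<in> carrier AA.LL"
  unfolding sig_def LL_simps by simp

lemma sig_el: "sig (el a b) = (alpha_comb d1 a, alpha_comb d2 b)"
  unfolding sig_def L_el R_el alpha_comb_restr ..

lemma sig_surj:
  assumes "x \<in> carrier AA.LL"
  obtains f where "f \<in> FF" "sig f = x"
proof -
  have x: "fst x \<in> root_lattice d1" "snd x \<in> root_lattice d2" using assms unfolding LL_simps by auto
  obtain a where a: "alpha_comb d1 a = fst x" by (rule alpha_comb_surj[OF x(1)])
  obtain b where b: "alpha_comb d2 b = snd x" by (rule alpha_comb_surj[OF x(2)])
  show thesis
  proof (rule that[OF el_in_FF])
    show "sig (el a b) = x" unfolding sig_el a b by simp
  qed
qed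

lemma sig_v: "i \<le> d1 \<Longrightarrow> sig (frag_of (v i)) = (alpha d1 i, 0)"
  and sig_v': "j \<le> d2 \<Longrightarrow> sig (frag_of (v' j)) = (0, alpha d2 j)"
  unfolding sig_def by (simp_all only: L_v R_v L_v' R_v' alpha_comb_unit_vec[OF A1.d] alpha_comb_unit_vec[OF A2.d] alpha_comb_0)

text \<open>If both halves of \<open>f\<close> are periods, the multiple of \<open>pv\<close>
  cancels the right potential, and the multiple of \<open>sg\<close> cancels what then remains on
  the left. Neither changes the image under \<open>sig\<close>, and the result lies in
  \<open>KD\<close>.\<close>

lemma sig_in_B_iff:
  assumes f: "f \<in> FF"
  shows "sig f \<in> B1 \<times> B2 \<longleftrightarrow> (\<exists>c. f - frag_cmul c sg \<in> AA.K)"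
proof
  assume "sig f \<in> B1 \<times> B2"
  then have B: "alpha_comb d1 (L f) \<in> B1" "alpha_comb d2 (R f) \<in> B2" unfolding sig_def by blast+
  let ?t1 = "A1.theta (L f)" and ?t2 = "A2.theta (R f)"
  define k where "k = f + frag_cmul (- (?t1 - ?t2)) sg + frag_cmul (- ?t2) pv"
  have Lk: "L k = L f + zmul (- (?t1 - ?t2)) (one_vec d1) + zmul (- ?t2) (one_vec d1)"
    and Rk: "R k = R f + zmul (- ?t2) (one_vec d2)"
    unfolding k_def L_add_pv R_add_pv L_add_sg R_add_sg by (rule refl)+
  have "k \<in> KD" unfolding KD_def A1.D_def A2.D_def mem_Collect_eq
  proof (intro conjI restr_L restr_R)
    show "k \<in> FF" unfolding k_def by (intro FF_closed el_in_FF f)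
    show "alpha_comb d1 (L k) \<in> B1"
      unfolding Lk alpha_comb_add alpha_comb_zmul alpha_comb_one zmul_zero add_0_right by (rule B)
    show "alpha_comb d2 (R k) \<in> B2"
      unfolding Rk alpha_comb_add alpha_comb_zmul alpha_comb_one zmul_zero add_0_right by (rule B)
    show "A1.theta (L k) = 0" unfolding Lk A1.theta_add_one by simp
    show "A2.theta (R k) = 0" unfolding Rk A2.theta_add_one by simp
  qed
  moreover have "f - frag_cmul (?t1 - ?t2) sg = k + frag_cmul ?t2 pv"
    unfolding k_def by (simp add: frag_cmul_distrib frag_cmul_diff_distrib flip: minus_frag_cmul)
  ultimately show "\<exists>c. f - frag_cmul c sg \<in> AA.K" unfolding K_iff by blast
next
  assume "\<exists>c. f - frag_cmul c sg \<in> AA.K"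
  then obtain c k c' where k: "k \<in> KD" "f - frag_cmul c sg = k + frag_cmul c' pv" unfolding K_iff by blast
  have f_eq: "f = k + frag_cmul c' pv + frag_cmul c sg" using k(2) by (simp add: algebra_simps)
  show "sig f \<in> B1 \<times> B2"
    unfolding f_eq sig_def L_add_sg R_add_sg L_add_pv R_add_pv alpha_comb_add alpha_comb_zmul alpha_comb_one
      zmul_zero add_0_right
    using theta_KD[OF k(1)] by blast
qed

lemma Zs_eq: "AA.Zs = {AA.deg (frag_cmul c sg) | c. True}"
proof -
  have pow: "AA.deg sg [^]\<^bsub>AA.H\<^esub> (c :: int) = AA.deg (frag_cmul c sg)" for c
  proof (cases c rule: int_cases2)
    case (nonneg n)
    show ?thesis unfolding nonneg int_pow_int by (rule deg_pow[OF el_in_FF])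
  next
    case (nonpos n)
    have "AA.deg sg [^]\<^bsub>AA.H\<^esub> c = inv\<^bsub>AA.H\<^esub> (AA.deg sg [^]\<^bsub>AA.H\<^esub> n)"
      unfolding nonpos by (rule H.int_pow_neg_int[OF deg_closed[OF el_in_FF]])
    also have "\<dots> = AA.deg (- frag_cmul (int n) sg)"
      unfolding deg_pow[OF el_in_FF] by (rule deg_uminus[OF cmul_sg_FF])
    finally show ?thesis unfolding nonpos minus_frag_cmul .
  qed
  show ?thesis
    unfolding AA.Zs_def s_eq H.generate_pow[OF deg_closed[OF el_in_FF]] pow by blast
qed

lemma Zs_subgroup: "subgroup AA.Zs AA.H"
  unfolding AA.Zs_def s_eq by (rule H.generate_is_subgroup) (use deg_closed[OF el_in_FF] in blast)

lemma Zs_normal: "AA.Zs \<lhd> AA.H" by (rule H.subgroup_imp_normal[OF Zs_subgroup])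

lemma comm_HZ: "comm_group (AA.H Mod AA.Zs)" by (rule H.abelian_FactGroup[OF Zs_subgroup])

abbreviation cs where "cs f \<equiv> AA.Zs #>\<^bsub>AA.H\<^esub> AA.deg f"

lemma deg_in_Zs_iff:
  assumes f: "f \<in> FF"
  shows "AA.deg f \<in> AA.Zs \<longleftrightarrow> sig f \<in> B1 \<times> B2"
  unfolding Zs_eq sig_in_B_iff[OF f] deg_eq_iff[symmetric] by blast

lemma cs_eq_iff:
  assumes f: "f \<in> FF" and g: "g \<in> FF"
  shows "cs f = cs g \<longleftrightarrow> sig f - sig g \<in> B1 \<times> B2"
proof -
  have "cs f = cs g \<longleftrightarrow> AA.deg f \<otimes>\<^bsub>AA.H\<^esub> inv\<^bsub>AA.H\<^esub> AA.deg g \<in> AA.Zs"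
  proof
    assume eq: "cs f = cs g"
    have "AA.deg f \<in> cs g" using H.rcos_self[OF deg_closed[OF f] Zs_subgroup] unfolding eq .
    then show "AA.deg f \<otimes>\<^bsub>AA.H\<^esub> inv\<^bsub>AA.H\<^esub> AA.deg g \<in> AA.Zs"
      by (rule subgroup.rcos_module_imp[OF Zs_subgroup H.is_group deg_closed[OF g]])
  next
    assume "AA.deg f \<otimes>\<^bsub>AA.H\<^esub> inv\<^bsub>AA.H\<^esub> AA.deg g \<in> AA.Zs"
    then have "AA.deg f \<in> cs g"
      by (rule subgroup.rcos_module_rev[OF Zs_subgroup H.is_group deg_closed[OF g] deg_closed[OF f]])
    then show "cs f = cs g"
      by (rule H.repr_independence[OF _ deg_closed[OF g] Zs_subgroup, symmetric])
  qed
  also have "AA.deg f \<otimes>\<^bsub>AA.H\<^esub> inv\<^bsub>AA.H\<^esub> AA.deg g = AA.deg (f - g)"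
    unfolding deg_uminus[OF g] deg_mult[OF f FF_closed(4)[OF g]] by simp
  finally show ?thesis unfolding deg_in_Zs_iff[OF FF_closed(3)[OF f g]] sig_diff .
qed

lemma cs_mult: "f \<in> FF \<Longrightarrow> g \<in> FF \<Longrightarrow> cs f \<otimes>\<^bsub>AA.H Mod AA.Zs\<^esub> cs g = cs (f + g)"
  using normal.rcos_sum[OF Zs_normal deg_closed deg_closed, of f g] deg_mult[of f g]
  unfolding FactGroup_def monoid.select_convs by simp

lemma cs_closed: "f \<in> FF \<Longrightarrow> cs f \<in> carrier (AA.H Mod AA.Zs)"
  unfolding FactGroup_def partial_object.select_convs RCOSETS_def using deg_closed by blast

lemma one_HZ: "\<one>\<^bsub>AA.H Mod AA.Zs\<^esub> = cs 0"
  unfolding deg_0 using subgroup.subset[OF Zs_subgroup] by (simp add: FactGroup_def H.coset_mult_one)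

definition is_Psi :: "(pt \<Rightarrow> (int ^ 'n \<Rightarrow>\<^sub>0 int) set set) \<Rightarrow> bool" where
  "is_Psi f \<longleftrightarrow> f \<in> hom AA.LL (AA.H Mod AA.Zs) \<and>
     (\<forall>i\<le>d1. f (alpha d1 i, 0) = AA.Zs #>\<^bsub>AA.H\<^esub> AA.xbar i) \<and>
     (\<forall>i\<le>d2. f (0, alpha d2 i) = AA.Zs #>\<^bsub>AA.H\<^esub> AA.xbar' i)"

lemma B_zero: "0 \<in> B1 \<times> B2"
  using A1.B(1) A2.B(1) by (simp add: zero_prod_def)

text \<open>\<open>Psi\<close> is a choice, so some map with the required properties has to be
  exhibited: lift along \<open>sig\<close> and take the class of the degree. By
  \<open>cs_eq_iff\<close> this does not depend on the lift.\<close>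

lemma is_Psi_Psi: "is_Psi AA.Psi"
proof -
  define lift where "lift x = (SOME f. f \<in> FF \<and> sig f = x)" for x
  have lift: "lift x \<in> FF" "sig (lift x) = x" if x: "x \<in> carrier AA.LL" for x
  proof -
    obtain f where "f \<in> FF \<and> sig f = x" using sig_surj[OF x] by blast
    then have "lift x \<in> FF \<and> sig (lift x) = x" unfolding lift_def by (rule someI)
    then show "lift x \<in> FF" "sig (lift x) = x" by blast+
  qed
  have eq: "cs (lift (sig f)) = cs f" if f: "f \<in> FF" for f
    unfolding cs_eq_iff[OF lift(1)[OF sig_closed] f] lift(2)[OF sig_closed] diff_self by (rule B_zero)
  have "is_Psi (\<lambda>x. cs (lift x))"
    unfolding is_Psi_def
  proof (intro conjI allI impI)
    show "(\<lambda>x. cs (lift x)) \<in> hom AA.LL (AA.H Mod AA.Zs)"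
    proof (rule homI)
      show "cs (lift x) \<in> carrier (AA.H Mod AA.Zs)" if "x \<in> carrier AA.LL" for x
        by (rule cs_closed[OF lift(1)[OF that]])
      fix x y assume x: "x \<in> carrier AA.LL" and y: "y \<in> carrier AA.LL"
      have "sig (lift x + lift y) = x + y" unfolding sig_add lift(2)[OF x] lift(2)[OF y] ..
      then have "cs (lift (x + y)) = cs (lift x + lift y)"
        using eq[OF FF_closed(2)[OF lift(1)[OF x] lift(1)[OF y]]] by (simp only:)
      then show "cs (lift (x \<otimes>\<^bsub>AA.LL\<^esub> y)) = cs (lift x) \<otimes>\<^bsub>AA.H Mod AA.Zs\<^esub> cs (lift y)"
        unfolding LL_simps cs_mult[OF lift(1)[OF x] lift(1)[OF y]] .
    qed
    show "cs (lift (alpha d1 i, 0)) = AA.Zs #>\<^bsub>AA.H\<^esub> AA.xbar i" if i: "i \<le> d1" for i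
      using eq[of "frag_of (v i)"] FF_closed(6)[of "Inl i"] i unfolding xbar_eq sig_v[OF i] mem_X by blast
    show "cs (lift (0, alpha d2 i)) = AA.Zs #>\<^bsub>AA.H\<^esub> AA.xbar' i" if i: "i \<le> d2" for i
      using eq[of "frag_of (v' i)"] FF_closed(6)[of "Inr i"] i unfolding xbar_eq sig_v'[OF i] mem_X by blast
  qed
  then show ?thesis
    unfolding AA.Psi_def is_Psi_def[symmetric] by (rule someI[of is_Psi])
qed

text \<open>A homomorphism is determined by its values on the roots. The induction runs over
  \<open>F\<close> instead of the lattice, because \<open>F\<close> is free on the vertices.\<close>

lemma Psi_sig:
  assumes "f \<in> FF"
  shows "AA.Psi (sig f) = cs f"
proof -
  have hom: "AA.Psi \<in> hom AA.LL (AA.H Mod AA.Zs)"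
    and v: "\<And>i. i \<le> d1 \<Longrightarrow> AA.Psi (alpha d1 i, 0) = AA.Zs #>\<^bsub>AA.H\<^esub> AA.xbar i"
    and v': "\<And>i. i \<le> d2 \<Longrightarrow> AA.Psi (0, alpha d2 i) = AA.Zs #>\<^bsub>AA.H\<^esub> AA.xbar' i"
    using is_Psi_Psi unfolding is_Psi_def by blast+
  have "Poly_Mapping.keys f \<subseteq> vv ` X" using assms unfolding FF_def by blast
  then have "f \<in> FF \<and> AA.Psi (sig f) = cs f"
  proof (induction f rule: frag_induction)
    case zero
    show ?case
      using hom_one[OF hom comm_group.axioms(2)[OF comm_LL] comm_group.axioms(2)[OF comm_HZ]] FF_closed(1)
      unfolding sig_0 LL_simps one_HZ by blast
  next
    case (one w)
    then obtain x where x: "x \<in> X" "w = vv x" by blast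
    have "AA.Psi (sig (frag_of w)) = cs (frag_of w)"
    proof (cases x)
      case (Inl i)
      then have i: "i \<le> d1" using x(1) by auto
      show ?thesis unfolding x(2) Inl sig_v[OF i] v[OF i] xbar_eq ..
    next
      case (Inr i)
      then have i: "i \<le> d2" using x(1) by auto
      show ?thesis unfolding x(2) Inr sig_v'[OF i] v'[OF i] xbar_eq ..
    qed
    then show ?case using FF_closed(6)[OF x(1)] unfolding x(2) by blast
  next
    case (diff a b)
    then have ab: "a \<in> FF" "b \<in> FF" "AA.Psi (sig a) = cs a" "AA.Psi (sig b) = cs b" by blast+
    have d: "a - b \<in> FF" by (rule FF_closed(3)[OF ab(1,2)])
    interpret HZ: comm_group "AA.H Mod AA.Zs" by (rule comm_HZ)
    have 1: "AA.Psi (sig (a - b) \<otimes>\<^bsub>AA.LL\<^esub> sig b) = AA.Psi (sig (a - b)) \<otimes>\<^bsub>AA.H Mod AA.Zs\<^esub> AA.Psi (sig b)"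
      by (rule hom_mult[OF hom sig_closed sig_closed])
    have 2: "sig (a - b) \<otimes>\<^bsub>AA.LL\<^esub> sig b = sig a"
      unfolding LL_simps sig_add[symmetric] by simp
    have "AA.Psi (sig (a - b)) \<otimes>\<^bsub>AA.H Mod AA.Zs\<^esub> cs b = cs (a - b) \<otimes>\<^bsub>AA.H Mod AA.Zs\<^esub> cs b"
      unfolding cs_mult[OF d ab(2)] diff_add_cancel using 1[unfolded 2 ab] by (rule sym)
    then have "AA.Psi (sig (a - b)) = cs (a - b)"
      using HZ.right_cancel[OF cs_closed[OF ab(2)] hom_in_carrier[OF hom sig_closed] cs_closed[OF d]] by blast
    then show ?case using d by blast
  qed
  then show ?thesis by blast
qed

text \<open>Consequently the vertices of \<open>Q(C)\<close> are the pairs of vertices of the two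
  given quivers.\<close>

lemma B_eq: "AA.B = B1 \<times> B2"
proof -
  have "x \<in> AA.B \<longleftrightarrow> x \<in> B1 \<times> B2" if x: "x \<in> carrier AA.LL" for x
  proof -
    obtain f where f: "f \<in> FF" "sig f = x" by (rule sig_surj[OF x])
    have "x \<in> AA.B \<longleftrightarrow> AA.Psi (sig f) = cs 0"
      unfolding AA.B_def kernel_def one_HZ f(2) using x by blast
    also have "\<dots> \<longleftrightarrow> x \<in> B1 \<times> B2"
      unfolding Psi_sig[OF f(1)] cs_eq_iff[OF f(1) FF_closed(1)] unfolding sig_0 diff_0_right f(2) ..
    finally show ?thesis .
  qed
  moreover have "AA.B \<subseteq> carrier AA.LL" unfolding AA.B_def kernel_def by blast
  moreover have "B1 \<times> B2 \<subseteq> carrier AA.LL" unfolding LL_simps using A1.B(4) A2.B(4) by blast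
  ultimately show ?thesis by blast
qed

text \<open>Two representatives of a class modulo \<open>s\<close> differ, up to \<open>K\<close>,
  by a multiple of \<open>sg\<close>, and \<open>phi\<close> detects this multiple. So only one
  representative has \<open>phi\<close> equal to 0.\<close>

lemma hrep_eq:
  assumes f: "f \<in> FF" and 0: "phi f = 0"
  shows "AA.hrep (sig f) = AA.deg f"
  unfolding AA.hrep_def
proof (rule the_equality)
  show "AA.deg f \<in> AA.J \<and> AA.Zs #>\<^bsub>AA.H\<^esub> AA.deg f = AA.Psi (sig f)"
    unfolding Psi_sig[OF f] J_iff[OF f] using 0 by blast
  fix h assume h: "h \<in> AA.J \<and> AA.Zs #>\<^bsub>AA.H\<^esub> h = AA.Psi (sig f)"
  then have "h \<in> I" unfolding AA.J_def by blast
  then have "h \<in> carrier AA.H" unfolding I_def carrier_H by blast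
  then obtain g where g: "g \<in> FF" "h = AA.deg g" unfolding carrier_H by blast
  have phi: "phi g = 0" using h g J_iff by blast
  have "cs g = cs f" using h unfolding g Psi_sig[OF f] by blast
  then have "sig (g - f) \<in> B1 \<times> B2" unfolding cs_eq_iff[OF g(1) f] sig_diff .
  then obtain c where c: "g - f - frag_cmul c sg \<in> AA.K"
    unfolding sig_in_B_iff[OF FF_closed(3)[OF g(1) f]] by blast
  then have "phi ((g - f - frag_cmul c sg) + (f + frag_cmul c sg)) = phi (f + frag_cmul c sg)" by (rule phi_add_K)
  moreover have "(g - f - frag_cmul c sg) + (f + frag_cmul c sg) = g" by (simp del: minus_frag_cmul)
  ultimately have "c = 0" using phi 0 by (simp only: phi_add_sg)
  then have "g - f \<in> AA.K" using c by simp
  then show "h = AA.deg f" unfolding g deg_eq_iff .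
qed

text \<open>\<open>sg\<close> changes \<open>phi\<close> but not the image under \<open>sig\<close>,
  since the roots sum to 0.\<close>

lemma sig_phi_surj:
  assumes "x \<in> carrier AA.LL"
  obtains f where "f \<in> FF" "sig f = x" "phi f = 0"
proof -
  obtain g where g: "g \<in> FF" "sig g = x" by (rule sig_surj[OF assms])
  define f where "f = g + frag_cmul (- phi g) sg"
  have 1: "f \<in> FF" unfolding f_def by (intro FF_closed g el_in_FF)
  have 2: "phi f = 0" unfolding f_def phi_add_sg by simp
  have 3: "sig f = x"
    unfolding f_def g(2)[symmetric] sig_def L_add_sg R_add_sg alpha_comb_add alpha_comb_zmul alpha_comb_one zmul_zero add_0_right ..
  show thesis by (rule that[OF 1 3 2])
qed

text \<open>Passing along \<open>Lft i\<close> adds the weight of the left arrow to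
  \<open>phi\<close>, so the representative leaves \<open>J\<close> exactly when that arrow lies in
  \<open>C1\<close>.\<close>

lemma C_hat_Lft:
  "(x, Lft i) \<in> AA.C_hat \<longleftrightarrow> x \<in> carrier AA.LL \<and> i \<le> d1 \<and> (B1 #>\<^bsub>root_group d1\<^esub> fst x, i) \<in> C1"
proof -
  have "AA.hrep x \<otimes>\<^bsub>AA.H\<^esub> AA.xbar i \<notin> AA.J \<longleftrightarrow> (B1 #>\<^bsub>root_group d1\<^esub> fst x, i) \<in> C1"
    if x: "x \<in> carrier AA.LL" and i: "i \<le> d1"
  proof -
    obtain f where f: "f \<in> FF" "sig f = x" "phi f = 0" by (rule sig_phi_surj[OF x])
    have e: "frag_of (v i) \<in> FF" using i by (intro FF_closed) auto
    have "AA.hrep x \<otimes>\<^bsub>AA.H\<^esub> AA.xbar i = AA.deg (f + frag_of (v i))"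
      unfolding f(2)[symmetric] hrep_eq[OF f(1,3)] xbar_eq deg_mult[OF f(1) e] ..
    then have "AA.hrep x \<otimes>\<^bsub>AA.H\<^esub> AA.xbar i \<notin> AA.J \<longleftrightarrow> phi (f + frag_of (v i)) \<noteq> 0"
      using J_iff[OF FF_closed(2)[OF f(1) e]] by (simp only:)
    also have "phi (f + frag_of (v i)) = A1.weight (L f) i"
      using f(3) unfolding phi_def L_add R_add L_v[OF i] R_v[OF i] A1.theta_step[OF i] add_0_right by linarith
    also have "A1.weight (L f) i \<noteq> 0 \<longleftrightarrow> (B1 #>\<^bsub>root_group d1\<^esub> fst x, i) \<in> C1"
      unfolding A1.weight_def f(2)[symmetric] sig_def fst_conv by simp
    finally show ?thesis .
  qed
  then show ?thesis unfolding AA.C_hat_def by blast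
qed

text \<open>On the right the weight enters \<open>phi\<close> with a minus sign; membership in
  \<open>J\<close> only asks whether it vanishes.\<close>

lemma C_hat_Rgt:
  "(x, Rgt i) \<in> AA.C_hat \<longleftrightarrow> x \<in> carrier AA.LL \<and> i \<le> d2 \<and> (B2 #>\<^bsub>root_group d2\<^esub> snd x, i) \<in> C2"
proof -
  have "AA.hrep x \<otimes>\<^bsub>AA.H\<^esub> AA.xbar' i \<notin> AA.J \<longleftrightarrow> (B2 #>\<^bsub>root_group d2\<^esub> snd x, i) \<in> C2"
    if x: "x \<in> carrier AA.LL" and i: "i \<le> d2"
  proof -
    obtain f where f: "f \<in> FF" "sig f = x" "phi f = 0" by (rule sig_phi_surj[OF x])
    have e: "frag_of (v' i) \<in> FF" using i by (intro FF_closed) auto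
    have "AA.hrep x \<otimes>\<^bsub>AA.H\<^esub> AA.xbar' i = AA.deg (f + frag_of (v' i))"
      unfolding f(2)[symmetric] hrep_eq[OF f(1,3)] xbar_eq deg_mult[OF f(1) e] ..
    then have "AA.hrep x \<otimes>\<^bsub>AA.H\<^esub> AA.xbar' i \<notin> AA.J \<longleftrightarrow> phi (f + frag_of (v' i)) \<noteq> 0"
      using J_iff[OF FF_closed(2)[OF f(1) e]] by (simp only:)
    also have "phi (f + frag_of (v' i)) = - A2.weight (R f) i"
      using f(3) unfolding phi_def L_add R_add L_v'[OF i] R_v'[OF i] A2.theta_step[OF i] add_0_right by linarith
    also have "- A2.weight (R f) i \<noteq> 0 \<longleftrightarrow> (B2 #>\<^bsub>root_group d2\<^esub> snd x, i) \<in> C2"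
      unfolding A2.weight_def f(2)[symmetric] sig_def snd_conv by simp
    finally show ?thesis .
  qed
  then show ?thesis unfolding AA.C_hat_def by blast
qed

end

subsection \<open>Paths of the quiver\<close>

fun left_types :: "arrow \<Rightarrow> nat list" where
  "left_types (Lft i) = [i]"
| "left_types (Rgt j) = []"
| "left_types (New i j) = [i]"

fun right_types :: "arrow \<Rightarrow> nat list" where
  "right_types (Lft i) = []"
| "right_types (Rgt j) = [j]"
| "right_types (New i j) = [j]"

fun is_new :: "arrow \<Rightarrow> bool" where
  "is_new (New i j) = True"
| "is_new _ = False"

text \<open>The projections of a path to the two factors, as words of types; a new arrow contributes
  to both.\<close>

definition typesL :: "('z \<times> arrow) list \<Rightarrow> nat list" where
  "typesL p = concat (map (\<lambda>a. left_types (snd a)) p)"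
definition typesR :: "('z \<times> arrow) list \<Rightarrow> nat list" where
  "typesR p = concat (map (\<lambda>a. right_types (snd a)) p)"
definition new_count :: "('z \<times> arrow) list \<Rightarrow> nat" where
  "new_count p = length (filter (\<lambda>a. is_new (snd a)) p)"

lemma types_simps [simp]:
  "typesL [] = []" "typesR [] = []" "new_count [] = 0"
  "typesL ((z, a) # p) = left_types a @ typesL p" "typesR ((z, a) # p) = right_types a @ typesR p"
  "new_count ((z, a) # p) = (if is_new a then 1 else 0) + new_count p"
  by (simp_all add: typesL_def typesR_def new_count_def)

lemma types_append: "typesL (p @ q) = typesL p @ typesL q" "typesR (p @ q) = typesR p @ typesR q"
  by (simp_all add: typesL_def typesR_def)

lemma types_Nil_iff: "typesL p = [] \<and> typesR p = [] \<longleftrightarrow> p = []"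
proof (cases p)
  case (Cons e q)
  then show ?thesis by (cases e; cases "snd e") simp_all
qed simp

lemma cnt_eq_0_iff: "cnt p = 0 \<longleftrightarrow> p = []"
  using cnt_eq_iff[of p "[]"] by (simp only: cnt_Nil mset.simps(1) mset_zero_iff)

context AA_datum
begin

lemma coset_prod: "(Z1 \<times> Z2) #>\<^bsub>AA.LL\<^esub> y = (Z1 #>\<^bsub>root_group d1\<^esub> fst y) \<times> (Z2 #>\<^bsub>root_group d2\<^esub> snd y)"
  unfolding AA.LL_def r_coset_add_group
proof (rule equalityI; rule subsetI)
  fix z assume "z \<in> (\<lambda>z. z + y) ` (Z1 \<times> Z2)"
  then show "z \<in> ((\<lambda>z. z + fst y) ` Z1) \<times> ((\<lambda>z. z + snd y) ` Z2)"
  proof (elim imageE)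
    fix w assume w: "z = w + y" "w \<in> Z1 \<times> Z2"
    have "fst z = fst w + fst y" "snd z = snd w + snd y" unfolding w by (rule fst_add snd_add)+
    then show ?thesis using w(2) unfolding mem_Times_iff by blast
  qed
next
  fix z assume "z \<in> ((\<lambda>z. z + fst y) ` Z1) \<times> ((\<lambda>z. z + snd y) ` Z2)"
  then obtain a b where ab: "a \<in> Z1" "b \<in> Z2" "fst z = a + fst y" "snd z = b + snd y"
    unfolding mem_Times_iff by blast
  have "z = (a, b) + y" by (rule prod_eqI) (simp_all only: fst_add snd_add fst_conv snd_conv ab)
  then show "z \<in> (\<lambda>z. z + y) ` (Z1 \<times> Z2)" using ab(1,2) by blast
qed

fun valid_arrow :: "(nat \<Rightarrow> int) set \<Rightarrow> (nat \<Rightarrow> int) set \<Rightarrow> arrow \<Rightarrow> bool" where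
  "valid_arrow Z1 Z2 (Lft i) \<longleftrightarrow> i \<le> d1 \<and> (Z1, i) \<notin> C1"
| "valid_arrow Z1 Z2 (Rgt j) \<longleftrightarrow> j \<le> d2 \<and> (Z2, j) \<notin> C2"
| "valid_arrow Z1 Z2 (New i j) \<longleftrightarrow> i \<le> d1 \<and> j \<le> d2 \<and> (Z1, i) \<in> C1 \<and> (Z2, j) \<in> C2"

lemma arcs_hat_iff:
  "(x, a) \<in> arcs AA.QC_hat \<longleftrightarrow> x \<in> carrier AA.LL \<and>
     valid_arrow (B1 #>\<^bsub>root_group d1\<^esub> fst x) (B2 #>\<^bsub>root_group d2\<^esub> snd x) a"
  by (cases x; cases a) (auto simp: AA.QC_hat_def AA.arcs_hat_def C_hat_Lft C_hat_Rgt)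

lemma QC_hat_simps: "verts AA.QC_hat = carrier AA.LL" "tail AA.QC_hat = fst"
  "head AA.QC_hat (x, a) = x + AA.disp a"
  by (simp_all add: AA.QC_hat_def)

lemma QC_simps: "verts AA.QC = rcosets\<^bsub>AA.LL\<^esub> AA.B" "tail AA.QC = fst"
  "head AA.QC (Z, a) = Z #>\<^bsub>AA.LL\<^esub> AA.disp a" "arcs AA.QC = AA.proj_arrow ` arcs AA.QC_hat"
  by (simp_all add: AA.QC_def)

lemma coset_LL: "AA.B #>\<^bsub>AA.LL\<^esub> x = (B1 #>\<^bsub>root_group d1\<^esub> fst x) \<times> (B2 #>\<^bsub>root_group d2\<^esub> snd x)"
  unfolding B_eq by (rule coset_prod)

lemma disp_eq:
  "valid_arrow Z1 Z2 a \<Longrightarrow> AA.disp a = (alpha_comb d1 (cnt (left_types a)), alpha_comb d2 (cnt (right_types a)))"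
  by (cases a) (simp_all only: AA.disp.simps valid_arrow.simps left_types.simps right_types.simps cnt_Cons cnt_Nil
      add_0_right alpha_comb_unit_vec[OF A1.d] alpha_comb_unit_vec[OF A2.d] alpha_comb_0)

lemma types_bound:
  "valid_arrow Z1 Z2 a \<Longrightarrow> set (left_types a) \<subseteq> {..d1} \<and> set (right_types a) \<subseteq> {..d2}"
  by (cases a) auto

lemma disp_closed: "valid_arrow Z1 Z2 a \<Longrightarrow> AA.disp a \<in> carrier AA.LL"
  unfolding disp_eq LL_simps by simp

lemma LL_add: "x \<in> carrier AA.LL \<Longrightarrow> y \<in> carrier AA.LL \<Longrightarrow> x + y \<in> carrier AA.LL"
  unfolding LL_simps mem_Times_iff fst_add snd_add using root_lattice_closed(3) by blast

lemma wf_QC_hat: "wf_digraph AA.QC_hat"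
proof
  fix e assume e: "e \<in> arcs AA.QC_hat"
  obtain x a where xa: "e = (x, a)" by (cases e)
  have *: "x \<in> carrier AA.LL" "valid_arrow (B1 #>\<^bsub>root_group d1\<^esub> fst x) (B2 #>\<^bsub>root_group d2\<^esub> snd x) a"
    using e unfolding xa arcs_hat_iff by blast+
  show "tail AA.QC_hat e \<in> verts AA.QC_hat" unfolding xa QC_hat_simps using * by simp
  show "head AA.QC_hat e \<in> verts AA.QC_hat"
    unfolding xa QC_hat_simps by (rule LL_add[OF *(1) disp_closed[OF *(2)]])
qed

lemma vertsE:
  assumes "Z \<in> verts AA.QC"
  obtains f g where "Z = A1.coset f \<times> A2.coset g"
proof -
  obtain x where x: "x \<in> carrier AA.LL" "Z = AA.B #>\<^bsub>AA.LL\<^esub> x"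
    using assms unfolding QC_simps RCOSETS_def by blast
  obtain h where h: "sig h = x" by (rule sig_surj[OF x(1)])
  have "Z = A1.coset (L h) \<times> A2.coset (R h)"
    unfolding x(2) coset_LL h[symmetric] sig_def fst_conv snd_conv ..
  then show thesis by (rule that)
qed

lemma verts_coset: "A1.coset f \<times> A2.coset g \<in> verts AA.QC"
proof -
  have "A1.coset f \<times> A2.coset g = AA.B #>\<^bsub>AA.LL\<^esub> (alpha_comb d1 f, alpha_comb d2 g)"
    unfolding coset_LL fst_conv snd_conv ..
  moreover have "(alpha_comb d1 f, alpha_comb d2 g) \<in> carrier AA.LL" unfolding LL_simps by simp
  ultimately show ?thesis unfolding QC_simps RCOSETS_def by blast
qed

lemma coset_nonempty: "A1.coset f \<noteq> {}" "A2.coset g \<noteq> {}"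
  unfolding r_coset_add_group using A1.B(1) A2.B(1) by blast+

lemma prod_coset_eq_iff:
  "A1.coset f \<times> A2.coset g = A1.coset f' \<times> A2.coset g' \<longleftrightarrow> A1.coset f = A1.coset f' \<and> A2.coset g = A2.coset g'"
  by (simp only: times_eq_iff coset_nonempty simp_thms)

lemma arcs_QC_D:
  assumes "(Z, a) \<in> arcs AA.QC"
  shows "\<exists>x. (x, a) \<in> arcs AA.QC_hat \<and> Z = AA.B #>\<^bsub>AA.LL\<^esub> x"
proof -
  obtain e where e: "e \<in> arcs AA.QC_hat" "(Z, a) = AA.proj_arrow e"
    using assms unfolding QC_simps(4) by blast
  obtain x b where x: "e = (x, b)" by (cases e)
  have "Z = AA.B #>\<^bsub>AA.LL\<^esub> x" "a = b" using e(2) unfolding x AA.proj_arrow_def by simp_all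
  then show ?thesis using e(1) unfolding x by blast
qed

lemma arcs_iff:
  "(A1.coset f \<times> A2.coset g, a) \<in> arcs AA.QC \<longleftrightarrow> valid_arrow (A1.coset f) (A2.coset g) a"
proof
  assume "(A1.coset f \<times> A2.coset g, a) \<in> arcs AA.QC"
  then obtain x where x: "(x, a) \<in> arcs AA.QC_hat" "A1.coset f \<times> A2.coset g = AA.B #>\<^bsub>AA.LL\<^esub> x"
    using arcs_QC_D by blast
  have xc: "x \<in> carrier AA.LL" using x(1) unfolding arcs_hat_iff by blast
  obtain h where h: "sig h = x" by (rule sig_surj[OF xc])
  have "A1.coset f \<times> A2.coset g = A1.coset (L h) \<times> A2.coset (R h)"
    using x(2) unfolding coset_LL h[symmetric] sig_def fst_conv snd_conv .
  then show "valid_arrow (A1.coset f) (A2.coset g) a"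
    using x(1) unfolding prod_coset_eq_iff arcs_hat_iff h[symmetric] sig_def fst_conv snd_conv by simp
next
  assume a: "valid_arrow (A1.coset f) (A2.coset g) a"
  let ?x = "(alpha_comb d1 f, alpha_comb d2 g)"
  have "(?x, a) \<in> arcs AA.QC_hat" unfolding arcs_hat_iff LL_simps using a by simp
  then have "AA.proj_arrow (?x, a) \<in> arcs AA.QC" unfolding QC_simps by (rule imageI)
  then show "(A1.coset f \<times> A2.coset g, a) \<in> arcs AA.QC"
    unfolding AA.proj_arrow_def prod.case coset_LL fst_conv snd_conv .
qed

lemma arcs_tail: "(Z, a) \<in> arcs AA.QC \<Longrightarrow> Z \<in> verts AA.QC"
proof -
  assume "(Z, a) \<in> arcs AA.QC"
  then obtain x where "(x, a) \<in> arcs AA.QC_hat" "Z = AA.B #>\<^bsub>AA.LL\<^esub> x"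
    using arcs_QC_D by blast
  then have "x \<in> carrier AA.LL" "Z = AA.B #>\<^bsub>AA.LL\<^esub> x" unfolding arcs_hat_iff by blast+
  then show "Z \<in> verts AA.QC" unfolding QC_simps(1) RCOSETS_def by blast
qed

lemma head_coset:
  assumes "valid_arrow Z1 Z2 a"
  shows "head AA.QC (A1.coset f \<times> A2.coset g, a)
    = A1.coset (f + cnt (left_types a)) \<times> A2.coset (g + cnt (right_types a))"
  unfolding QC_simps coset_prod disp_eq[OF assms] fst_conv snd_conv A1.coset_shift A2.coset_shift ..

lemma wf_QC: "wf_digraph AA.QC"
proof
  fix e assume e: "e \<in> arcs AA.QC"
  obtain Z a where xa: "e = (Z, a)" by (cases e)
  have Z: "Z \<in> verts AA.QC" using e unfolding xa by (rule arcs_tail)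
  then show "tail AA.QC e \<in> verts AA.QC" unfolding xa QC_simps by simp
  obtain f g where fg: "Z = A1.coset f \<times> A2.coset g" using Z by (rule vertsE)
  have v: "valid_arrow (A1.coset f) (A2.coset g) a" using e unfolding xa fg arcs_iff .
  show "head AA.QC e \<in> verts AA.QC" unfolding xa fg head_coset[OF v] by (rule verts_coset)
qed

sublocale Qh: wf_digraph AA.QC_hat by (rule wf_QC_hat)
sublocale Q: wf_digraph AA.QC by (rule wf_QC)

lemma finite_verts: "finite (verts AA.QC)"
proof (rule finite_subset)
  show "verts AA.QC \<subseteq> (\<lambda>(Z1, Z2). Z1 \<times> Z2) ` (A1.vs \<times> A2.vs)"
  proof
    fix Z assume "Z \<in> verts AA.QC"
    then obtain f g where "Z = A1.coset f \<times> A2.coset g" by (rule vertsE)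
    then show "Z \<in> (\<lambda>(Z1, Z2). Z1 \<times> Z2) ` (A1.vs \<times> A2.vs)"
      using A1.coset_in_vs A2.coset_in_vs by (intro image_eqI[of _ _ "(A1.coset f, A2.coset g)"]) auto
  qed
  show "finite ((\<lambda>(Z1, Z2). Z1 \<times> Z2) ` (A1.vs \<times> A2.vs))"
    using A1.finite_vs A2.finite_vs by blast
qed

lemma theta_arrow:
  assumes "valid_arrow (A1.coset f) (A2.coset g) a"
  shows "A1.theta (f + cnt (left_types a)) = A1.theta f + (if is_new a then 1 else 0)"
    "A2.theta (g + cnt (right_types a)) = A2.theta g + (if is_new a then 1 else 0)"
  using assms
  by (cases a; simp only: left_types.simps right_types.simps is_new.simps cnt_Cons cnt_Nil add_0_right
      valid_arrow.simps A1.theta_step A2.theta_step A1.weight_def A2.weight_def if_True if_False)+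

text \<open>Both potentials grow in step, by 1 at each new arrow and by 0 at every other arrow. So,
  for a given start, the number of new arrows depends only on the exponent vectors.\<close>

lemma QC_path:
  assumes "is_path AA.QC (A1.coset f \<times> A2.coset g) p Y"
  shows "set (typesL p) \<subseteq> {..d1} \<and> set (typesR p) \<subseteq> {..d2} \<and>
    Y = A1.coset (f + cnt (typesL p)) \<times> A2.coset (g + cnt (typesR p)) \<and>
    A1.theta (f + cnt (typesL p)) = A1.theta f + int (new_count p) \<and>
    A2.theta (g + cnt (typesR p)) = A2.theta g + int (new_count p)"
  using assms
proof (induction p arbitrary: f g)
  case Nil
  then show ?case unfolding Q.is_path_Nil types_simps cnt_Nil add_0_right by simp
next
  case (Cons e p)
  obtain Z a where e: "e = (Z, a)" by (cases e)
  have Z: "Z = A1.coset f \<times> A2.coset g" and a: "(A1.coset f \<times> A2.coset g, a) \<in> arcs AA.QC"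
    and p: "is_path AA.QC (head AA.QC (A1.coset f \<times> A2.coset g, a)) p Y"
    using Cons.prems unfolding e Q.is_path_Cons QC_simps(2) fst_conv by blast+
  have v: "valid_arrow (A1.coset f) (A2.coset g) a" using a unfolding arcs_iff .
  let ?f = "f + cnt (left_types a)" and ?g = "g + cnt (right_types a)"
  have IH: "set (typesL p) \<subseteq> {..d1} \<and> set (typesR p) \<subseteq> {..d2} \<and>
    Y = A1.coset (?f + cnt (typesL p)) \<times> A2.coset (?g + cnt (typesR p)) \<and>
    A1.theta (?f + cnt (typesL p)) = A1.theta ?f + int (new_count p) \<and>
    A2.theta (?g + cnt (typesR p)) = A2.theta ?g + int (new_count p)"
    by (rule Cons.IH) (use p in \<open>unfold head_coset[OF v]\<close>)
  have eq: "f + cnt (typesL (e # p)) = ?f + cnt (typesL p)" "g + cnt (typesR (e # p)) = ?g + cnt (typesR p)"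
    by (simp_all only: e types_simps cnt_append add.assoc)
  have nc: "int (new_count (e # p)) = (if is_new a then 1 else 0) + int (new_count p)"
    unfolding e types_simps by simp
  have s: "set (typesL (e # p)) \<subseteq> {..d1}" "set (typesR (e # p)) \<subseteq> {..d2}"
    using IH types_bound[OF v] unfolding e types_simps set_append by blast+
  show ?case
    unfolding eq nc using IH s theta_arrow[OF v] by linarith
qed

lemma path_label_props:
  "set (typesL p) \<subseteq> {..d1} \<Longrightarrow> set (typesR p) \<subseteq> {..d2} \<Longrightarrow>
   AA.path_label p = el (cnt (typesL p)) (cnt (typesR p)) \<and> restr d1 (cnt (typesL p)) = cnt (typesL p)
    \<and> restr d2 (cnt (typesR p)) = cnt (typesR p)"
proof (induction p)
  case Nil
  have "el 0 0 = 0" by (rule F_eqI) (simp_all only: el_in_FF FF_closed L_el R_el restr_0 L_0 R_0)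
  then show ?case unfolding AA.path_label_def by (simp only: types_simps cnt_Nil restr_0 list.map sum_list.Nil simp_thms)
next
  case (Cons e p)
  obtain Z a where e: "e = (Z, a)" by (cases e)
  have s: "set (left_types a) \<subseteq> {..d1}" "set (right_types a) \<subseteq> {..d2}"
    "set (typesL p) \<subseteq> {..d1}" "set (typesR p) \<subseteq> {..d2}"
    using Cons.prems unfolding e types_simps set_append by blast+
  note IH = Cons.IH[OF s(3,4)]
  have a: "AA.label a \<in> FF \<and> L (AA.label a) = cnt (left_types a) \<and> R (AA.label a) = cnt (right_types a)"
  proof (cases a)
    case (Lft i)
    have i: "i \<le> d1" using s(1) Lft by simp
    show ?thesis
      unfolding Lft AA.label.simps left_types.simps right_types.simps cnt_Cons cnt_Nil add_0_right L_v[OF i] R_v[OF i]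
      using FF_closed(6)[of "Inl i"] i mem_X by blast
  next
    case (Rgt j)
    have j: "j \<le> d2" using s(2) Rgt by simp
    show ?thesis
      unfolding Rgt AA.label.simps left_types.simps right_types.simps cnt_Cons cnt_Nil add_0_right L_v'[OF j] R_v'[OF j]
      using FF_closed(6)[of "Inr j"] j mem_X by blast
  next
    case (New i j)
    have i: "i \<le> d1" and j: "j \<le> d2" using s(1,2) New by simp_all
    show ?thesis
      unfolding New AA.label.simps left_types.simps right_types.simps cnt_Cons cnt_Nil add_0_right add_0_left
        L_add R_add L_v[OF i] R_v[OF i] L_v'[OF j] R_v'[OF j]
      using FF_closed(2)[OF FF_closed(6)[of "Inl i"] FF_closed(6)[of "Inr j"]] i j mem_X by blast
  qed
  have lab: "AA.path_label (e # p) = AA.label a + AA.path_label p"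
    unfolding AA.path_label_def e by simp
  have r: "restr d1 (cnt (left_types a)) = cnt (left_types a)" "restr d2 (cnt (right_types a)) = cnt (right_types a)"
    using a restr_L[of "AA.label a"] restr_R[of "AA.label a"] by (simp_all only:)
  have R: "restr d1 (cnt (typesL (e # p))) = cnt (typesL (e # p))" "restr d2 (cnt (typesR (e # p))) = cnt (typesR (e # p))"
    using IH by (simp_all only: e types_simps cnt_append restr_add r)
  have "AA.path_label (e # p) = el (cnt (typesL (e # p))) (cnt (typesR (e # p)))"
  proof (rule F_eqI)
    show "AA.path_label (e # p) \<in> FF"
      unfolding lab using a IH el_in_FF FF_closed(2) by metis
    show "L (AA.path_label (e # p)) = L (el (cnt (typesL (e # p))) (cnt (typesR (e # p))))"
      unfolding lab L_add L_el R using a IH by (simp only: L_el e types_simps cnt_append)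
    show "R (AA.path_label (e # p)) = R (el (cnt (typesL (e # p))) (cnt (typesR (e # p))))"
      unfolding lab R_add R_el R using a IH by (simp only: R_el e types_simps cnt_append)
  qed (rule el_in_FF)
  then show ?case using R by blast
qed

lemma hat_path:
  assumes "is_path AA.QC_hat x p y"
  shows "y = x + (alpha_comb d1 (cnt (typesL p)), alpha_comb d2 (cnt (typesR p))) \<and>
    is_path AA.QC (AA.B #>\<^bsub>AA.LL\<^esub> x) (map AA.proj_arrow p) (AA.B #>\<^bsub>AA.LL\<^esub> y)"
  using assms
proof (induction p arbitrary: x)
  case Nil
  then have xy: "x \<in> carrier AA.LL" "x = y" unfolding Qh.is_path_Nil QC_hat_simps by blast+
  have "AA.B #>\<^bsub>AA.LL\<^esub> x \<in> verts AA.QC" unfolding QC_simps RCOSETS_def using xy(1) by blast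
  then show ?case
    unfolding types_simps cnt_Nil alpha_comb_0 zero_prod_def[symmetric] add_0_right list.map Q.is_path_Nil
    using xy(2) by blast
next
  case (Cons e p)
  obtain z a where e: "e = (z, a)" by (cases e)
  have z: "z = x" and a: "(x, a) \<in> arcs AA.QC_hat" and p: "is_path AA.QC_hat (x + AA.disp a) p y"
    using Cons.prems unfolding e Qh.is_path_Cons QC_hat_simps fst_conv by blast+
  have v: "valid_arrow (B1 #>\<^bsub>root_group d1\<^esub> fst x) (B2 #>\<^bsub>root_group d2\<^esub> snd x) a"
    using a unfolding arcs_hat_iff by blast
  note IH = Cons.IH[OF p]
  have 1: "x + AA.disp a + (alpha_comb d1 (cnt (typesL p)), alpha_comb d2 (cnt (typesR p)))
      = x + (alpha_comb d1 (cnt (typesL (e # p))), alpha_comb d2 (cnt (typesR (e # p))))"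
    unfolding disp_eq[OF v] e types_simps cnt_append alpha_comb_add add.assoc add_Pair ..
  have pe: "AA.proj_arrow e = (AA.B #>\<^bsub>AA.LL\<^esub> x, a)" unfolding e z AA.proj_arrow_def prod.case ..
  have 2: "AA.proj_arrow e \<in> arcs AA.QC" unfolding QC_simps e z using a by (rule imageI)
  have 3: "AA.B #>\<^bsub>AA.LL\<^esub> (x + AA.disp a) = head AA.QC (AA.B #>\<^bsub>AA.LL\<^esub> x, a)"
    unfolding QC_simps AA.LL_def r_coset_r_coset ..
  have "is_path AA.QC (AA.B #>\<^bsub>AA.LL\<^esub> x) (map AA.proj_arrow (e # p)) (AA.B #>\<^bsub>AA.LL\<^esub> y)"
    using IH 2 unfolding list.map pe Q.is_path_Cons QC_simps(2) fst_conv 3 by blast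
  then show ?case using IH unfolding 1 by blast
qed

lemma A1_total_weight_nonneg: "A1.total_weight f p \<ge> 0"
  by (induction p arbitrary: f) (simp_all add: A1.weight_def)
lemma A2_total_weight_nonneg: "A2.total_weight f p \<ge> 0"
  by (induction p arbitrary: f) (simp_all add: A2.weight_def)

text \<open>Arrows outside the cuts are traversed one at a time, cut arrows simultaneously as a new arrow.\<close>

lemma hat_path_exists:
  assumes "set p \<subseteq> {..d1}" "set q \<subseteq> {..d2}" "A1.total_weight f p = A2.total_weight g q"
  shows "\<exists>r y. is_path AA.QC_hat (alpha_comb d1 f, alpha_comb d2 g) r y \<and> typesL r = p \<and> typesR r = q"
  using assms
proof (induction "length p + length q" arbitrary: p q f g rule: less_induct)
  case less
  let ?x = "(alpha_comb d1 f, alpha_comb d2 g)"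
  have step: ?case
    if v: "valid_arrow (A1.coset f) (A2.coset g) a" and pq: "p = left_types a @ p'" "q = right_types a @ q'"
      and w: "A1.total_weight (f + cnt (left_types a)) p' = A2.total_weight (g + cnt (right_types a)) q'" for a p' q'
  proof -
    have len: "length p' + length q' < length p + length q" unfolding pq by (cases a) simp_all
    have s: "set p' \<subseteq> {..d1}" "set q' \<subseteq> {..d2}" using less.prems(1,2) unfolding pq by simp_all
    obtain r y where r: "is_path AA.QC_hat (alpha_comb d1 (f + cnt (left_types a)), alpha_comb d2 (g + cnt (right_types a))) r y"
      "typesL r = p'" "typesR r = q'"
      using less.hyps[OF len s w] by blast
    have "(?x, a) \<in> arcs AA.QC_hat" unfolding arcs_hat_iff LL_simps using v by simp
    moreover have "head AA.QC_hat (?x, a) = (alpha_comb d1 (f + cnt (left_types a)), alpha_comb d2 (g + cnt (right_types a)))"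
      unfolding QC_hat_simps disp_eq[OF v] add_Pair alpha_comb_add ..
    ultimately have "is_path AA.QC_hat ?x ((?x, a) # r) y"
      unfolding Qh.is_path_Cons QC_hat_simps(2) fst_conv using r(1) by simp
    moreover have "typesL ((?x, a) # r) = p" "typesR ((?x, a) # r) = q" unfolding types_simps r(2,3) pq by (rule refl)+
    ultimately show ?thesis by blast
  qed
  \<comment> \<open>If one word starts with a cut arrow and the other word is empty, the total
    weights differ, because weights are nonnegative. So the cases \<open>left1\<close> and
    \<open>right1\<close> are contradictory.\<close>
  consider (nil) "p = []" "q = []"
    | (left) i p' where "p = i # p'" "A1.weight f i = 0"
    | (right) j q' where "q = j # q'" "A2.weight g j = 0"
    | (left1) i p' where "p = i # p'" "A1.weight f i = 1" "q = []"
    | (right1) j q' where "q = j # q'" "A2.weight g j = 1" "p = []"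
    | (both) i p' j q' where "p = i # p'" "A1.weight f i = 1" "q = j # q'" "A2.weight g j = 1"
    unfolding A1.weight_def A2.weight_def by (cases p; cases q) (simp, metis+)
  then show ?case
  proof cases
    case nil
    have "is_path AA.QC_hat ?x [] ?x" unfolding Qh.is_path_Nil QC_hat_simps LL_simps by simp
    then show ?thesis unfolding nil using types_simps(1,2) by blast
  next
    case left
    show ?thesis
    proof (rule step[of "Lft i" p' q])
      show "valid_arrow (A1.coset f) (A2.coset g) (Lft i)"
        using less.prems(1) left unfolding A1.weight_def by (auto split: if_splits)
      show "A1.total_weight (f + cnt (left_types (Lft i))) p' = A2.total_weight (g + cnt (right_types (Lft i))) q"
        using less.prems(3) left(2)
        unfolding left(1) A1.total_weight.simps left_types.simps right_types.simps cnt_Cons cnt_Nil add_0_right by linarith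
    qed (simp_all add: left)
  next
    case right
    show ?thesis
    proof (rule step[of "Rgt j" p q'])
      show "valid_arrow (A1.coset f) (A2.coset g) (Rgt j)"
        using less.prems(2) right unfolding A2.weight_def by (auto split: if_splits)
      show "A1.total_weight (f + cnt (left_types (Rgt j))) p = A2.total_weight (g + cnt (right_types (Rgt j))) q'"
        using less.prems(3) right(2)
        unfolding right(1) A2.total_weight.simps left_types.simps right_types.simps cnt_Cons cnt_Nil add_0_right by linarith
    qed (simp_all add: right)
  next
    case left1
    then show ?thesis
      using less.prems(3) A1_total_weight_nonneg[of "f + unit_vec i" p']
      unfolding left1 A1.total_weight.simps A2.total_weight.simps by linarith
  next
    case right1
    then show ?thesis
      using less.prems(3) A2_total_weight_nonneg[of "g + unit_vec j" q']
      unfolding right1 A1.total_weight.simps A2.total_weight.simps by linarith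
  next
    case both
    show ?thesis
    proof (rule step[of "New i j" p' q'])
      show "valid_arrow (A1.coset f) (A2.coset g) (New i j)"
        using less.prems(1,2) both unfolding A1.weight_def A2.weight_def by (auto split: if_splits)
      show "A1.total_weight (f + cnt (left_types (New i j))) p' = A2.total_weight (g + cnt (right_types (New i j))) q'"
        using less.prems(3) both(2,4)
        unfolding both(1,3) A1.total_weight.simps A2.total_weight.simps left_types.simps right_types.simps cnt_Cons cnt_Nil add_0_right
        by linarith
    qed (simp_all add: both)
  qed
qed

end

subsection \<open>The cut and its type\<close>

lemma types_map_proj:
  "typesL (map (\<lambda>(x, a). (F x, a)) p) = typesL p" "typesR (map (\<lambda>(x, a). (F x, a)) p) = typesR p"
  by (induction p) auto

context AA_datum
begin

definition CC :: "(pt set \<times> arrow) set" where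
  "CC = {(Z, a). (Z, a) \<in> arcs AA.QC \<and> is_new a}"

lemma eps_CC: "set p \<subseteq> arcs AA.QC \<Longrightarrow> eps CC p = new_count p"
proof (induction p)
  case (Cons e p)
  obtain Z a where e: "e = (Z, a)" by (cases e)
  have "(Z, a) \<in> CC \<longleftrightarrow> is_new a" using Cons.prems unfolding e CC_def by simp
  then show ?case using Cons unfolding e eps_Cons types_simps by simp
qed simp

lemma path_arcs: "is_path AA.QC Z p Y \<Longrightarrow> set p \<subseteq> arcs AA.QC"
  unfolding is_path_def pre_digraph.awalk_def by blast

lemma path_label_QC:
  assumes "is_path AA.QC (A1.coset f \<times> A2.coset g) p Y"
  shows "AA.path_label p \<in> FF" "L (AA.path_label p) = cnt (typesL p)" "R (AA.path_label p) = cnt (typesR p)"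
proof -
  have "set (typesL p) \<subseteq> {..d1}" "set (typesR p) \<subseteq> {..d2}" using QC_path[OF assms] by blast+
  note * = path_label_props[OF this]
  show "AA.path_label p \<in> FF" using * el_in_FF by metis
  show "L (AA.path_label p) = cnt (typesL p)" "R (AA.path_label p) = cnt (typesR p)"
    using * by (simp_all only: L_el R_el)
qed

lemma path_vertsE:
  assumes "is_path AA.QC Z p Y"
  obtains f g where "Z = A1.coset f \<times> A2.coset g" "is_path AA.QC (A1.coset f \<times> A2.coset g) p Y"
proof -
  obtain f g where "Z = A1.coset f \<times> A2.coset g" by (rule vertsE[OF Q.is_path_verts(1)[OF assms]])
  then show thesis using that assms by blast
qed

text \<open>An elementary cycle projects to all ones on the left, which raises the potential by 1,
  so it contains one new arrow. For paths with the same source, equal labels mean equal growth of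
  the potential, which is condition (ii).\<close>

lemma cut_CC: "AA.cut CC"
  unfolding AA.cut_def
proof (intro conjI allI impI)
  show "CC \<subseteq> arcs AA.QC" unfolding CC_def by blast
next
  fix c assume "AA.elementary_cycle c"
  then obtain Z where Z: "is_path AA.QC Z c Z" "AA.path_label c = AA.pvec"
    unfolding AA.elementary_cycle_def by blast
  obtain f g where fg: "is_path AA.QC (A1.coset f \<times> A2.coset g) c Z" using path_vertsE[OF Z(1)] by blast
  have "cnt (typesL c) = zmul 1 (one_vec d1)"
    using path_label_QC(2)[OF fg] unfolding Z(2) pvec_eq L_el restr_one zmul_1 by (rule sym)
  then have "A1.theta (f + zmul 1 (one_vec d1)) = A1.theta f + int (new_count c)"
    using QC_path[OF fg] by (simp only:)
  then have "new_count c = 1" unfolding A1.theta_add_one by linarith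
  then show "eps CC c = 1" using eps_CC[OF path_arcs[OF fg]] by (simp only:)
next
  fix Z Y p q assume *: "is_path AA.QC Z p Y \<and> is_path AA.QC Z q Y \<and> AA.path_label p = AA.path_label q"
  then have "is_path AA.QC Z p Y" by blast
  then obtain f g where fg: "Z = A1.coset f \<times> A2.coset g" by (rule path_vertsE)
  have p: "is_path AA.QC (A1.coset f \<times> A2.coset g) p Y" and q: "is_path AA.QC (A1.coset f \<times> A2.coset g) q Y"
    using * unfolding fg by blast+
  have "cnt (typesL p) = cnt (typesL q)"
    using path_label_QC(2)[OF p] path_label_QC(2)[OF q] * by (simp only:)
  then have "A1.theta f + int (new_count p) = A1.theta f + int (new_count q)"
    using QC_path[OF p] QC_path[OF q] by (simp only:)
  then show "eps CC p = eps CC q"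
    unfolding eps_CC[OF path_arcs[OF p]] eps_CC[OF path_arcs[OF q]] by linarith
qed

text \<open>Coefficient vectors with the same combination of roots differ by a multiple of all ones,
  which the potential detects; on \<open>KD\<close> both potentials are 0. As a consequence the
  value of \<open>kappa\<close> is unambiguous.\<close>

lemma KD_sig_inj:
  assumes "k \<in> KD" "k' \<in> KD" "sig k = sig k'"
  shows "k = k'"
proof (rule F_eqI)
  show "k \<in> FF" "k' \<in> FF" using assms KD_closed(3) by blast+
  have d: "k - k' \<in> KD" by (rule KD_closed(2)[OF assms(1,2)])
  have s: "alpha_comb d1 (L (k - k')) = 0" "alpha_comb d2 (R (k - k')) = 0"
    using assms(3) unfolding sig_def prod.inject L_diff R_diff alpha_comb_diff by (simp_all only: diff_self)
  obtain c where c: "L (k - k') = zmul c (one_vec d1)" using alpha_comb_eq_0[OF s(1) restr_L] by blast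
  have "A1.theta (0 + zmul c (one_vec d1)) = 0" unfolding add_0_left c[symmetric] using theta_KD[OF d] by blast
  then have "c = 0" unfolding A1.theta_add_one A1.theta_0 by simp
  then have "L k - L k' = 0" using c unfolding L_diff by (simp only: zmul_0)
  then show "L k = L k'" by (rule right_minus_eq[THEN iffD1])
  obtain c' where c': "R (k - k') = zmul c' (one_vec d2)" using alpha_comb_eq_0[OF s(2) restr_R] by blast
  have "A2.theta (0 + zmul c' (one_vec d2)) = 0" unfolding add_0_left c'[symmetric] using theta_KD[OF d] by blast
  then have "c' = 0" unfolding A2.theta_add_one A2.theta_0 by simp
  then have "R k - R k' = 0" using c' unfolding R_diff by (simp only: zmul_0)
  then show "R k = R k'" by (rule right_minus_eq[THEN iffD1])
qed

lemma proj_arrow_eq: "AA.proj_arrow = (\<lambda>(x, a). (AA.B #>\<^bsub>AA.LL\<^esub> x, a))"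
  by (simp only: AA.proj_arrow_def)

lemma path_label_proj: "AA.path_label (map AA.proj_arrow p) = AA.path_label p"
  unfolding AA.path_label_def proj_arrow_eq by (simp add: case_prod_beta comp_def)

text \<open>The path raises both potentials by its number of new arrows, and subtracting that
  multiple of \<open>pv\<close> brings both back to 0.\<close>

lemma kappa_value:
  assumes p: "is_path AA.QC_hat x p (x + b)" and b: "b \<in> B1 \<times> B2"
  defines "k \<equiv> AA.path_label p - frag_cmul (int (eps CC (map AA.proj_arrow p))) AA.pvec"
  shows "k \<in> KD \<and> sig k = b"
proof -
  let ?q = "map AA.proj_arrow p"
  have x: "x \<in> carrier AA.LL" using Qh.is_path_verts(1)[OF p] unfolding QC_hat_simps .
  obtain h where h: "sig h = x" by (rule sig_surj[OF x])
  have eq: "x + b = x + (alpha_comb d1 (cnt (typesL p)), alpha_comb d2 (cnt (typesR p)))"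
    and q: "is_path AA.QC (AA.B #>\<^bsub>AA.LL\<^esub> x) ?q (AA.B #>\<^bsub>AA.LL\<^esub> (x + b))"
    using hat_path[OF p] by blast+
  have b_eq: "b = (alpha_comb d1 (cnt (typesL p)), alpha_comb d2 (cnt (typesR p)))"
    using eq by (rule add_left_imp_eq)
  have "AA.B #>\<^bsub>AA.LL\<^esub> x = A1.coset (L h) \<times> A2.coset (R h)"
    unfolding coset_LL h[symmetric] sig_def fst_conv snd_conv ..
  then have q': "is_path AA.QC (A1.coset (L h) \<times> A2.coset (R h)) ?q (AA.B #>\<^bsub>AA.LL\<^esub> (x + b))"
    using q by (simp only:)
  have types: "typesL ?q = typesL p" "typesR ?q = typesR p"
    unfolding proj_arrow_eq by (rule types_map_proj)+
  define n where "n = int (new_count ?q)"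
  have lab: "AA.path_label p \<in> FF" "L (AA.path_label p) = cnt (typesL p)" "R (AA.path_label p) = cnt (typesR p)"
    using path_label_QC[OF q'] unfolding path_label_proj types by blast+
  have k: "k = AA.path_label p + frag_cmul (- n) pv"
    unfolding k_def eps_CC[OF path_arcs[OF q']] pvec_eq n_def minus_frag_cmul[symmetric] by (rule diff_conv_add_uminus)
  have B: "alpha_comb d1 (cnt (typesL p)) \<in> B1" "alpha_comb d2 (cnt (typesR p)) \<in> B2"
    using b unfolding b_eq by blast+
  have "A1.theta (cnt (typesL p) + L h) = A1.theta (L h) + n" "A2.theta (cnt (typesR p) + R h) = A2.theta (R h) + n"
    using QC_path[OF q'] unfolding types n_def by (simp_all only: add.commute)
  then have t: "A1.theta (cnt (typesL p)) = n" "A2.theta (cnt (typesR p)) = n"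
    unfolding A1.theta_add_period[OF B(1)] A2.theta_add_period[OF B(2)] by linarith+
  have Lk: "L k = cnt (typesL p) + zmul (- n) (one_vec d1)" and Rk: "R k = cnt (typesR p) + zmul (- n) (one_vec d2)"
    unfolding k L_add_pv R_add_pv lab by (rule refl)+
  have s: "alpha_comb d1 (L k) = alpha_comb d1 (cnt (typesL p))" "alpha_comb d2 (R k) = alpha_comb d2 (cnt (typesR p))"
    unfolding Lk Rk alpha_comb_add alpha_comb_zmul alpha_comb_one zmul_zero add_0_right by (rule refl)+
  have "k \<in> KD"
    unfolding KD_def A1.D_def A2.D_def mem_Collect_eq
  proof (intro conjI restr_L restr_R)
    show "k \<in> FF" unfolding k by (intro FF_closed el_in_FF lab(1))
    show "alpha_comb d1 (L k) \<in> B1" "alpha_comb d2 (R k) \<in> B2" unfolding s by (rule B)+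
    show "A1.theta (L k) = 0" unfolding Lk A1.theta_add_one t by simp
    show "A2.theta (R k) = 0" unfolding Rk A2.theta_add_one t by simp
  qed
  moreover have "sig k = b" unfolding sig_def s b_eq ..
  ultimately show ?thesis by blast
qed

lemma kappa_path_exists:
  assumes b: "b \<in> B1 \<times> B2"
  obtains p where "is_path AA.QC_hat 0 p (0 + b)"
proof -
  have "fst b \<in> root_lattice d1" "snd b \<in> root_lattice d2" using b A1.B(4) A2.B(4) by auto
  then obtain f g where f: "alpha_comb d1 f = fst b" "restr d1 f = f" and g: "alpha_comb d2 g = snd b" "restr d2 g = g"
    using alpha_comb_surj by metis
  \<comment> \<open>Adding a constant to all coordinates keeps the endpoint and shifts the potential
    by that constant. \<open>N\<close> is the common potential given to both sides, so large that
    all coordinates become nonnegative and hence come from words.\<close>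
  define N where "N = (\<Sum>i\<le>d1. \<bar>f i\<bar>) + (\<Sum>i\<le>d2. \<bar>g i\<bar>) + \<bar>A1.theta f\<bar> + \<bar>A2.theta g\<bar>"
  let ?f = "f + zmul (N - A1.theta f) (one_vec d1)" and ?g = "g + zmul (N - A2.theta g) (one_vec d2)"
  have nn: "(\<Sum>i\<le>d1. \<bar>f i\<bar>) \<ge> 0" "(\<Sum>i\<le>d2. \<bar>g i\<bar>) \<ge> 0" by (intro sum_nonneg; simp)+
  have fn: "?f i \<ge> 0" for i
  proof (cases "i \<le> d1")
    case True
    have "\<bar>f i\<bar> \<le> (\<Sum>i\<le>d1. \<bar>f i\<bar>)" using True by (intro member_le_sum) auto
    moreover have "?f i = f i + (N - A1.theta f)" using True by (simp add: one_vec_def)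
    ultimately show ?thesis using nn unfolding N_def by linarith
  next
    case False
    then show ?thesis using fun_cong[OF f(2), of i] by (simp add: one_vec_def restr_def)
  qed
  have gn: "?g i \<ge> 0" for i
  proof (cases "i \<le> d2")
    case True
    have "\<bar>g i\<bar> \<le> (\<Sum>i\<le>d2. \<bar>g i\<bar>)" using True by (intro member_le_sum) auto
    moreover have "?g i = g i + (N - A2.theta g)" using True by (simp add: one_vec_def)
    ultimately show ?thesis using nn unfolding N_def by linarith
  next
    case False
    then show ?thesis using fun_cong[OF g(2), of i] by (simp add: one_vec_def restr_def)
  qed
  have rz: "restr n (zmul c (one_vec n)) = zmul c (one_vec n)" for n c
    by (rule ext) (simp add: restr_def one_vec_def)
  have rf: "restr d1 ?f = ?f" and rg: "restr d2 ?g = ?g"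
    by (simp_all only: restr_add f g rz)
  obtain p where p: "set p \<subseteq> {..d1}" "cnt p = ?f" by (rule cnt_list_exists[OF fn rf])
  obtain q where q: "set q \<subseteq> {..d2}" "cnt q = ?g" by (rule cnt_list_exists[OF gn rg])
  have "A1.total_weight 0 p = N" "A2.total_weight 0 q = N"
    using A1.theta_total_weight[OF p(1), of 0] A2.theta_total_weight[OF q(1), of 0]
    unfolding add_0_left p(2) q(2) A1.theta_add_one A2.theta_add_one A1.theta_0 A2.theta_0 by linarith+
  then obtain r y where r: "is_path AA.QC_hat (alpha_comb d1 0, alpha_comb d2 0) r y" "typesL r = p" "typesR r = q"
    using hat_path_exists[OF p(1) q(1), of 0 0] by auto
  have r0: "is_path AA.QC_hat 0 r y" using r(1) unfolding alpha_comb_0 zero_prod_def .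
  have "y = 0 + (alpha_comb d1 ?f, alpha_comb d2 ?g)"
    using hat_path[OF r0] unfolding r(2,3) p(2) q(2) by blast
  also have "(alpha_comb d1 ?f, alpha_comb d2 ?g) = b"
    unfolding alpha_comb_add alpha_comb_zmul alpha_comb_one zmul_zero add_0_right f g by simp
  finally show thesis using that r0 by blast
qed

lemma kappa_props:
  assumes b: "b \<in> B1 \<times> B2"
  shows "AA.kappa CC b \<in> KD \<and> sig (AA.kappa CC b) = b"
proof -
  define Pr where "Pr f \<longleftrightarrow> (\<exists>x p. is_path AA.QC_hat x p (x + b) \<and>
     f = AA.path_label p - frag_cmul (int (eps CC (map AA.proj_arrow p))) AA.pvec)" for f
  have Pr: "f \<in> KD \<and> sig f = b" if "Pr f" for f
    using that kappa_value[OF _ b] unfolding Pr_def by blast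
  obtain p where "is_path AA.QC_hat 0 p (0 + b)" by (rule kappa_path_exists[OF b])
  then have ex: "Pr (AA.path_label p - frag_cmul (int (eps CC (map AA.proj_arrow p))) AA.pvec)"
    unfolding Pr_def by blast
  have "Pr (THE f. Pr f)"
    using ex
  proof (rule theI)
    fix f assume "Pr f"
    then show "f = AA.path_label p - frag_cmul (int (eps CC (map AA.proj_arrow p))) AA.pvec"
      using Pr[OF ex] Pr[of f] KD_sig_inj by metis
  qed
  then have "Pr (AA.kappa CC b)" unfolding AA.kappa_def Pr_def .
  then show ?thesis by (rule Pr)
qed

lemma kappa_image: "AA.kappa CC ` AA.B = KD"
proof (rule equalityI; rule subsetI)
  fix k assume "k \<in> AA.kappa CC ` AA.B"
  then show "k \<in> KD" unfolding B_eq using kappa_props by blast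
next
  fix k assume k: "k \<in> KD"
  have s: "sig k \<in> B1 \<times> B2" unfolding sig_def using theta_KD[OF k] by blast
  have "k = AA.kappa CC (sig k)" using kappa_props[OF s] KD_sig_inj[OF k] by metis
  then show "k \<in> AA.kappa CC ` AA.B" unfolding B_eq using s by (rule image_eqI)
qed

text \<open>The image of \<open>kappa\<close> is \<open>KD\<close>, which is \<open>A_P(M)\<close>,
  the description belonging to \<open>u = 0\<close>. If \<open>w\<close> also fits, then
  \<open>m w\<close> times \<open>pv\<close> lies in \<open>KD\<close> for every \<open>m\<close>;
  the potentials there are 0, so every \<open>m\<close> vanishes at \<open>w\<close>.\<close>

lemma cut_type_CC: "AA.cut_type CC = 0"
  unfolding AA.cut_type_def kappa_image
proof (rule the_equality)
  have "AA.A_P m - frag_cmul (m 0) AA.pvec = AA.A_P m" if "m \<in> AA.M" for m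
  proof -
    interpret additive m using that unfolding AA.M_def by simp
    show ?thesis by (simp add: zero)
  qed
  then have "{AA.A_P m - frag_cmul (m 0) AA.pvec | m. m \<in> AA.M} = {AA.A_P m | m. m \<in> AA.M}" by force
  then show "KD = {AA.A_P m - frag_cmul (m 0) AA.pvec | m. m \<in> AA.M}" unfolding A_P_image by simp
next
  fix w assume w: "KD = {AA.A_P m - frag_cmul (m w) AA.pvec | m. m \<in> AA.M}"
  have "m w = 0" if m: "m \<in> AA.M" for m
  proof -
    have 1: "AA.A_P m \<in> KD" unfolding A_P_image[symmetric] using m by blast
    have 2: "AA.A_P m - frag_cmul (m w) AA.pvec \<in> KD" by (subst w) (use m in blast)
    have "AA.A_P m - (AA.A_P m - frag_cmul (m w) AA.pvec) \<in> KD" by (rule KD_closed(2)[OF 1 2])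
    then have "0 + frag_cmul (m w) pv \<in> KD" unfolding pvec_eq by simp
    then have "A1.theta (0 + zmul (m w) (one_vec d1)) = 0"
      using theta_KD[of "0 + frag_cmul (m w) pv"] unfolding L_add_pv L_0 by blast
    then show ?thesis unfolding A1.theta_add_one A1.theta_0 by simp
  qed
  then have "w $ k = 0" for k
    using additive_component[of k] unfolding AA.M_def by blast
  then show "w = 0" by (simp add: vec_eq_iff)
qed

lemma admissible: "AA.admissible CC"
proof -
  have "lat (0 :: int ^ 'n) = 0" by (simp add: lat_def vec_eq_iff)
  moreover have "0 \<in> interior P" using P.zero_in_interior unfolding Plus_def .
  ultimately show ?thesis
    unfolding AA.admissible_def cut_type_CC
    using simplicial card_V labelling nontrivial_upper_set cut_CC by metis
qed

subsection \<open>The algebra\<close>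

text \<open>A vertex of \<open>Q(C)\<close> is a product of two nonempty cosets, so the images under
  \<open>fst\<close> and \<open>snd\<close> recover the factors.\<close>

definition clsQ :: "pt set \<times> (pt set \<times> arrow) list \<Rightarrow>
    ((nat \<Rightarrow> int) set \<times> (nat \<Rightarrow> int)) \<times> ((nat \<Rightarrow> int) set \<times> (nat \<Rightarrow> int))" where
  "clsQ = (\<lambda>(Z, p). ((fst ` Z, cnt (typesL p)), (snd ` Z, cnt (typesR p))))"

lemma clsQ_coset: "clsQ (A1.coset f \<times> A2.coset g, p) = ((A1.coset f, cnt (typesL p)), (A2.coset g, cnt (typesR p)))"
  unfolding clsQ_def prod.case fst_image_times snd_image_times using coset_nonempty by simp

text \<open>A path without new arrows leaves both potentials constant, so its projections avoid the
  cuts. Conversely, two words that avoid their cuts have total weight 0, and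
  \<open>hat_path_exists\<close> interleaves them without new arrows.\<close>

lemma clsQ_deg_0: "clsQ ` {x \<in> paths AA.QC. eps CC (snd x) = 0} = A1.path_classes \<times> A2.path_classes"
proof (rule equalityI; rule subsetI)
  fix c assume "c \<in> clsQ ` {x \<in> paths AA.QC. eps CC (snd x) = 0}"
  then obtain Z p Y where Zp: "c = clsQ (Z, p)" "is_path AA.QC Z p Y" "eps CC p = 0"
    unfolding paths_def by auto
  obtain f g where Z: "Z = A1.coset f \<times> A2.coset g" and fg: "is_path AA.QC (A1.coset f \<times> A2.coset g) p Y"
    using Zp(2) by (rule path_vertsE)
  have n: "new_count p = 0" using Zp(3) eps_CC[OF path_arcs[OF fg]] by simp
  note * = QC_path[OF fg, unfolded n of_nat_0 add_0_right]
  have sL: "set (typesL p) \<subseteq> {..d1}" and sR: "set (typesR p) \<subseteq> {..d2}" using * by blast+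
  have "is_path A1.QC (A1.coset f) (steps d1 (A1.coset f) (typesL p)) (A1.coset (f + cnt (typesL p)))"
    unfolding A1.is_path_QC_iff A1.is_path_QA_iff map_snd_steps using A1.theta_eps[OF sL, of f] * sL by simp
  then have "A1.cls (A1.coset f, steps d1 (A1.coset f) (typesL p)) \<in> A1.path_classes"
    unfolding A1.path_classes_def paths_def by blast
  moreover have "is_path A2.QC (A2.coset g) (steps d2 (A2.coset g) (typesR p)) (A2.coset (g + cnt (typesR p)))"
    unfolding A2.is_path_QC_iff A2.is_path_QA_iff map_snd_steps using A2.theta_eps[OF sR, of g] * sR by simp
  then have "A2.cls (A2.coset g, steps d2 (A2.coset g) (typesR p)) \<in> A2.path_classes"
    unfolding A2.path_classes_def paths_def by blast
  ultimately show "c \<in> A1.path_classes \<times> A2.path_classes"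
    unfolding Zp(1) Z clsQ_coset A1.cls_def A2.cls_def prod.case map_snd_steps by blast
next
  fix c assume "c \<in> A1.path_classes \<times> A2.path_classes"
  then obtain Z1 p Y1 Z2 q Y2 where c: "c = (A1.cls (Z1, p), A2.cls (Z2, q))"
    and p: "is_path A1.QC Z1 p Y1" and q: "is_path A2.QC Z2 q Y2"
    unfolding A1.path_classes_def A2.path_classes_def paths_def by auto
  have "Z1 \<in> A1.vs" "Z2 \<in> A2.vs"
    using A1.QC.is_path_verts(1)[OF p] A2.QC.is_path_verts(1)[OF q] unfolding A1.QC_simps A2.QC_simps by blast+
  then obtain f g where fg: "Z1 = A1.coset f" "Z2 = A2.coset g" using A1.vsE A2.vsE by metis
  have p': "p = steps d1 (A1.coset f) (map snd p)" "set (map snd p) \<subseteq> {..d1}" "eps C1 p = 0"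
    using p unfolding fg A1.is_path_QC_iff A1.is_path_QA_iff by blast+
  have q': "q = steps d2 (A2.coset g) (map snd q)" "set (map snd q) \<subseteq> {..d2}" "eps C2 q = 0"
    using q unfolding fg A2.is_path_QC_iff A2.is_path_QA_iff by blast+
  have w: "A1.total_weight f (map snd p) = 0" "A2.total_weight g (map snd q) = 0"
    using A1.eps_steps[OF p'(2), of f] A2.eps_steps[OF q'(2), of g]
    unfolding p'(1)[symmetric] q'(1)[symmetric] p'(3) q'(3) by linarith+
  then obtain r y where r: "is_path AA.QC_hat (alpha_comb d1 f, alpha_comb d2 g) r y"
    "typesL r = map snd p" "typesR r = map snd q"
    using hat_path_exists[OF p'(2) q'(2), of f g] by auto
  let ?r = "map AA.proj_arrow r"
  have path: "is_path AA.QC (A1.coset f \<times> A2.coset g) ?r (AA.B #>\<^bsub>AA.LL\<^esub> y)"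
    using hat_path[OF r(1)] unfolding coset_LL[of "(_, _)"] fst_conv snd_conv by blast
  have types: "typesL ?r = map snd p" "typesR ?r = map snd q"
    unfolding proj_arrow_eq types_map_proj by (rule r)+
  have "A1.theta (f + cnt (map snd p)) = A1.theta f + int (new_count ?r)"
    using QC_path[OF path] unfolding types by blast
  then have "new_count ?r = 0" unfolding A1.theta_total_weight[OF p'(2)] w by linarith
  then have "eps CC ?r = 0" using eps_CC[OF path_arcs[OF path]] by (simp only:)
  moreover have "c = clsQ (A1.coset f \<times> A2.coset g, ?r)"
    unfolding c fg clsQ_coset types A1.cls_def A2.cls_def prod.case ..
  ultimately show "c \<in> clsQ ` {x \<in> paths AA.QC. eps CC (snd x) = 0}"
    using path unfolding paths_def by (intro image_eqI) auto
qed

end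

lemma alg_iso_trans:
  assumes "alg_iso A B" "alg_iso B C"
  shows "alg_iso A C"
proof -
  obtain g where g: "g \<in> ring_iso A B" "\<forall>c. \<forall>x\<in>carrier A. g (c \<odot>\<^bsub>A\<^esub> x) = c \<odot>\<^bsub>B\<^esub> g x"
    using assms(1) unfolding alg_iso_def by blast
  obtain h where h: "h \<in> ring_iso B C" "\<forall>c. \<forall>x\<in>carrier B. h (c \<odot>\<^bsub>B\<^esub> x) = c \<odot>\<^bsub>C\<^esub> h x"
    using assms(2) unfolding alg_iso_def by blast
  have "g x \<in> carrier B" if "x \<in> carrier A" for x
    using g(1) that unfolding ring_iso_def bij_betw_def by blast
  then have "\<forall>c. \<forall>x\<in>carrier A. (h \<circ> g) (c \<odot>\<^bsub>A\<^esub> x) = c \<odot>\<^bsub>C\<^esub> (h \<circ> g) x"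
    using g(2) h(2) by simp
  then show ?thesis unfolding alg_iso_def using ring_iso_set_trans[OF g(1) h(1)] by blast
qed

context AA_datum
begin

lemma clsQ_mult:
  assumes "x \<in> paths AA.QC" "y \<in> paths AA.QC"
  shows "prod_mult A1.cls_mult A2.cls_mult (clsQ x) (clsQ y) = map_option clsQ (compose_paths AA.QC x y)"
proof -
  obtain Z p W where x: "x = (Z, p)" "is_path AA.QC Z p W" using assms(1) unfolding paths_def by blast
  obtain Y q V where y: "y = (Y, q)" "is_path AA.QC Y q V" using assms(2) unfolding paths_def by blast
  obtain f g where Z: "Z = A1.coset f \<times> A2.coset g" using x(2) by (rule path_vertsE)
  obtain f' g' where Y: "Y = A1.coset f' \<times> A2.coset g'" using y(2) by (rule path_vertsE)
  have xp: "is_path AA.QC (A1.coset f \<times> A2.coset g) p W" using x(2) unfolding Z .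
  have W: "W = A1.coset (f + cnt (typesL p)) \<times> A2.coset (g + cnt (typesR p))" using QC_path[OF xp] by blast
  have "is_path AA.QC (A1.coset f \<times> A2.coset g) p (A1.coset f' \<times> A2.coset g') \<longleftrightarrow>
      A1.coset f' = A1.coset (f + cnt (typesL p)) \<and> A2.coset g' = A2.coset (g + cnt (typesR p))"
  proof -
    have "is_path AA.QC (A1.coset f \<times> A2.coset g) p (A1.coset f' \<times> A2.coset g') \<longleftrightarrow> A1.coset f' \<times> A2.coset g' = W"
      using xp Q.is_path_unique[OF xp] by blast
    then show ?thesis unfolding W prod_coset_eq_iff .
  qed
  then show ?thesis
    unfolding x(1) y(1) Z Y clsQ_coset prod_mult_def A1.cls_mult_def A2.cls_mult_def compose_paths_def prod.case
      A1.coset_shift A2.coset_shift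
    by (cases "A1.coset f' = A1.coset (f + cnt (typesL p))"; cases "A2.coset g' = A2.coset (g + cnt (typesR p))")
      (simp_all only: if_True if_False simp_thms bind.simps option.map clsQ_coset types_append cnt_append)
qed

text \<open>Collects what is needed to make the difference of two paths of one class a generator of
  the ideal. The last claim is there because the relations only involve paths of positive
  length.\<close>

lemma clsQ_eqD:
  assumes x: "is_path AA.QC Z p W" and y: "is_path AA.QC Y q V" and eq: "clsQ (Z, p) = clsQ (Y, q)"
  shows "Y = Z" "V = W" "AA.path_label p = AA.path_label q" "p = [] \<longleftrightarrow> q = []"
proof -
  obtain f g where Z: "Z = A1.coset f \<times> A2.coset g" and p: "is_path AA.QC (A1.coset f \<times> A2.coset g) p W"
    using x by (rule path_vertsE)
  obtain f' g' where Y: "Y = A1.coset f' \<times> A2.coset g'" using y by (rule path_vertsE)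
  have c: "A1.coset f = A1.coset f'" "A2.coset g = A2.coset g'" "cnt (typesL p) = cnt (typesL q)"
    "cnt (typesR p) = cnt (typesR q)"
    using eq unfolding Z Y clsQ_coset by blast+
  show "Y = Z" unfolding Z Y c ..
  then have q: "is_path AA.QC (A1.coset f \<times> A2.coset g) q V" using y unfolding Z by simp
  show "V = W" using QC_path[OF p] QC_path[OF q] c by (simp only:)
  show "AA.path_label p = AA.path_label q"
    using path_label_QC[OF p] path_label_QC[OF q] c by (intro F_eqI) (simp_all only:)
  have "typesL p = [] \<longleftrightarrow> typesL q = []" "typesR p = [] \<longleftrightarrow> typesR q = []"
    unfolding cnt_eq_0_iff[symmetric] c(3,4) by blast+
  then show "p = [] \<longleftrightarrow> q = []" using types_Nil_iff by metis
qed

text \<open>The isomorphism for \<open>Gamma\<close> is restricted to the part of degree 0. The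
  image is spanned by the classes of paths of degree 0, and by \<open>clsQ_deg_0\<close> these are
  the pairs of path classes of the two factors.\<close>

lemma alg_iso_algebraAA:
  "alg_iso (basis_algebra (A1.path_classes \<times> A2.path_classes) (prod_mult A1.cls_mult A2.cls_mult)
      (((\<lambda>X. (X, 0)) ` A1.vs) \<times> ((\<lambda>X. (X, 0)) ` A2.vs)) :: ('k::field, _) module)
    (AA.algebraAA CC)"
proof -
  let ?E = "{(x, []) | x. x \<in> verts AA.QC}"
  let ?m = "prod_mult A1.cls_mult A2.cls_mult"
  interpret Pa: algebra_basis "paths AA.QC" "compose_paths AA.QC" ?E
    by (rule Q.algebra_basis_paths[OF finite_verts])
  define Rg where "Rg = (path_algebra AA.QC :: ('k, _) module)"
  define T where "T = (AA.path_relations :: (_ \<Rightarrow> 'k) set)"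
  define S where "S = genideal Rg T"
  define Qu where "Qu = quotient_algebra Rg S"
  have Rg: "Rg = basis_algebra (paths AA.QC) (compose_paths AA.QC) ?E"
    by (simp only: Rg_def path_algebra_def)
  interpret Rg: ring Rg unfolding Rg by (rule Pa.ring_basis_algebra)
  have T: "T \<subseteq> {single x - single y | x y. x \<in> paths AA.QC \<and> y \<in> paths AA.QC \<and> clsQ x = clsQ y}"
  proof
    fix t assume "t \<in> T"
    then obtain Z p q Y where t: "t = single (Z, p) - single (Z, q)" "AA.path_label p = AA.path_label q"
      "is_path AA.QC Z p Y" "is_path AA.QC Z q Y"
      unfolding T_def AA.path_relations_def by blast
    obtain f g where Z: "Z = A1.coset f \<times> A2.coset g" using t(3) by (rule path_vertsE)
    have p: "is_path AA.QC (A1.coset f \<times> A2.coset g) p Y" and q: "is_path AA.QC (A1.coset f \<times> A2.coset g) q Y"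
      using t(3,4) unfolding Z by blast+
    have "clsQ (Z, p) = clsQ (Z, q)"
      unfolding Z clsQ_coset path_label_QC(2,3)[OF p, symmetric] path_label_QC(2,3)[OF q, symmetric] t(2) ..
    then show "t \<in> {single x - single y | x y. x \<in> paths AA.QC \<and> y \<in> paths AA.QC \<and> clsQ x = clsQ y}"
      using t unfolding paths_def by blast
  qed
  have T_carrier: "T \<subseteq> carrier Rg"
  proof
    fix t assume "t \<in> T"
    then obtain x y where t: "t = single x - single y" "x \<in> paths AA.QC" "y \<in> paths AA.QC" using T by blast
    moreover have "support t \<subseteq> {x, y}" unfolding t(1) by (auto simp: single_apply)
    ultimately show "t \<in> carrier Rg"
      unfolding Rg basis_algebra_simps using finite_subset[of "support t" "{x, y}"] by blast
  qed
  have ideal: "ideal S Rg" unfolding S_def by (rule Rg.genideal_ideal[OF T_carrier])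
  have TS: "T \<subseteq> S" unfolding S_def by (rule Rg.genideal_self[OF T_carrier])
  have zero: "0 \<in> S"
    using additive_subgroup.zero_closed[OF ideal.axioms(1)[OF ideal]] unfolding Rg basis_algebra_simps .
  have inj: "inj_on clsQ ?E"
  proof (rule inj_onI)
    fix x y assume "x \<in> ?E" "y \<in> ?E" and eq: "clsQ x = clsQ y"
    then obtain Z Y where xy: "x = (Z, [])" "y = (Y, [])" "Z \<in> verts AA.QC" "Y \<in> verts AA.QC" by blast
    have "is_path AA.QC Z [] Z" "is_path AA.QC Y [] Y" unfolding Q.is_path_Nil using xy by blast+
    then show "x = y" using clsQ_eqD(1)[of Z "[]" Z Y "[]" Y] eq unfolding xy(1,2) by blast
  qed
  have Idl: "single x - single y \<in> S" if xy: "x \<in> paths AA.QC" "y \<in> paths AA.QC" "clsQ x = clsQ y" for x y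
  proof -
    obtain Z p W where x: "x = (Z, p)" "is_path AA.QC Z p W" using xy(1) unfolding paths_def by blast
    obtain Y q V where y: "y = (Y, q)" "is_path AA.QC Y q V" using xy(2) unfolding paths_def by blast
    note * = clsQ_eqD[OF x(2) y(2) xy(3)[unfolded x(1) y(1)]]
    show ?thesis
    proof (cases "p = []")
      case True
      then have "x = y" using * unfolding x(1) y(1) by blast
      then show ?thesis using zero by (simp only: diff_self)
    next
      case False
      have q: "is_path AA.QC Z q W" using y(2) unfolding *(1,2) .
      have "single (Z, p) - single (Z, q) \<in> T"
        unfolding T_def AA.path_relations_def using False *(3,4) x(2) q by blast
      then show ?thesis using TS unfolding x(1) y(1) *(1) by blast
    qed
  qed
  have Eimg: "clsQ ` ?E = ((\<lambda>X. (X, 0)) ` A1.vs) \<times> ((\<lambda>X. (X, 0)) ` A2.vs)"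
  proof (rule equalityI; rule subsetI)
    fix c assume "c \<in> clsQ ` ?E"
    then obtain Z where Z: "c = clsQ (Z, [])" "Z \<in> verts AA.QC" by blast
    obtain f g where fg: "Z = A1.coset f \<times> A2.coset g" by (rule vertsE[OF Z(2)])
    show "c \<in> ((\<lambda>X. (X, 0)) ` A1.vs) \<times> ((\<lambda>X. (X, 0)) ` A2.vs)"
      unfolding Z(1) fg clsQ_coset types_simps cnt_Nil using A1.coset_in_vs A2.coset_in_vs by blast
  next
    fix c assume "c \<in> ((\<lambda>X. (X, 0 :: nat \<Rightarrow> int)) ` A1.vs) \<times> ((\<lambda>X. (X, 0 :: nat \<Rightarrow> int)) ` A2.vs)"
    then obtain Z1 Z2 where c: "c = ((Z1, 0), (Z2, 0))" "Z1 \<in> A1.vs" "Z2 \<in> A2.vs" by blast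
    then obtain f g where fg: "Z1 = A1.coset f" "Z2 = A2.coset g" using A1.vsE A2.vsE by metis
    have "c = clsQ (A1.coset f \<times> A2.coset g, [])" unfolding c(1) fg clsQ_coset types_simps cnt_Nil ..
    then show "c \<in> clsQ ` ?E" using verts_coset by blast
  qed
  have AA_alg: "AA.algebraAA CC = Qu\<lparr>carrier := {S +>\<^bsub>Rg\<^esub> f | f.
      f \<in> carrier Rg \<and> (\<forall>(X, p) \<in> support f. eps CC p = 0)}\<rparr>"
    by (simp only: AA.algebraAA_def AA.Gamma_def AA.relation_ideal_def Qu_def S_def Rg_def T_def)
  define A where "A = {S +>\<^bsub>Rg\<^esub> f | f. f \<in> carrier Rg \<and> (\<forall>(X, p) \<in> support f. eps CC p = 0)}"
  let ?Y0 = "A1.path_classes \<times> A2.path_classes"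
  let ?EE = "((\<lambda>X. (X, 0)) ` A1.vs) \<times> ((\<lambda>X. (X, 0)) ` A2.vs)"
  let ?F = "basis_algebra (clsQ ` paths AA.QC) ?m (clsQ ` ?E) :: ('k, _) module"
  let ?R0 = "basis_algebra ?Y0 ?m ?EE :: ('k, _) module"
  show ?thesis
  proof (rule Pa.quotient_by_classes[OF Rg S_def Qu_def clsQ_mult inj T Idl])
    fix \<Phi>
    assume \<Phi>: "\<Phi> \<in> ring_iso Qu ?F"
      and \<Phi>_coset: "\<And>f. f \<in> carrier Rg \<Longrightarrow> \<Phi> (S +>\<^bsub>Rg\<^esub> f) = lin_ext (\<lambda>x. single (clsQ x)) f"
      and smult_closed: "\<And>c x. x \<in> carrier Qu \<Longrightarrow> c \<odot>\<^bsub>Qu\<^esub> x \<in> carrier Qu"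
      and smult: "\<And>c x. x \<in> carrier Qu \<Longrightarrow> \<Phi> (c \<odot>\<^bsub>Qu\<^esub> x) = scl c (\<Phi> x)"
    have "ring Qu" unfolding Qu_def by (rule ring_quotient_algebra[OF ideal])
    \<comment> \<open>The required \<open>alg_iso\<close> starts at the basis algebra, so the
      inverse of \<Phi> is the map to restrict.\<close>
    define g where "g = inv_into (carrier Qu) \<Phi>"
    have g: "g \<in> ring_iso ?F Qu" unfolding g_def using \<open>ring Qu\<close> \<Phi> by (rule ring_iso_set_sym)
    have bij: "bij_betw \<Phi> (carrier Qu) (carrier ?F)" using \<Phi> unfolding ring_iso_def by blast
    have A_sub: "A \<subseteq> carrier Qu"
      unfolding A_def Qu_def quotient_algebra_simps A_RCOSETS_def' by blast
    have image: "\<Phi> ` A = carrier ?R0"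
    proof (rule equalityI; rule subsetI)
      fix r assume "r \<in> \<Phi> ` A"
      then obtain f where f: "f \<in> carrier Rg" "\<forall>(X, p) \<in> support f. eps CC p = 0" "r = \<Phi> (S +>\<^bsub>Rg\<^esub> f)"
        unfolding A_def by blast
      have fs: "finite (support f)" "support f \<subseteq> paths AA.QC" using f(1) unfolding Rg basis_algebra_simps by blast+
      have r: "r = lin_ext (\<lambda>x. single (clsQ x)) f" unfolding f(3) by (rule \<Phi>_coset[OF f(1)])
      have f0: "x \<in> {x \<in> paths AA.QC. eps CC (snd x) = 0}" if "x \<in> support f" for x
      proof -
        have "eps CC (snd x) = 0" using bspec[OF f(2) that] by (cases x) simp
        then show ?thesis using fs(2) that by blast
      qed
      have "support r \<subseteq> (\<Union>x\<in>support f. support (single (clsQ x) :: _ \<Rightarrow> 'k))"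
        unfolding r lin_ext_def by (rule support_lin_comb)
      also have "\<dots> \<subseteq> clsQ ` {x \<in> paths AA.QC. eps CC (snd x) = 0}"
        unfolding support_single
      proof (rule UN_least)
        fix x assume "x \<in> support f"
        show "{clsQ x} \<subseteq> clsQ ` {x \<in> paths AA.QC. eps CC (snd x) = 0}"
          using imageI[OF f0[OF \<open>x \<in> support f\<close>], of clsQ] by (simp only: insert_subset empty_subsetI simp_thms)
      qed
      finally have "support r \<subseteq> ?Y0" unfolding clsQ_deg_0 .
      moreover have "finite (support r)" unfolding r by (rule finite_support_lin_ext[OF fs(1)]) simp
      ultimately show "r \<in> carrier ?R0" unfolding basis_algebra_simps by blast
    next
      fix r assume "r \<in> carrier ?R0"
      then have r: "finite (support r)" "support r \<subseteq> clsQ ` {x \<in> paths AA.QC. eps CC (snd x) = 0}"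
        unfolding basis_algebra_simps clsQ_deg_0 by blast+
      \<comment> \<open>Representatives are taken among the paths of degree 0, so that the element
        built from them belongs to the degree 0 part.\<close>
      define rep where "rep = inv_into {x \<in> paths AA.QC. eps CC (snd x) = 0} clsQ"
      have rep: "rep y \<in> {x \<in> paths AA.QC. eps CC (snd x) = 0}" "clsQ (rep y) = y" if "y \<in> support r" for y
      proof -
        have y: "y \<in> clsQ ` {x \<in> paths AA.QC. eps CC (snd x) = 0}" using r(2) that by blast
        show "rep y \<in> {x \<in> paths AA.QC. eps CC (snd x) = 0}" unfolding rep_def by (rule inv_into_into[OF y])
        show "clsQ (rep y) = y" unfolding rep_def by (rule f_inv_into_f[OF y])
      qed
      define f where "f = lin_ext (\<lambda>y. single (rep y)) r"
      have "support f \<subseteq> (\<Union>y\<in>support r. support (single (rep y) :: _ \<Rightarrow> 'k))"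
        unfolding f_def lin_ext_def by (rule support_lin_comb)
      also have "\<dots> \<subseteq> {x \<in> paths AA.QC. eps CC (snd x) = 0}"
        unfolding support_single
      proof (rule UN_least)
        fix y assume "y \<in> support r"
        show "{rep y} \<subseteq> {x \<in> paths AA.QC. eps CC (snd x) = 0}"
          using rep(1)[OF \<open>y \<in> support r\<close>] by (simp only: insert_subset empty_subsetI simp_thms)
      qed
      finally have sf: "support f \<subseteq> {x \<in> paths AA.QC. eps CC (snd x) = 0}" .
      have ff: "finite (support f)" unfolding f_def by (rule finite_support_lin_ext[OF r(1)]) simp
      have f: "f \<in> carrier Rg" unfolding Rg basis_algebra_simps mem_Collect_eq
        by (intro conjI ff subset_trans[OF sf] Collect_restrict)
      have "\<Phi> (S +>\<^bsub>Rg\<^esub> f) = lin_ext (\<lambda>y. lin_ext (\<lambda>x. single (clsQ x)) (single (rep y))) r"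
        by (rule trans[OF \<Phi>_coset[OF f]], unfold f_def, rule lin_ext_lin_ext[OF r(1)]) simp
      also have "\<dots> = lin_ext single r"
        by (rule lin_ext_cong) (simp only: lin_ext_single rep(2))
      also have "\<dots> = r" by (rule lin_ext_single_self[OF r(1)])
      finally have "\<Phi> (S +>\<^bsub>Rg\<^esub> f) = r" .
      moreover have "S +>\<^bsub>Rg\<^esub> f \<in> A"
      proof -
        have "\<forall>(X, p)\<in>support f. eps CC p = 0"
        proof
          fix x assume "x \<in> support f"
          then have "x \<in> {x \<in> paths AA.QC. eps CC (snd x) = 0}" by (rule subsetD[OF sf])
          then have "eps CC (snd x) = 0" by simp
          then show "case_prod (\<lambda>X p. eps CC p = 0) x" by (simp only: split_beta)
        qed
        then show ?thesis unfolding A_def using f by blast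
      qed
      ultimately show "r \<in> \<Phi> ` A" by (rule image_eqI[OF sym])
    qed
    have g\<Phi>: "g (\<Phi> a) = a" if "a \<in> carrier Qu" for a
      unfolding g_def by (rule inv_into_f_f[OF bij_betw_imp_inj_on[OF bij] that])
    have sub: "carrier ?R0 \<subseteq> carrier ?F"
      unfolding image[symmetric] using A_sub bij unfolding bij_betw_def by blast
    have g_image: "g ` carrier ?R0 = A"
    proof -
      have "g ` \<Phi> ` A = (\<lambda>a. a) ` A"
        unfolding image_image by (rule image_cong[OF refl]) (rule g\<Phi>[OF subsetD[OF A_sub]])
      then show ?thesis unfolding image image_ident .
    qed
    have "g \<in> ring_iso ?R0 (AA.algebraAA CC)"
    proof -
      have hom: "g x \<in> carrier Qu" "g (x \<otimes>\<^bsub>?F\<^esub> y) = g x \<otimes>\<^bsub>Qu\<^esub> g y" "g (x \<oplus>\<^bsub>?F\<^esub> y) = g x \<oplus>\<^bsub>Qu\<^esub> g y"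
        "g \<one>\<^bsub>?F\<^esub> = \<one>\<^bsub>Qu\<^esub>" if "x \<in> carrier ?F" "y \<in> carrier ?F" for x y
      proof -
        have h: "g \<in> ring_hom ?F Qu" using g unfolding ring_iso_def by blast
        show "g x \<in> carrier Qu" by (rule ring_hom_closed[OF h that(1)])
        show "g (x \<otimes>\<^bsub>?F\<^esub> y) = g x \<otimes>\<^bsub>Qu\<^esub> g y" by (rule ring_hom_mult[OF h that])
        show "g (x \<oplus>\<^bsub>?F\<^esub> y) = g x \<oplus>\<^bsub>Qu\<^esub> g y" by (rule ring_hom_add[OF h that])
        show "g \<one>\<^bsub>?F\<^esub> = \<one>\<^bsub>Qu\<^esub>" by (rule ring_hom_one[OF h])
      qed
      have z: "(0 :: _ \<Rightarrow> 'k) \<in> carrier ?F" unfolding basis_algebra_simps by simp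
      have ops: "mult (AA.algebraAA CC) = mult Qu" "add (AA.algebraAA CC) = add Qu"
        "one (AA.algebraAA CC) = one Qu" "carrier (AA.algebraAA CC) = A"
        unfolding AA_alg A_def by simp_all
      have opsF: "mult ?F = mult ?R0" "add ?F = add ?R0" "one ?F = one ?R0"
        unfolding basis_algebra_simps Eimg by (rule refl)+
      have "inj_on g (carrier ?F)" using g unfolding ring_iso_def bij_betw_def by blast
      then have "inj_on g (carrier ?R0)" using sub by (rule inj_on_subset)
      then have "bij_betw g (carrier ?R0) (carrier (AA.algebraAA CC))"
        unfolding bij_betw_def g_image ops by blast
      moreover have "g \<in> ring_hom ?R0 (AA.algebraAA CC)"
      proof (rule ring_hom_memI)
        fix x y assume x: "x \<in> carrier ?R0" and y: "y \<in> carrier ?R0"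
        have xF: "x \<in> carrier ?F" "y \<in> carrier ?F" using sub x y by blast+
        show "g (x \<otimes>\<^bsub>?R0\<^esub> y) = g x \<otimes>\<^bsub>AA.algebraAA CC\<^esub> g y"
          using hom(2)[OF xF] unfolding ops opsF .
        show "g (x \<oplus>\<^bsub>?R0\<^esub> y) = g x \<oplus>\<^bsub>AA.algebraAA CC\<^esub> g y"
          using hom(3)[OF xF] unfolding ops opsF .
      next
        fix x assume "x \<in> carrier ?R0"
        then have "g x \<in> A" using g_image by blast
        then show "g x \<in> carrier (AA.algebraAA CC)" unfolding ops .
      next
        show "g \<one>\<^bsub>?R0\<^esub> = \<one>\<^bsub>AA.algebraAA CC\<^esub>"
          using hom(4)[OF z z] unfolding ops opsF .
      qed
      ultimately show ?thesis unfolding ring_iso_def by blast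
    qed
    moreover have "g (c \<odot>\<^bsub>?R0\<^esub> x) = c \<odot>\<^bsub>AA.algebraAA CC\<^esub> g x" if x: "x \<in> carrier ?R0" for c x
    proof -
      obtain a where a: "a \<in> A" "x = \<Phi> a" using x unfolding image[symmetric] by (rule imageE)
      have aQ: "a \<in> carrier Qu" using a(1) A_sub by blast
      have "g (scl c x) = g (\<Phi> (c \<odot>\<^bsub>Qu\<^esub> a))" unfolding a(2) smult[OF aQ] ..
      also have "\<dots> = c \<odot>\<^bsub>Qu\<^esub> a" by (rule g\<Phi>[OF smult_closed[OF aQ]])
      also have "\<dots> = c \<odot>\<^bsub>Qu\<^esub> g x" unfolding a(2) g\<Phi>[OF aQ] ..
      moreover have "smult (AA.algebraAA CC) = smult Qu" "smult ?R0 = scl"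
        unfolding AA_alg basis_algebra_simps by simp_all
      ultimately show ?thesis by (simp only:)
    qed
    ultimately show ?thesis unfolding alg_iso_def by blast
  qed
qed

lemma rep_infinite_AA_tensor:
  "rep_infinite_AA TYPE('n) (tensor_algebra (algebraA d1 B1 C1 :: ('k::field, _) module) (algebraA d2 B2 C2))"
proof -
  obtain \<phi>1 where 1: "basis_iso (algebraA d1 B1 C1 :: ('k, _) module) A1.path_classes A1.cls_mult ((\<lambda>X. (X, 0)) ` A1.vs) \<phi>1"
    using A1.basis_iso_algebraA by blast
  obtain \<phi>2 where 2: "basis_iso (algebraA d2 B2 C2 :: ('k, _) module) A2.path_classes A2.cls_mult ((\<lambda>X. (X, 0)) ` A2.vs) \<phi>2"
    using A2.basis_iso_algebraA by blast
  have "alg_iso (tensor_algebra (algebraA d1 B1 C1 :: ('k, _) module) (algebraA d2 B2 C2)) (AA.algebraAA CC)"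
    by (rule alg_iso_trans[OF tensor_algebra_basis_iso[OF 1 2] alg_iso_algebraAA])
  then show ?thesis unfolding rep_infinite_AA_def using admissible by blast
qed

end

theorem proposition4p25:
  fixes d1 d2 :: nat
    and B1 B2 :: "(nat \<Rightarrow> int) set"
    and C1 C2 :: "((nat \<Rightarrow> int) set \<times> nat) set"
  assumes "d1 \<ge> 1" and "d2 \<ge> 1"
    and "CARD('n::finite) = d1 + d2"
    and "rep_infinite_datumA d1 B1 C1"
    and "rep_infinite_datumA d2 B2 C2"
  shows "rep_infinite_AA TYPE('n)
    (tensor_algebra
      (algebraA d1 B1 C1 ::
        ('k::field, ((nat \<Rightarrow> int) set \<times> ((nat \<Rightarrow> int) set \<times> nat) list \<Rightarrow> 'k) set) module)
      (algebraA d2 B2 C2))"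
proof -
  interpret A1: type_A d1 B1 C1 by unfold_locales (fact assms)+
  interpret A2: type_A d2 B2 C2 by unfold_locales (fact assms)+
  let ?D = "{f. f \<circ> Inl \<in> A1.D \<and> f \<circ> Inr \<in> A2.D}"
  \<comment> \<open>Coordinates 1 to \<open>d1\<close> on the left, then 1 to \<open>d2\<close> on
    the right. By \<open>D_eq_0\<close> coordinate 0 may be omitted on either side, which leaves
    \<open>d1 + d2\<close> coordinates.\<close>
  let ?c = "\<lambda>k. if k < d1 then Inl (Suc k) else Inr (Suc (k - d1))"
  obtain vv :: "nat + nat \<Rightarrow> int ^ 'n" where vv: "?D = {\<lambda>x. m (vv x) | m. Modules.additive m}"
  proof (rule ex_basis[of ?D ?c])
    have "(0 :: nat + nat \<Rightarrow> int) \<circ> Inl = 0" "(0 :: nat + nat \<Rightarrow> int) \<circ> Inr = 0" by (rule ext, simp)+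
    then show "0 \<in> ?D" unfolding mem_Collect_eq using A1.D_zero A2.D_zero by (simp only: simp_thms)
    fix f g assume f: "f \<in> ?D" and g: "g \<in> ?D"
    have "(f - g) \<circ> Inl = (f \<circ> Inl) - (g \<circ> Inl)" "(f - g) \<circ> Inr = (f \<circ> Inr) - (g \<circ> Inr)" by (rule ext, simp)+
    then show "f - g \<in> ?D"
      using f g A1.D_diff[of "f \<circ> Inl" "g \<circ> Inl"] A2.D_diff[of "f \<circ> Inr" "g \<circ> Inr"]
      unfolding mem_Collect_eq by (simp only: simp_thms)
  next
    fix f assume f: "f \<in> ?D" and 0: "\<And>k. k < CARD('n) \<Longrightarrow> f (?c k) = 0"
    have e1: "f \<circ> Inl = 0"
    proof (rule A1.D_eq_0)
      show "f \<circ> Inl \<in> A1.D" using f by blast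
      fix i assume "1 \<le> i" "i \<le> d1"
      then have i: "i - 1 < CARD('n)" "i - 1 < d1" "Suc (i - 1) = i" using assms(3) by simp_all
      show "(f \<circ> Inl) i = 0" using 0[OF i(1)] unfolding if_P[OF i(2)] i(3) o_apply .
    qed
    have e2: "f \<circ> Inr = 0"
    proof (rule A2.D_eq_0)
      show "f \<circ> Inr \<in> A2.D" using f by blast
      fix i assume "1 \<le> i" "i \<le> d2"
      then have i: "d1 + i - 1 < CARD('n)" "\<not> d1 + i - 1 < d1" "Suc (d1 + i - 1 - d1) = i"
        using assms(3) by simp_all
      show "(f \<circ> Inr) i = 0" using 0[OF i(1)] unfolding if_not_P[OF i(2)] i(3) o_apply .
    qed
    show "f = 0"
    proof (rule ext)
      fix x show "f x = 0 x"
      proof (cases x)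
        case (Inl i)
        then show ?thesis using fun_cong[OF e1, of i] by (simp only: o_apply zero_fun_apply)
      next
        case (Inr i)
        then show ?thesis using fun_cong[OF e2, of i] by (simp only: o_apply zero_fun_apply)
      qed
    qed
  next
    fix w :: "nat + nat \<Rightarrow> int ^ 'n"
    assume "?D = {\<lambda>x. m (w x) | m. Modules.additive m}"
    then show thesis by (rule that)
  qed
  interpret AA_datum d1 B1 C1 d2 B2 C2 vv
    by unfold_locales (fact assms vv)+
  show ?thesis by (rule rep_infinite_AA_tensor)
qed

end
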